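(* Every finitely satisfiable two-variable $\mathrm{UNFO}{+}\mathcal{S}$ formula $\phi$ has a finite (admissible) model of size bounded triply exponentially in $|\phi|$, i.e. of size at most $2^{2^{2^{p(|\phi|)}}}$ for some fixed polynomial $p$.
   Context: Signatures are purely relational, $\sigma=\sigma_{\mathrm{base}}\cup\sigma_{\mathrm{dist}}$ with $\sigma_{\mathrm{dist}}=\{T_1,\dots,T_{2k}\}$ binary. $\mathrm{UNFO}$ formulas are given by $\phi ::= B\bar x \mid x=y \mid \phi\wedge\phi \mid \phi\vee\phi \mid \exists x\,\phi \mid \neg\phi(x)$, where in the last clause $\phi$ has at most the free variable $x$. $\mathrm{UNFO}{+}\mathcal{S}$ has the same syntax, but admissible structures must interpret each $T_u$ as a transitive relation and $T_{2u}$ as the inverse of $T_{2u-1}$ ($1\le u\le k$). A two-variable formula uses only the variables $x,y$; in the two-variable setting formulas use only relation symbols of arity at most $2$. $|\phi|$ is the length of $\phi$. *)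

theory Defs
  imports Main "HOL-Computational_Algebra.Polynomial"
begin

datatype symbol = Base nat | T nat

record signature =
  base_symbols :: "nat set"
  base_arity :: "nat \<Rightarrow> nat"
  pairs :: nat

definition symbols :: "signature \<Rightarrow> symbol set" where
  "symbols \<sigma> = Base ` base_symbols \<sigma> \<union> T ` {1..2 * pairs \<sigma>}"

fun arity :: "signature \<Rightarrow> symbol \<Rightarrow> nat" where
  "arity \<sigma> (Base b) = base_arity \<sigma> b"
| "arity \<sigma> (T u) = 2"

text \<open>Variables are natural numbers; the two variables \<open>x\<close>, \<open>y\<close> of two-variable formulas
  are \<open>0\<close> and \<open>1\<close>.\<close>

datatype fm =
    Atom symbol "nat list"
  | Eq nat nat
  | And fm fm
  | Or fm fm
  | Exists nat fm
  | Neg fm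

primrec free_vars :: "fm \<Rightarrow> nat set" where
  "free_vars (Atom R xs) = set xs"
| "free_vars (Eq x y) = {x, y}"
| "free_vars (And \<phi> \<psi>) = free_vars \<phi> \<union> free_vars \<psi>"
| "free_vars (Or \<phi> \<psi>) = free_vars \<phi> \<union> free_vars \<psi>"
| "free_vars (Exists x \<phi>) = free_vars \<phi> - {x}"
| "free_vars (Neg \<phi>) = free_vars \<phi>"

primrec all_vars :: "fm \<Rightarrow> nat set" where
  "all_vars (Atom R xs) = set xs"
| "all_vars (Eq x y) = {x, y}"
| "all_vars (And \<phi> \<psi>) = all_vars \<phi> \<union> all_vars \<psi>"
| "all_vars (Or \<phi> \<psi>) = all_vars \<phi> \<union> all_vars \<psi>"
| "all_vars (Exists x \<phi>) = insert x (all_vars \<phi>)"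
| "all_vars (Neg \<phi>) = all_vars \<phi>"

primrec fm_symbols :: "fm \<Rightarrow> symbol set" where
  "fm_symbols (Atom R xs) = {R}"
| "fm_symbols (Eq x y) = {}"
| "fm_symbols (And \<phi> \<psi>) = fm_symbols \<phi> \<union> fm_symbols \<psi>"
| "fm_symbols (Or \<phi> \<psi>) = fm_symbols \<phi> \<union> fm_symbols \<psi>"
| "fm_symbols (Exists x \<phi>) = fm_symbols \<phi>"
| "fm_symbols (Neg \<phi>) = fm_symbols \<phi>"

text \<open>The length counts occurrences of relation symbols, variables, equality signs, connectives
  and quantifiers, each with weight one.\<close>

primrec fm_length :: "fm \<Rightarrow> nat" where
  "fm_length (Atom R xs) = 1 + length xs"
| "fm_length (Eq x y) = 3"
| "fm_length (And \<phi> \<psi>) = 1 + fm_length \<phi> + fm_length \<psi>"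
| "fm_length (Or \<phi> \<psi>) = 1 + fm_length \<phi> + fm_length \<psi>"
| "fm_length (Exists x \<phi>) = 2 + fm_length \<phi>"
| "fm_length (Neg \<phi>) = 1 + fm_length \<phi>"

primrec unfo :: "signature \<Rightarrow> fm \<Rightarrow> bool" where
  "unfo \<sigma> (Atom R xs) \<longleftrightarrow> R \<in> symbols \<sigma> \<and> length xs = arity \<sigma> R"
| "unfo \<sigma> (Eq x y) \<longleftrightarrow> True"
| "unfo \<sigma> (And \<phi> \<psi>) \<longleftrightarrow> unfo \<sigma> \<phi> \<and> unfo \<sigma> \<psi>"
| "unfo \<sigma> (Or \<phi> \<psi>) \<longleftrightarrow> unfo \<sigma> \<phi> \<and> unfo \<sigma> \<psi>"
| "unfo \<sigma> (Exists x \<phi>) \<longleftrightarrow> unfo \<sigma> \<phi>"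
| "unfo \<sigma> (Neg \<phi>) \<longleftrightarrow> unfo \<sigma> \<phi> \<and> (\<exists>x. free_vars \<phi> \<subseteq> {x})"

definition two_variable :: "signature \<Rightarrow> fm \<Rightarrow> bool" where
  "two_variable \<sigma> \<phi> \<longleftrightarrow>
     all_vars \<phi> \<subseteq> {0, 1} \<and> (\<forall>R\<in>fm_symbols \<phi>. arity \<sigma> R \<le> 2)"

record 'a struct =
  universe :: "'a set"
  interp :: "symbol \<Rightarrow> 'a list set"

definition is_struct :: "signature \<Rightarrow> 'a struct \<Rightarrow> bool" where
  "is_struct \<sigma> A \<longleftrightarrow> universe A \<noteq> {} \<and>
     (\<forall>R\<in>symbols \<sigma>. interp A R \<subseteq> {as. set as \<subseteq> universe A \<and> length as = arity \<sigma> R})"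

definition T_rel :: "'a struct \<Rightarrow> nat \<Rightarrow> ('a \<times> 'a) set" where
  "T_rel A u = {(a, b). [a, b] \<in> interp A (T u)}"

definition admissible :: "signature \<Rightarrow> 'a struct \<Rightarrow> bool" where
  "admissible \<sigma> A \<longleftrightarrow> is_struct \<sigma> A \<and>
     (\<forall>u\<in>{1..2 * pairs \<sigma>}. trans (T_rel A u)) \<and>
     (\<forall>u\<in>{1..pairs \<sigma>}. T_rel A (2 * u) = (T_rel A (2 * u - 1))\<inverse>)"

primrec sat :: "'a struct \<Rightarrow> (nat \<Rightarrow> 'a) \<Rightarrow> fm \<Rightarrow> bool" where
  "sat A v (Atom R xs) \<longleftrightarrow> map v xs \<in> interp A R"
| "sat A v (Eq x y) \<longleftrightarrow> v x = v y"
| "sat A v (And \<phi> \<psi>) \<longleftrightarrow> sat A v \<phi> \<and> sat A v \<psi>"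
| "sat A v (Or \<phi> \<psi>) \<longleftrightarrow> sat A v \<phi> \<or> sat A v \<psi>"
| "sat A v (Exists x \<phi>) \<longleftrightarrow> (\<exists>a\<in>universe A. sat A (v(x := a)) \<phi>)"
| "sat A v (Neg \<phi>) \<longleftrightarrow> \<not> sat A v \<phi>"

text \<open>Free variables, if any, are read existentially.\<close>

definition admissible_model :: "signature \<Rightarrow> 'a struct \<Rightarrow> fm \<Rightarrow> bool" where
  "admissible_model \<sigma> A \<phi> \<longleftrightarrow>
     admissible \<sigma> A \<and> (\<exists>v. range v \<subseteq> universe A \<and> sat A v \<phi>)"

text \<open>Restricting universes to sets of natural numbers loses no finite structure up to
  isomorphism; see \<open>finitely_satisfiableI\<close> below.\<close>

definition finitely_satisfiable :: "signature \<Rightarrow> fm \<Rightarrow> bool" where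
  "finitely_satisfiable \<sigma> \<phi> \<longleftrightarrow>
     (\<exists>A :: nat struct. admissible_model \<sigma> A \<phi> \<and> finite (universe A))"

definition map_struct :: "('a \<Rightarrow> 'b) \<Rightarrow> 'a struct \<Rightarrow> 'b struct" where
  "map_struct f A = \<lparr>universe = f ` universe A, interp = (\<lambda>R. map f ` interp A R)\<rparr>"

lemma sat_map_struct:
  assumes A: "is_struct \<sigma> A" and f: "inj_on f (universe A)"
  shows "unfo \<sigma> \<phi> \<Longrightarrow> range v \<subseteq> universe A \<Longrightarrow> sat (map_struct f A) (f \<circ> v) \<phi> \<longleftrightarrow> sat A v \<phi>"
proof (induction \<phi> arbitrary: v)
  case (Atom R xs)
  have "inj_on (map f) (lists (universe A))"
    using f by (simp add: inj_on_mapI inj_on_map_lists)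
  moreover have "interp A R \<subseteq> lists (universe A)"
    using A Atom.prems by (fastforce simp: is_struct_def)
  moreover have "map v xs \<in> lists (universe A)"
    using Atom.prems by (auto simp: image_subset_iff)
  ultimately have "map f (map v xs) \<in> map f ` interp A R \<longleftrightarrow> map v xs \<in> interp A R"
    by (metis inj_on_image_mem_iff)
  then show ?case by (simp add: map_struct_def comp_def)
next
  case (Eq x y)
  then show ?case using f by (auto simp: inj_on_def image_subset_iff)
next
  case (Exists x \<phi>)
  have "sat (map_struct f A) ((f \<circ> v)(x := f a)) \<phi> \<longleftrightarrow> sat A (v(x := a)) \<phi>"
    if "a \<in> universe A" for a
  proof -
    have "range (v(x := a)) \<subseteq> universe A" using Exists.prems that by auto
    then have "sat (map_struct f A) (f \<circ> v(x := a)) \<phi> \<longleftrightarrow> sat A (v(x := a)) \<phi>"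
      using Exists.IH[of "v(x := a)"] Exists.prems(1) unfolding unfo.simps by blast
    then show ?thesis by (metis fun_upd_comp)
  qed
  then show ?case by (simp add: map_struct_def comp_def)
qed auto

lemma T_rel_map_struct:
  "T_rel (map_struct f A) u = map_prod f f ` T_rel A u"
  by (force simp: T_rel_def map_struct_def map_eq_Cons_conv Cons_eq_map_conv image_iff)

lemma admissible_map_struct:
  assumes A: "admissible \<sigma> A" and f: "inj_on f (universe A)"
  shows "admissible \<sigma> (map_struct f A)"
proof -
  have st: "is_struct \<sigma> A" using A by (simp add: admissible_def)
  have "is_struct \<sigma> (map_struct f A)"
    using st by (fastforce simp: is_struct_def map_struct_def)
  moreover have "trans (T_rel (map_struct f A) u)" if u: "u \<in> {1..2 * pairs \<sigma>}" for u
  proof -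
    have t: "trans (T_rel A u)" using A u by (simp add: admissible_def)
    have "T u \<in> symbols \<sigma>" using u by (simp add: symbols_def)
    then have "interp A (T u) \<subseteq> {as. set as \<subseteq> universe A \<and> length as = arity \<sigma> (T u)}"
      using st unfolding is_struct_def by blast
    then have sub: "T_rel A u \<subseteq> universe A \<times> universe A"
      by (auto simp: T_rel_def)
    show ?thesis unfolding T_rel_map_struct
    proof (rule transI)
      fix x y z
      assume "(x, y) \<in> map_prod f f ` T_rel A u" "(y, z) \<in> map_prod f f ` T_rel A u"
      then obtain a b c d where "(a, b) \<in> T_rel A u" "(c, d) \<in> T_rel A u"
        and e: "x = f a" "y = f b" "y = f c" "z = f d" by auto
      moreover from this have "b = c" using f sub by (auto simp: inj_on_def)
      ultimately have "(a, d) \<in> T_rel A u" using t by (auto dest: transD)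
      then show "(x, z) \<in> map_prod f f ` T_rel A u" using e by force
    qed
  qed
  moreover have "T_rel (map_struct f A) (2 * u) = (T_rel (map_struct f A) (2 * u - 1))\<inverse>"
    if "u \<in> {1..pairs \<sigma>}" for u
  proof -
    have "T_rel A (2 * u) = (T_rel A (2 * u - 1))\<inverse>" using A that by (simp add: admissible_def)
    then show ?thesis unfolding T_rel_map_struct by force
  qed
  ultimately show ?thesis by (simp add: admissible_def)
qed

lemma finitely_satisfiableI:
  fixes A :: "'a struct"
  assumes "unfo \<sigma> \<phi>" and A: "admissible_model \<sigma> A \<phi>" and fin: "finite (universe A)"
  shows "finitely_satisfiable \<sigma> \<phi>"
proof -
  obtain f :: "'a \<Rightarrow> nat" where f: "inj_on f (universe A)"
    using finite_imp_inj_to_nat_seg[OF fin] by blast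
  obtain v where v: "range v \<subseteq> universe A" "sat A v \<phi>" and ad: "admissible \<sigma> A"
    using A by (auto simp: admissible_model_def)
  have "sat (map_struct f A) (f \<circ> v) \<phi>"
    using sat_map_struct[OF _ f assms(1) v(1)] v(2) ad by (simp add: admissible_def)
  moreover have "range (f \<circ> v) \<subseteq> universe (map_struct f A)"
    using v(1) by (auto simp: map_struct_def)
  ultimately have "admissible_model \<sigma> (map_struct f A) \<phi>"
    using admissible_map_struct[OF ad f] unfolding admissible_model_def by blast
  then show ?thesis
    using fin by (auto simp: finitely_satisfiable_def map_struct_def)
qed

end

theory Submission imports Defs begin

text \<open>
  A finite model \<open>A\<close> is replaced by a small structure in which every pair of elements is locally
  homomorphic to a pair of elements of \<open>A\<close> with the same one-variable types, and in which every
  element has the witnesses its type asks for; both together preserve UNFO formulas with two variables.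

  Call labels the indices of the transitive relations occurring in the formula. Transitivity is
  controlled by enriched types, which record for every set \<open>V\<close> of directed labels the types that are
  \<open>V\<close>-reachable; the relation \<open>arrow V\<close> on enriched types is itself transitive. By induction on the
  number of labels outside \<open>S\<close> one treats sets \<open>C\<close> on which all relations in \<open>S\<close> are total. One
  unravels \<open>C\<close> into a forest whose blocks at a given level are approximations, known by induction, of
  strongly connected components for one further label \<open>u\<close>. Leaving such a block along \<open>u\<close> one moves
  strictly upwards, and choosing each witness as high as possible inside its enriched type makes the
  enriched types along the path pairwise distinct; hence \<open>u\<close>-paths die out after boundedly many levels.
  So it suffices that an element remembers a bounded part of its history and its level modulo a constant:
  this finite quotient looks, within the range of any path, like the forest.
\<close>


section \<open>Enriched types and approximations\<close>

text \<open>Why sets \<open>V\<close>: two elements of the structure built may be joined by paths of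
  several relations at once, and a single pair of \<open>A\<close> has to realise all of them. Types
  that treat labels one by one would give each label its own target. In a forest all paths between
  two elements cross the same tree edges, so one arrow for the whole of \<open>V\<close> can be
  composed, whatever detours the labels make. Closing a finite structure transitively might also
  create paths around the cycle of levels that mean nothing in \<open>A\<close>; this is why paths
  must die out. A block absorbs only one further label while paths of the others climb through it,
  so the labels take turns over the levels. Origin of the bound: types are sets of linearly many
  formulas, so the number of enriched types, and with it the modulus \<open>m\<close>, is doubly
  exponential. One induction step turns a bound \<open>B\<close> into
  \<open>(q * B) ^ (m + 1)\<close>, which multiplies the exponent of \<open>q\<close> by at most
  \<open>2 * (m + 1)\<close>. There are no more labels than the formula is long, so the exponent
  stays doubly exponential.\<close>

definition dirrel :: "('l \<Rightarrow> 'a \<Rightarrow> 'a \<Rightarrow> bool) \<Rightarrow> 'l \<times> bool \<Rightarrow> 'a \<Rightarrow> 'a \<Rightarrow> bool" where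
  "dirrel R v x y \<longleftrightarrow> (if snd v then R (fst v) x y else R (fst v) y x)"

definition flip :: "'l \<times> bool \<Rightarrow> 'l \<times> bool" where
  "flip v = (fst v, \<not> snd v)"

lemma dirrel_flip: "dirrel R (flip v) x y \<longleftrightarrow> dirrel R v y x"
  by (simp add: dirrel_def flip_def)

lemma flip_simps [simp]: "fst (flip v) = fst v" "flip (flip v) = v"
  by (simp_all add: flip_def)

text \<open>
  \<open>R\<close> collects the transitive relations, \<open>Q\<close> the remaining binary ones, and \<open>wt i a\<close> is a witness
  for the \<open>i\<close>-th demand at \<open>a\<close>; if there is no such demand, then \<open>wt i a = a\<close>.
\<close>

locale colored_relations =
  fixes A :: "'a set" and I :: "nat set" and R :: "nat \<Rightarrow> 'a \<Rightarrow> 'a \<Rightarrow> bool"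
    and Q :: "'q \<Rightarrow> 'a \<Rightarrow> 'a \<Rightarrow> bool" and tp :: "'a \<Rightarrow> 't"
    and wt :: "nat \<Rightarrow> 'a \<Rightarrow> 'a" and n :: nat
  assumes fin_A: "finite A" and fin_I: "finite I"
    and trans_R: "l \<in> I \<Longrightarrow> R l a b \<Longrightarrow> R l b c \<Longrightarrow> R l a c"
begin

lemma trans_dirrel: "fst v \<in> I \<Longrightarrow> dirrel R v a b \<Longrightarrow> dirrel R v b c \<Longrightarrow> dirrel R v a c"
  by (auto simp: dirrel_def intro: trans_R split: if_splits)

text \<open>The targets range over all of \<open>A\<close>, not over the class at hand, so one
  notion of type and one bound on the number of types serve the whole induction.\<close>

definition etype :: "'a \<Rightarrow> 't \<times> ((nat \<times> bool) set \<times> 't) set" where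
  "etype a = (tp a, {(V, tp b) | V b. V \<subseteq> I \<times> UNIV \<and> b \<in> A \<and> (\<forall>v\<in>V. dirrel R v a b)})"

text \<open>The second clause is what remains of transitivity when elements are forgotten:
  reachability is inherited backwards, so arrows compose even where a representative has replaced
  the element actually reached.\<close>

definition arrow ::
  "(nat \<times> bool) set \<Rightarrow> 't \<times> ((nat \<times> bool) set \<times> 't) set \<Rightarrow> 't \<times> ((nat \<times> bool) set \<times> 't) set \<Rightarrow> bool"
  where "arrow V e e' \<longleftrightarrow> (V, fst e') \<in> snd e \<and> (\<forall>t. (V, t) \<in> snd e' \<longrightarrow> (V, t) \<in> snd e)"

lemma arrow_trans: "arrow V e e' \<Longrightarrow> arrow V e' e'' \<Longrightarrow> arrow V e e''"
  by (auto simp: arrow_def)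

lemma tp_etype: "etype a = etype b \<Longrightarrow> tp a = tp b"
  by (simp add: etype_def)

lemma arrow_etype:
  assumes "V \<subseteq> I \<times> UNIV" "b \<in> A" "\<And>v. v \<in> V \<Longrightarrow> dirrel R v a b"
  shows "arrow V (etype a) (etype b)"
proof -
  have "dirrel R v a c" if "v \<in> V" "\<forall>v\<in>V. dirrel R v b c" for v c
    using that assms trans_dirrel[of v a b c] by auto
  then show ?thesis using assms unfolding arrow_def etype_def by auto
qed

text \<open>The way back from types to elements. The target is common to all labels of
  \<open>V\<close>; only its type is prescribed, not its enriched type.\<close>

lemma arrow_etypeE:
  assumes "arrow V (etype a) (etype b)"
  obtains b' where "b' \<in> A" "tp b' = tp b" "\<And>v. v \<in> V \<Longrightarrow> dirrel R v a b'"
proof -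
  have "(V, tp b) \<in> snd (etype a)" using assms by (simp add: arrow_def etype_def)
  then show ?thesis using that unfolding etype_def by auto
qed

text \<open>Pairs are controlled twice: by arrows, which compose and feed the next stage of the
  induction, and by realising pairs of \<open>A\<close>, which also cover the relations
  \<open>Q\<close>. Demands whose witness lies outside \<open>C\<close> stay open and are served by
  child blocks. The clause \<open>y = x\<close> protects equality atoms.\<close>

definition approx :: "nat set \<Rightarrow> 'a set \<Rightarrow> 'k set \<Rightarrow> ('k \<Rightarrow> 'a) \<Rightarrow> (nat \<Rightarrow> 'k \<Rightarrow> 'k \<Rightarrow> bool)
    \<Rightarrow> ('q \<Rightarrow> 'k \<Rightarrow> 'k \<Rightarrow> bool) \<Rightarrow> bool" where
  "approx S C K p R' Q' \<longleftrightarrow> finite K \<and> p ` K \<subseteq> C \<and>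
    (\<forall>l\<in>I. \<forall>x\<in>K. \<forall>y\<in>K. \<forall>z\<in>K. R' l x y \<longrightarrow> R' l y z \<longrightarrow> R' l x z) \<and>
    (\<forall>l\<in>S. \<forall>x\<in>K. \<forall>y\<in>K. x \<noteq> y \<longrightarrow> R' l x y) \<and>
    (\<forall>l\<in>I. \<forall>x\<in>K. R' l x x \<longleftrightarrow> R l (p x) (p x)) \<and>
    (\<forall>q. \<forall>x\<in>K. Q' q x x \<longleftrightarrow> Q q (p x) (p x)) \<and>
    (\<forall>x\<in>K. \<forall>y\<in>K. \<forall>V. x \<noteq> y \<longrightarrow> V \<subseteq> I \<times> UNIV \<longrightarrow> (\<forall>v\<in>V. dirrel R' v x y) \<longrightarrow>
       arrow V (etype (p x)) (etype (p y))) \<and>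
    (\<forall>x\<in>K. \<forall>y\<in>K. x \<noteq> y \<longrightarrow> (\<exists>a\<in>A. \<exists>b\<in>A. tp a = tp (p x) \<and> tp b = tp (p y) \<and>
       (\<forall>v\<in>I \<times> UNIV. dirrel R' v x y \<longrightarrow> dirrel R v a b) \<and> (\<forall>w. dirrel Q' w x y \<longrightarrow> dirrel Q w a b))) \<and>
    (\<forall>x\<in>K. \<forall>i<n. wt i (p x) \<in> C \<longrightarrow> (\<exists>y\<in>K. tp (p y) = tp (wt i (p x)) \<and>
       (wt i (p x) = p x \<longrightarrow> y = x) \<and>
       (\<forall>v\<in>I \<times> UNIV. dirrel R v (p x) (wt i (p x)) \<longrightarrow> dirrel R' v x y) \<and>
       (\<forall>w. dirrel Q w (p x) (wt i (p x)) \<longrightarrow> dirrel Q' w x y)))"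

lemma approxD:
  assumes "approx S C K p R' Q'"
  shows "finite K" "x \<in> K \<Longrightarrow> p x \<in> C"
    "l \<in> I \<Longrightarrow> x \<in> K \<Longrightarrow> y \<in> K \<Longrightarrow> z \<in> K \<Longrightarrow> R' l x y \<Longrightarrow> R' l y z \<Longrightarrow> R' l x z"
    "l \<in> S \<Longrightarrow> x \<in> K \<Longrightarrow> y \<in> K \<Longrightarrow> x \<noteq> y \<Longrightarrow> R' l x y"
    "l \<in> I \<Longrightarrow> x \<in> K \<Longrightarrow> R' l x x \<longleftrightarrow> R l (p x) (p x)"
    "x \<in> K \<Longrightarrow> Q' q x x \<longleftrightarrow> Q q (p x) (p x)"
    "x \<in> K \<Longrightarrow> y \<in> K \<Longrightarrow> x \<noteq> y \<Longrightarrow> V \<subseteq> I \<times> UNIV \<Longrightarrow> (\<And>v. v \<in> V \<Longrightarrow> dirrel R' v x y) \<Longrightarrow>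
       arrow V (etype (p x)) (etype (p y))"
    "x \<in> K \<Longrightarrow> y \<in> K \<Longrightarrow> x \<noteq> y \<Longrightarrow> \<exists>a\<in>A. \<exists>b\<in>A. tp a = tp (p x) \<and> tp b = tp (p y) \<and>
       (\<forall>v\<in>I \<times> UNIV. dirrel R' v x y \<longrightarrow> dirrel R v a b) \<and> (\<forall>w. dirrel Q' w x y \<longrightarrow> dirrel Q w a b)"
    "x \<in> K \<Longrightarrow> i < n \<Longrightarrow> wt i (p x) \<in> C \<Longrightarrow> \<exists>y\<in>K. tp (p y) = tp (wt i (p x)) \<and>
       (wt i (p x) = p x \<longrightarrow> y = x) \<and>
       (\<forall>v\<in>I \<times> UNIV. dirrel R v (p x) (wt i (p x)) \<longrightarrow> dirrel R' v x y) \<and>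
       (\<forall>w. dirrel Q w (p x) (wt i (p x)) \<longrightarrow> dirrel Q' w x y)"
proof -
  note c = assms[unfolded approx_def]
  show "finite K" using c[THEN conjunct1] .
  show "x \<in> K \<Longrightarrow> p x \<in> C" using c[THEN conjunct2, THEN conjunct1] by blast
  show "l \<in> I \<Longrightarrow> x \<in> K \<Longrightarrow> y \<in> K \<Longrightarrow> z \<in> K \<Longrightarrow> R' l x y \<Longrightarrow> R' l y z \<Longrightarrow> R' l x z"
    using c[THEN conjunct2, THEN conjunct2, THEN conjunct1] by blast
  show "l \<in> S \<Longrightarrow> x \<in> K \<Longrightarrow> y \<in> K \<Longrightarrow> x \<noteq> y \<Longrightarrow> R' l x y"
    using c[THEN conjunct2, THEN conjunct2, THEN conjunct2, THEN conjunct1] by blast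
  show "l \<in> I \<Longrightarrow> x \<in> K \<Longrightarrow> R' l x x \<longleftrightarrow> R l (p x) (p x)"
    using c[THEN conjunct2, THEN conjunct2, THEN conjunct2, THEN conjunct2, THEN conjunct1] by simp
  show "x \<in> K \<Longrightarrow> Q' q x x \<longleftrightarrow> Q q (p x) (p x)"
    using c[THEN conjunct2, THEN conjunct2, THEN conjunct2, THEN conjunct2, THEN conjunct2, THEN conjunct1] by simp
  show "x \<in> K \<Longrightarrow> y \<in> K \<Longrightarrow> x \<noteq> y \<Longrightarrow> V \<subseteq> I \<times> UNIV \<Longrightarrow> (\<And>v. v \<in> V \<Longrightarrow> dirrel R' v x y) \<Longrightarrow>
       arrow V (etype (p x)) (etype (p y))"
    using c[THEN conjunct2, THEN conjunct2, THEN conjunct2, THEN conjunct2, THEN conjunct2, THEN conjunct2, THEN conjunct1] by simp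
  show "x \<in> K \<Longrightarrow> y \<in> K \<Longrightarrow> x \<noteq> y \<Longrightarrow> \<exists>a\<in>A. \<exists>b\<in>A. tp a = tp (p x) \<and> tp b = tp (p y) \<and>
       (\<forall>v\<in>I \<times> UNIV. dirrel R' v x y \<longrightarrow> dirrel R v a b) \<and> (\<forall>w. dirrel Q' w x y \<longrightarrow> dirrel Q w a b)"
    using c[THEN conjunct2, THEN conjunct2, THEN conjunct2, THEN conjunct2, THEN conjunct2, THEN conjunct2, THEN conjunct2, THEN conjunct1] by simp
  show "x \<in> K \<Longrightarrow> i < n \<Longrightarrow> wt i (p x) \<in> C \<Longrightarrow> \<exists>y\<in>K. tp (p y) = tp (wt i (p x)) \<and>
       (wt i (p x) = p x \<longrightarrow> y = x) \<and>
       (\<forall>v\<in>I \<times> UNIV. dirrel R v (p x) (wt i (p x)) \<longrightarrow> dirrel R' v x y) \<and>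
       (\<forall>w. dirrel Q w (p x) (wt i (p x)) \<longrightarrow> dirrel Q' w x y)"
    using c[THEN conjunct2, THEN conjunct2, THEN conjunct2, THEN conjunct2, THEN conjunct2, THEN conjunct2, THEN conjunct2, THEN conjunct2] by simp
qed

lemma approx_mono: "approx S' C K p R' Q' \<Longrightarrow> S \<subseteq> S' \<Longrightarrow> approx S C K p R' Q'"
  unfolding approx_def by (elim conjE, intro conjI; (assumption | blast))

lemma approx_singleton: "approx S {a} {k} (\<lambda>_. a) (\<lambda>l _ _. R l a a) (\<lambda>q _ _. Q q a a)"
  unfolding approx_def by (auto simp: dirrel_def)

text \<open>For renumbering a carrier as an initial segment of \<open>nat\<close>: all blocks of the
  next stage must live over one fixed type.\<close>

lemma approx_transport:
  assumes ap: "approx S C K p R' Q'" and f: "bij_betw f L K"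
  shows "approx S C L (p \<circ> f) (\<lambda>l x y. R' l (f x) (f y)) (\<lambda>q x y. Q' q (f x) (f y))"
proof -
  have K: "K = f ` L" and inj: "\<And>x y. x \<in> L \<Longrightarrow> y \<in> L \<Longrightarrow> f x = f y \<longleftrightarrow> x = y"
    using f by (auto simp: bij_betw_def inj_on_def)
  have fin: "finite L" using approxD(1)[OF ap] f bij_betw_finite by blast
  have [simp]: "dirrel (\<lambda>l x y. R' l (f x) (f y)) v x y = dirrel R' v (f x) (f y)"
    "dirrel (\<lambda>q x y. Q' q (f x) (f y)) w x y = dirrel Q' w (f x) (f y)" for v w x y
    by (simp_all add: dirrel_def)
  have fL: "x \<in> L \<Longrightarrow> f x \<in> K" for x using K by blast
  note D = approxD[OF ap]
  show ?thesis unfolding approx_def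
  proof (intro conjI ballI allI impI; (elim conjE)?)
    fix x y assume "x \<in> L" "y \<in> L" "x \<noteq> y"
    then show "\<exists>a\<in>A. \<exists>b\<in>A. tp a = tp ((p \<circ> f) x) \<and> tp b = tp ((p \<circ> f) y) \<and>
       (\<forall>v\<in>I \<times> UNIV. dirrel (\<lambda>l x y. R' l (f x) (f y)) v x y \<longrightarrow> dirrel R v a b) \<and>
       (\<forall>w. dirrel (\<lambda>q x y. Q' q (f x) (f y)) w x y \<longrightarrow> dirrel Q w a b)"
      using D(8)[of "f x" "f y"] by (simp add: fL inj)
  next
    fix x i assume "x \<in> L" "i < n" "wt i ((p \<circ> f) x) \<in> C"
    then obtain y where "y \<in> L" "tp (p (f y)) = tp (wt i (p (f x)))"
       "wt i (p (f x)) = p (f x) \<longrightarrow> f y = f x"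
       "\<forall>v\<in>I \<times> UNIV. dirrel R v (p (f x)) (wt i (p (f x))) \<longrightarrow> dirrel R' v (f x) (f y)"
       "\<forall>w. dirrel Q w (p (f x)) (wt i (p (f x))) \<longrightarrow> dirrel Q' w (f x) (f y)"
      using D(9)[of "f x" i] unfolding K by auto
    then show "\<exists>y\<in>L. tp ((p \<circ> f) y) = tp (wt i ((p \<circ> f) x)) \<and>
       (wt i ((p \<circ> f) x) = (p \<circ> f) x \<longrightarrow> y = x) \<and>
       (\<forall>v\<in>I \<times> UNIV. dirrel R v ((p \<circ> f) x) (wt i ((p \<circ> f) x)) \<longrightarrow>
          dirrel (\<lambda>l x y. R' l (f x) (f y)) v x y) \<and>
       (\<forall>w. dirrel Q w ((p \<circ> f) x) (wt i ((p \<circ> f) x)) \<longrightarrow> dirrel (\<lambda>q x y. Q' q (f x) (f y)) w x y)"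
      using \<open>x \<in> L\<close> by (intro bexI[of _ y]) (simp_all add: inj)
  next
    fix l x y z assume "l \<in> I" "x \<in> L" "y \<in> L" "z \<in> L" "R' l (f x) (f y)" "R' l (f y) (f z)"
    then show "R' l (f x) (f z)" using D(3) fL by blast
  next
    show "(p \<circ> f) ` L \<subseteq> C" using D(2) fL by auto
  next
    fix x y V assume "x \<in> L" "y \<in> L" "x \<noteq> y" "V \<subseteq> I \<times> UNIV"
      "\<forall>v\<in>V. dirrel (\<lambda>l x y. R' l (f x) (f y)) v x y"
    then show "arrow V (etype ((p \<circ> f) x)) (etype ((p \<circ> f) y))"
      using D(7)[of "f x" "f y" V] fL inj by simp
  qed (simp_all add: fin fL D(4-6) inj)
qed

end

section \<open>The forest of blocks\<close>

text \<open>
  The block at level \<open>z\<close> with state \<open>s\<close> is the structure \<open>Kc z s\<close> with origin \<open>Ko z s\<close>; it approximates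
  the subset \<open>D z s\<close> of \<open>C\<close>. A witness \<open>b\<close> outside \<open>D z s\<close> for an element over \<open>c\<close> opens a child block at
  the next level with state \<open>rep z c b\<close>. A history is a list of letters \<open>(s, x, i)\<close>, most recent first: the
  state of the block that was left, the element at which it was left, and the demand that was served.
\<close>

locale layered = colored_relations A I R Q tp wt n
  for A :: "'a set" and I :: "nat set" and R :: "nat \<Rightarrow> 'a \<Rightarrow> 'a \<Rightarrow> bool"
    and Q :: "'q \<Rightarrow> 'a \<Rightarrow> 'a \<Rightarrow> bool" and tp :: "'a \<Rightarrow> 't"
    and wt :: "nat \<Rightarrow> 'a \<Rightarrow> 'a" and n :: nat +
  fixes S :: "nat set" and C :: "'a set" and M :: nat and D :: "nat \<Rightarrow> 'a \<Rightarrow> 'a set"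
    and Kc :: "nat \<Rightarrow> 'a \<Rightarrow> nat set" and Kp :: "nat \<Rightarrow> 'a \<Rightarrow> nat \<Rightarrow> 'a"
    and KR :: "nat \<Rightarrow> 'a \<Rightarrow> nat \<Rightarrow> nat \<Rightarrow> nat \<Rightarrow> bool"
    and KQ :: "nat \<Rightarrow> 'a \<Rightarrow> 'q \<Rightarrow> nat \<Rightarrow> nat \<Rightarrow> bool"
    and Ko :: "nat \<Rightarrow> 'a \<Rightarrow> nat" and rep :: "nat \<Rightarrow> 'a \<Rightarrow> 'a \<Rightarrow> 'a" and St :: "'a set"
  assumes S_I: "S \<subseteq> I" and C_A: "C \<subseteq> A"
    and tot: "l \<in> S \<Longrightarrow> a \<in> C \<Longrightarrow> b \<in> C \<Longrightarrow> R l a b"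
    and M_ge: "2 \<le> M" and St_C: "St \<subseteq> C" and fin_St: "finite St"
    and ap: "s \<in> St \<Longrightarrow> approx S (D z s) (Kc z s) (Kp z s) (KR z s) (KQ z s)"
    and D_C: "s \<in> St \<Longrightarrow> D z s \<subseteq> C"
    and Ko_in: "s \<in> St \<Longrightarrow> Ko z s \<in> Kc z s" and Kp_Ko: "s \<in> St \<Longrightarrow> Kp z s (Ko z s) = s"
    and rep_St: "b \<in> C \<Longrightarrow> rep z c b \<in> St" and etype_rep: "b \<in> C \<Longrightarrow> etype (rep z c b) = etype b"
    and kill: "fst v \<in> I - S \<Longrightarrow>
      (\<And>j. j < M \<Longrightarrow> ss j \<in> St \<and> cs j \<in> D ((z + j) mod (2 * M)) (ss j) \<and>
         bs j \<in> C - D ((z + j) mod (2 * M)) (ss j) \<and>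
         ss (Suc j) = rep ((z + j) mod (2 * M)) (cs j) (bs j) \<and> dirrel R v (cs j) (bs j)) \<Longrightarrow> False"
begin

text \<open>Twice the height \<open>M\<close> that no path can gain or lose: a path starting in the
  middle of a window of \<open>m\<close> levels cannot reach either end.\<close>

definition m :: nat where "m = 2 * M"

lemma m_pos: "0 < m" using M_ge by (simp add: m_def)

definition link :: "nat \<Rightarrow> 'a \<Rightarrow> nat \<Rightarrow> nat \<Rightarrow> bool" where
  "link z s x i \<longleftrightarrow> s \<in> St \<and> x \<in> Kc z s \<and> i < n \<and> wt i (Kp z s x) \<in> C - D z s"

definition next_state :: "nat \<Rightarrow> 'a \<Rightarrow> nat \<Rightarrow> nat \<Rightarrow> 'a" where
  "next_state z s x i = rep z (Kp z s x) (wt i (Kp z s x))"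

lemma linkD:
  assumes "link z s x i"
  shows "s \<in> St" "x \<in> Kc z s" "i < n" "Kp z s x \<in> D z s" "Kp z s x \<in> C"
    "wt i (Kp z s x) \<in> C" "wt i (Kp z s x) \<notin> D z s" "next_state z s x i \<in> St"
    "etype (next_state z s x i) = etype (wt i (Kp z s x))"
  using assms approxD(2)[OF ap, of s x z] D_C[of s z] rep_St etype_rep
  unfolding link_def next_state_def by auto

definition level_of :: "nat \<Rightarrow> ('a \<times> nat \<times> nat) list \<Rightarrow> nat" where
  "level_of b h = (b + length h) mod m"

fun forest_proj :: "nat \<Rightarrow> 'a \<times> ('a \<times> nat \<times> nat) list \<times> nat \<Rightarrow> 'a" where
  "forest_proj b (s, h, x) = Kp (level_of b h) s x"

text \<open>A history need not record a genuine descent; this is what allows truncated histories to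
  be read as forest elements.\<close>

fun forest_elem :: "nat \<Rightarrow> 'a \<times> ('a \<times> nat \<times> nat) list \<times> nat \<Rightarrow> bool" where
  "forest_elem b (s, h, x) \<longleftrightarrow> s \<in> St \<and> x \<in> Kc (level_of b h) s"

fun in_block :: "nat \<Rightarrow> nat \<times> bool \<Rightarrow> 'a \<times> ('a \<times> nat \<times> nat) list \<times> nat \<Rightarrow>
    'a \<times> ('a \<times> nat \<times> nat) list \<times> nat \<Rightarrow> bool" where
  "in_block b v (s, h, x) (s', h', x') \<longleftrightarrow> s' = s \<and> h' = h \<and> s \<in> St \<and> x \<in> Kc (level_of b h) s \<and>
     x' \<in> Kc (level_of b h) s \<and> dirrel (KR (level_of b h) s) v x x'"

fun forest_child :: "nat \<Rightarrow> nat \<Rightarrow> 'a \<times> ('a \<times> nat \<times> nat) list \<times> nat \<Rightarrow>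
    'a \<times> ('a \<times> nat \<times> nat) list \<times> nat \<Rightarrow> bool" where
  "forest_child b i (s, h, x) (s', h', x') \<longleftrightarrow> link (level_of b h) s x i \<and> s' = next_state (level_of b h) s x i \<and>
     h' = (s, x, i) # h \<and> x' = Ko (level_of b h') s'"

text \<open>Blocks with empty history sit at level \<open>b\<close>. A tree edge carries the
  relations between the parent and its true witness, although the child starts at a representative
  of the same enriched type.\<close>

definition forest_rel where
  "forest_rel b v = {(X, Y). in_block b v X Y \<or>
     (\<exists>i. forest_child b i X Y \<and> dirrel R v (forest_proj b X) (wt i (forest_proj b X))) \<or>
     (\<exists>i. forest_child b i Y X \<and> dirrel R v (wt i (forest_proj b Y)) (forest_proj b Y))}"

lemma forest_rel_flip: "forest_rel b (flip v) = (forest_rel b v)\<inverse>"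
proof -
  have "in_block b (flip v) X Y = in_block b v Y X" for X Y
    by (cases X; cases Y) (auto simp: dirrel_flip)
  then show ?thesis unfolding forest_rel_def by (auto simp: dirrel_flip)
qed

lemma forest_rel_rtrancl_flip: "(X, Y) \<in> (forest_rel b (flip v))\<^sup>* \<longleftrightarrow> (Y, X) \<in> (forest_rel b v)\<^sup>*"
  by (simp add: forest_rel_flip rtrancl_converse)

lemma forest_childD:
  assumes "forest_child b i X Y"
  shows "forest_elem b X" "forest_elem b Y" "forest_proj b X \<in> C" "wt i (forest_proj b X) \<in> C" "etype (forest_proj b Y) = etype (wt i (forest_proj b X))"
proof -
  obtain s h x s' h' x' where XY: "X = (s, h, x)" "Y = (s', h', x')" by (metis prod_cases3)
  have l: "link (level_of b h) s x i" and s': "s' = next_state (level_of b h) s x i" and x': "x' = Ko (level_of b h') s'"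
    using assms XY by auto
  note L = linkD[OF l]
  show "forest_elem b X" "forest_elem b Y" "forest_proj b X \<in> C" "wt i (forest_proj b X) \<in> C" "etype (forest_proj b Y) = etype (wt i (forest_proj b X))"
    using XY L s' x' Ko_in Kp_Ko by simp_all
qed

lemma forest_rel_forest_elem: "(X, Y) \<in> forest_rel b v \<Longrightarrow> forest_elem b X \<and> forest_elem b Y"
  unfolding forest_rel_def using forest_childD by (cases X; cases Y) auto

lemma forest_rel_cons:
  assumes "((s0, h0, x0), (s, (s0, x0, i) # h0, y)) \<in> forest_rel b v"
  shows "forest_child b i (s0, h0, x0) (s, (s0, x0, i) # h0, y)"
    "dirrel R v (forest_proj b (s0, h0, x0)) (wt i (forest_proj b (s0, h0, x0)))"
  using assms unfolding forest_rel_def by auto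

text \<open>Blocks with the same history are told apart by their state; hence the letter by which
  the root block is left must carry \<open>s0\<close>.\<close>

definition subtree :: "'a \<Rightarrow> ('a \<times> nat \<times> nat) list \<Rightarrow> ('a \<times> ('a \<times> nat \<times> nat) list \<times> nat) set" where
  "subtree s0 h0 = {(s, h, x). (s = s0 \<and> h = h0) \<or> (\<exists>g x i. h = g @ (s0, x, i) # h0)}"

lemma subtree_length: "(s, h, x) \<in> subtree s0 h0 \<Longrightarrow> length h0 \<le> length h"
  by (auto simp: subtree_def)

lemma subtree_child: "forest_child b i Z Z' \<Longrightarrow> Z \<in> subtree s0 h0 \<Longrightarrow> Z' \<in> subtree s0 h0"
  by (cases Z; cases Z') (force simp: subtree_def Cons_eq_append_conv)

text \<open>Block edges keep state and history, and a child edge stays in every subtree that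
  contains the parent. Only the edge that creates the root block can lead into its subtree, and the
  newest letter of that block names its source.\<close>

lemma gate_step:
  assumes st: "(Z, Z') \<in> forest_rel b v" and "Z \<notin> subtree sB ((s0, x0, i0) # h0)"
    and "Z' \<in> subtree sB ((s0, x0, i0) # h0)"
  shows "Z = (s0, h0, x0)" "Z' = (sB, (s0, x0, i0) # h0, Ko (level_of b ((s0, x0, i0) # h0)) sB)"
proof -
  obtain s h x s' h' x' where ZZ: "Z = (s, h, x)" "Z' = (s', h', x')" by (metis prod_cases3)
  have "\<not> in_block b v Z Z'" using assms ZZ by (auto simp: subtree_def)
  moreover have "\<not> forest_child b i Z' Z" for i using assms subtree_child by blast
  ultimately obtain i where dn: "forest_child b i Z Z'" using st by (auto simp: forest_rel_def)
  have n2: "\<not> (\<exists>g y j. h = g @ (sB, y, j) # (s0, x0, i0) # h0)"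
    "\<not> (s = sB \<and> h = (s0, x0, i0) # h0)"
    using assms(2) ZZ by (auto simp: subtree_def)
  have "s' = sB \<and> h' = (s0, x0, i0) # h0"
    using assms(3) n2 dn ZZ by (auto simp: subtree_def Cons_eq_append_conv)
  then show "Z = (s0, h0, x0)" "Z' = (sB, (s0, x0, i0) # h0, Ko (level_of b ((s0, x0, i0) # h0)) sB)"
    using dn ZZ by auto
qed

lemma gate:
  assumes "(X, Y) \<in> (forest_rel b v)\<^sup>*" and X: "X \<notin> subtree sB ((s0, x0, i0) # h0)"
    and "Y \<in> subtree sB ((s0, x0, i0) # h0)"
  shows "(X, (s0, h0, x0)) \<in> (forest_rel b v)\<^sup>* \<and>
    ((s0, h0, x0), (sB, (s0, x0, i0) # h0, Ko (level_of b ((s0, x0, i0) # h0)) sB)) \<in> forest_rel b v \<and>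
    ((sB, (s0, x0, i0) # h0, Ko (level_of b ((s0, x0, i0) # h0)) sB), Y) \<in> (forest_rel b v)\<^sup>*"
  using assms(1,3)
proof (induction rule: rtrancl_induct)
  case base
  then show ?case using X by blast
next
  case (step Y Z)
  show ?case
  proof (cases "Y \<in> subtree sB ((s0, x0, i0) # h0)")
    case True
    then show ?thesis using step by (meson rtrancl.rtrancl_into_rtrancl)
  next
    case False
    from gate_step[OF step(2) False step(4)] show ?thesis using step(1,2) by auto
  qed
qed

lemma trans_dirrel_KR:
  assumes "s \<in> St" "fst v \<in> I" "x \<in> Kc z s" "y \<in> Kc z s" "w \<in> Kc z s"
    "dirrel (KR z s) v x y" "dirrel (KR z s) v y w"
  shows "dirrel (KR z s) v x w"
proof (cases "snd v")
  case True
  then show ?thesis using assms approxD(3)[OF ap, of s "fst v" x z y w] by (simp add: dirrel_def)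
next
  case False
  then show ?thesis using assms approxD(3)[OF ap, of s "fst v" w z y x] by (simp add: dirrel_def)
qed

text \<open>Each block is a retract of the forest: everything below a child block is sent to the
  element the child hangs on, everything outside the subtree to the origin of the block.\<close>

lemma same_block:
  assumes "((s, h, x), (s, h, y)) \<in> (forest_rel b v)\<^sup>*" and ok: "s \<in> St" "x \<in> Kc (level_of b h) s"
    and v: "fst v \<in> I"
  shows "x = y \<or> dirrel (KR (level_of b h) s) v x y"
proof -
  define G where "G y \<longleftrightarrow> y \<in> Kc (level_of b h) s \<and> (x = y \<or> dirrel (KR (level_of b h) s) v x y)" for y
  define Inv where "Inv Z \<longleftrightarrow> (case Z of (s', h', z) \<Rightarrow> (s' = s \<and> h' = h \<longrightarrow> G z) \<and>
      (\<forall>g y i. h' = g @ (s, y, i) # h \<longrightarrow> G y) \<and>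
      (Z \<notin> subtree s h \<longrightarrow> G (Ko (level_of b h) s)))" for Z
  have "Inv Z" if "((s, h, x), Z) \<in> (forest_rel b v)\<^sup>*" for Z
    using that
  proof (induction rule: rtrancl_induct)
    case base
    then show ?case using ok by (auto simp: Inv_def G_def subtree_def)
  next
    case (step Y Z)
    obtain s1 h1 y s2 h2 z where YZ: "Y = (s1, h1, y)" "Z = (s2, h2, z)" by (metis prod_cases3)
    consider "in_block b v Y Z" | i where "forest_child b i Y Z" | i where "forest_child b i Z Y"
      using step(2) unfolding forest_rel_def by blast
    then show ?case
    proof cases
      case 1
      have "G z" if "s1 = s" "h1 = h"
        using 1 step(3) YZ that ok v trans_dirrel_KR[of s v x "level_of b h" y z]
        by (auto simp: Inv_def G_def)
      then show ?thesis using 1 step(3) YZ by (auto simp: Inv_def subtree_def)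
    next
      case 2
      have Yn: "Y \<notin> subtree s h" if "Z \<notin> subtree s h" using subtree_child[OF 2] that by blast
      have a: "G z" if "s2 = s" "h2 = h"
      proof -
        have "length h1 < length h" using 2 YZ that by auto
        then have "Y \<notin> subtree s h" using subtree_length YZ by fastforce
        then show ?thesis using step(3) 2 YZ that by (auto simp: Inv_def)
      qed
      have c: "G w" if "h2 = g @ (s, w, j) # h" for g w j
        using 2 step(3) YZ that by (cases g) (auto simp: Inv_def)
      show ?thesis using a c Yn step(3) YZ by (auto simp: Inv_def)
    next
      case 3
      have a: "G z" if "s2 = s" "h2 = h"
      proof -
        have "h1 = [] @ (s, z, i) # h" using 3 YZ that by auto
        then show ?thesis using step(3) YZ by (auto simp: Inv_def)
      qed
      have c: "G w" if "h2 = g @ (s, w, j) # h" for g w j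
      proof -
        have "h1 = ((s2, z, i) # g) @ (s, w, j) # h" using 3 YZ that by auto
        then show ?thesis using step(3) YZ unfolding Inv_def by blast
      qed
      have d: "G (Ko (level_of b h) s)" if "Z \<notin> subtree s h"
      proof (cases "Y \<in> subtree s h")
        case True
        then have "s1 = s \<and> h1 = h"
          using 3 YZ that by (auto simp: subtree_def Cons_eq_append_conv)
        then show ?thesis using step(3) 3 YZ by (auto simp: Inv_def)
      next
        case False
        then show ?thesis using step(3) YZ by (auto simp: Inv_def)
      qed
      show ?thesis using a c d YZ by (auto simp: Inv_def)
    qed
  qed
  from this[OF assms(1)] show ?thesis by (auto simp: Inv_def G_def)
qed

section \<open>Arrows along paths of the forest\<close>

fun root_state :: "'a \<times> ('a \<times> nat \<times> nat) list \<times> nat \<Rightarrow> 'a" where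
  "root_state (s, h, x) = (if h = [] then s else fst (last h))"

text \<open>Shows that connected elements of different blocks cannot both have the empty history, so
  that one of the two blocks has an entry edge.\<close>

lemma root_state_path: "(X, Y) \<in> (forest_rel b v)\<^sup>* \<Longrightarrow> root_state X = root_state Y"
proof (induction rule: rtrancl_induct)
  case (step Y Z)
  have "root_state Y = root_state Z"
    using step(2) unfolding forest_rel_def by (cases Y; cases Z) auto
  then show ?case using step by simp
qed simp

lemma arrow_same_block:
  assumes "s \<in> St" "x \<in> Kc (level_of b h) s" "y \<in> Kc (level_of b h) s" "x \<noteq> y"
    and VN: "VN \<subseteq> (I - S) \<times> UNIV" and VS: "VS \<subseteq> S \<times> UNIV"
    and p: "\<And>v. v \<in> VN \<Longrightarrow> ((s, h, x), (s, h, y)) \<in> (forest_rel b v)\<^sup>*"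
  shows "arrow (VN \<union> VS) (etype (forest_proj b (s, h, x))) (etype (forest_proj b (s, h, y)))"
proof -
  have "dirrel (KR (level_of b h) s) v x y" if v: "v \<in> VN \<union> VS" for v
  proof (cases "v \<in> VN")
    case True
    then show ?thesis using same_block[OF p, of v] assms by auto
  next
    case False
    then have "fst v \<in> S" using v VS by auto
    then show ?thesis using approxD(4)[OF ap, of s "fst v"] assms by (auto simp: dirrel_def)
  qed
  moreover have "VN \<union> VS \<subseteq> I \<times> UNIV" using VN VS S_I by auto
  ultimately show ?thesis
    using approxD(7)[OF ap, of s x "level_of b h" y "VN \<union> VS"] assms(1-4) by simp
qed

lemma dirrel_tot: "fst v \<in> S \<Longrightarrow> a \<in> C \<Longrightarrow> b \<in> C \<Longrightarrow> dirrel R v a b"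
  by (auto simp: dirrel_def tot)

text \<open>The origin of the child has the enriched type of the true witness, and an arrow sees
  nothing else; so a tree edge counts as a real edge of \<open>A\<close>.\<close>

lemma arrow_cross:
  assumes VN: "VN \<subseteq> (I - S) \<times> UNIV" and VS: "VS \<subseteq> S \<times> UNIV"
    and dn: "forest_child b i X Y"
  shows "(\<And>v. v \<in> VN \<Longrightarrow> dirrel R v (forest_proj b X) (wt i (forest_proj b X))) \<Longrightarrow>
      arrow (VN \<union> VS) (etype (forest_proj b X)) (etype (forest_proj b Y))"
    and "(\<And>v. v \<in> VN \<Longrightarrow> dirrel R v (wt i (forest_proj b X)) (forest_proj b X)) \<Longrightarrow>
      arrow (VN \<union> VS) (etype (forest_proj b Y)) (etype (forest_proj b X))"
proof -
  note F = forest_childD[OF dn]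
  have sb: "VN \<union> VS \<subseteq> I \<times> UNIV" using VN VS S_I by auto
  show "arrow (VN \<union> VS) (etype (forest_proj b X)) (etype (forest_proj b Y))"
    if "\<And>v. v \<in> VN \<Longrightarrow> dirrel R v (forest_proj b X) (wt i (forest_proj b X))"
    unfolding F(5) using F(3,4) C_A VS that dirrel_tot by (intro arrow_etype[OF sb]) auto
  show "arrow (VN \<union> VS) (etype (forest_proj b Y)) (etype (forest_proj b X))"
    if "\<And>v. v \<in> VN \<Longrightarrow> dirrel R v (wt i (forest_proj b X)) (forest_proj b X)"
    unfolding F(5) using F(3,4) C_A VS that dirrel_tot by (intro arrow_etype[OF sb]) auto
qed

lemma forest_rel_rtrancl_forest_elem: "(X, Y) \<in> (forest_rel b v)\<^sup>* \<Longrightarrow> forest_elem b X \<longleftrightarrow> forest_elem b Y"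
  by (induction rule: rtrancl_induct) (auto dest: forest_rel_forest_elem)

text \<open>The pieces between consecutive gates are connected by all labels of \<open>VN\<close>
  simultaneously, since the gates do not depend on the label; totality of \<open>S\<close> adds
  \<open>VS\<close> to each piece. The arrows of the pieces compose.\<close>

lemma arrow_forest:
  assumes VN: "VN \<subseteq> (I - S) \<times> UNIV" "VN \<noteq> {}" and VS: "VS \<subseteq> S \<times> UNIV"
  shows "X \<noteq> Y \<Longrightarrow> forest_elem b X \<Longrightarrow> (\<And>v. v \<in> VN \<Longrightarrow> (X, Y) \<in> (forest_rel b v)\<^sup>*) \<Longrightarrow>
    arrow (VN \<union> VS) (etype (forest_proj b X)) (etype (forest_proj b Y))"
proof (induction "length (fst (snd X)) + length (fst (snd Y))" arbitrary: X Y rule: less_induct)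
  case less
  obtain s h x s' h' y where XY: "X = (s, h, x)" "Y = (s', h', y)" by (metis prod_cases3)
  obtain v0 where v0: "v0 \<in> VN" using VN by blast
  have okY: "forest_elem b Y" using forest_rel_rtrancl_forest_elem less v0 by blast
  note p = less(4)
  \<comment> \<open>If \<open>X\<close> is outside the subtree of the block of \<open>Y\<close>, all
    paths enter that subtree by its gate. If it is inside, or if the block of \<open>Y\<close> has
    empty history, they leave the subtree of the block of \<open>X\<close> by the gate of the
    latter.\<close>
  consider (same) "s = s' \<and> h = h'"
    | (down) e h0 where "h' = e # h0" "X \<notin> subtree s' h'"
    | (up) e h0 where "h = e # h0" "Y \<notin> subtree s h"
  proof (cases "s = s' \<and> h = h'")
    case False
    show ?thesis
    proof (cases "X \<in> subtree s' h'")
      case True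
      then have "length h' < length h" using False XY by (auto simp: subtree_def)
      moreover from this have "Y \<notin> subtree s h" using subtree_length XY by fastforce
      ultimately show ?thesis using up by (cases h) auto
    next
      case nX: False
      show ?thesis
      proof (cases h')
        case Nil
        have "h \<noteq> []" using root_state_path[OF p[OF v0]] False Nil XY by auto
        moreover have "Y \<notin> subtree s h" using subtree_length[of s' h' y s h] XY Nil \<open>h \<noteq> []\<close> by auto
        ultimately show ?thesis using up by (cases h) auto
      qed (use down nX in auto)
    qed
  qed (use same in auto)
  then show ?case
  proof cases
    case same
    then have "Y = (s, h, y)" using XY by simp
    with XY(1) show ?thesis
      using arrow_same_block[OF _ _ _ _ VN(1) VS, of s x b h y] less(2-4) okY by simp
  next
    case down
    obtain s0 x0 i0 where e: "e = (s0, x0, i0)" by (metis prod_cases3)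
    let ?P = "(s0, h0, x0)" and ?o = "(s', h', Ko (level_of b h') s')"
    have Ys: "Y \<in> subtree s' h'" using XY by (simp add: subtree_def)
    have g: "(X, ?P) \<in> (forest_rel b v)\<^sup>*" "(?P, ?o) \<in> forest_rel b v" "(?o, Y) \<in> (forest_rel b v)\<^sup>*" if "v \<in> VN" for v
      using gate[OF p[OF that], of s' s0 x0 i0 h0] down Ys e by auto
    have dn: "forest_child b i0 ?P ?o" and dd: "\<And>v. v \<in> VN \<Longrightarrow> dirrel R v (forest_proj b ?P) (wt i0 (forest_proj b ?P))"
      using forest_rel_cons[OF g(2)[unfolded down(1) e]] v0 e down(1) by auto
    have 1: "arrow (VN \<union> VS) (etype (forest_proj b ?P)) (etype (forest_proj b ?o))"
      using arrow_cross(1)[OF VN(1) VS dn dd] .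
    have 2: "arrow (VN \<union> VS) (etype (forest_proj b X)) (etype (forest_proj b ?o))"
    proof (cases "X = ?P")
      case False
      have "arrow (VN \<union> VS) (etype (forest_proj b X)) (etype (forest_proj b ?P))"
        by (rule less(1)) (use False g(1) less(3) XY down(1) in simp_all)
      then show ?thesis using 1 by (rule arrow_trans)
    qed (use 1 in simp)
    show ?thesis
    proof (cases "Y = ?o")
      case False
      have "arrow (VN \<union> VS) (etype (forest_proj b ?o)) (etype (forest_proj b Y))"
        unfolding XY(2)
        by (rule arrow_same_block[OF _ _ _ _ VN(1) VS])
          (use False g(3) okY forest_childD(2)[OF dn] XY(2) in simp_all)
      with 2 show ?thesis by (rule arrow_trans)
    qed (use 2 in simp)
  next
    case up
    obtain s0 x0 i0 where e: "e = (s0, x0, i0)" by (metis prod_cases3)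
    let ?P = "(s0, h0, x0)" and ?o = "(s, h, Ko (level_of b h) s)"
    have Xs: "X \<in> subtree s h" using XY by (simp add: subtree_def)
    \<comment> \<open>Gates are stated for entering a subtree; leaving one is entering it along the
      flipped label.\<close>
    have "(Y, X) \<in> (forest_rel b (flip v))\<^sup>*" if "v \<in> VN" for v
      using p[OF that] by (simp add: forest_rel_rtrancl_flip)
    from gate[OF this, of _ s s0 x0 i0 h0]
    have g: "(?P, Y) \<in> (forest_rel b v)\<^sup>*" "(?P, ?o) \<in> forest_rel b (flip v)" "(X, ?o) \<in> (forest_rel b v)\<^sup>*"
      if "v \<in> VN" for v
      using that up Xs e by (auto simp: forest_rel_rtrancl_flip)
    have dn: "forest_child b i0 ?P ?o" and dd: "\<And>v. v \<in> VN \<Longrightarrow> dirrel R v (wt i0 (forest_proj b ?P)) (forest_proj b ?P)"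
      using forest_rel_cons[OF g(2)[unfolded up(1) e]] v0 e up(1) by (auto simp: dirrel_flip)
    have 1: "arrow (VN \<union> VS) (etype (forest_proj b ?o)) (etype (forest_proj b ?P))"
      using arrow_cross(2)[OF VN(1) VS dn dd] .
    have 2: "arrow (VN \<union> VS) (etype (forest_proj b ?o)) (etype (forest_proj b Y))"
    proof (cases "?P = Y")
      case False
      have "arrow (VN \<union> VS) (etype (forest_proj b ?P)) (etype (forest_proj b Y))"
        by (rule less(1)) (use False g(1) XY up(1) forest_childD(1)[OF dn] in simp_all)
      with 1 show ?thesis by (rule arrow_trans)
    qed (use 1 in simp)
    show ?thesis
    proof (cases "X = ?o")
      case False
      have "arrow (VN \<union> VS) (etype (forest_proj b X)) (etype (forest_proj b ?o))"
        unfolding XY(1)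
        by (rule arrow_same_block[OF _ _ _ _ VN(1) VS])
          (use False g(3) less(3) forest_childD(2)[OF dn] XY(1) in simp_all)
      then show ?thesis using 2 by (rule arrow_trans)
    qed (use 2 in simp)
  qed
qed

section \<open>Paths that die out, and the finite quotient\<close>

text \<open>A path that ends \<open>M\<close> levels higher crosses every gate in between, and these
  gates spell out exactly a chain excluded by \<open>kill\<close>.\<close>

lemma no_deep:
  assumes v: "fst v \<in> I - S" and path: "((s, h, x), (s', h', y)) \<in> (forest_rel b v)\<^sup>*"
    and len: "length h' = length h + M"
  shows False
proof -
  define N where "N = length h'"
  define k where "k = length h"
  \<comment> \<open>\<open>H j\<close> consists of the oldest \<open>j\<close> letters. As recent
    letters come first, the letter that extends \<open>H j\<close> sits at position
    \<open>N - 1 - j\<close>.\<close>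
  define H where "H j = drop (N - j) h'" for j
  define st where "st j = (if j = N then s' else fst (h' ! (N - 1 - j)))" for j
  define xx where "xx j = fst (snd (h' ! (N - 1 - j)))" for j
  define ii where "ii j = snd (snd (h' ! (N - 1 - j)))" for j
  have H_Suc: "H (Suc j) = (st j, xx j, ii j) # H j" if "j < N" for j
  proof -
    have "H (Suc j) = h' ! (N - 1 - j) # drop (Suc (N - 1 - j)) h'"
      unfolding H_def using that Cons_nth_drop_Suc[of "N - Suc j" h'] by (simp add: N_def)
    moreover have "Suc (N - 1 - j) = N - j" using that by simp
    ultimately show ?thesis using that by (simp add: H_def st_def xx_def ii_def)
  qed
  have lenH: "length (H j) = j" if "j \<le> N" for j using that by (simp add: H_def N_def)
  have Ysub: "(s', h', y) \<in> subtree (st j) (H j)" if "j \<le> N" for j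
  proof (cases "j = N")
    case True
    then show ?thesis by (simp add: subtree_def st_def H_def)
  next
    case False
    then have "h' = take (N - 1 - j) h' @ H (Suc j)"
      using that by (simp add: H_def)
    also have "\<dots> = take (N - 1 - j) h' @ (st j, xx j, ii j) # H j" using H_Suc False that by simp
    finally show ?thesis unfolding subtree_def by blast
  qed
  have link: "forest_child b (ii j) (st j, H j, xx j) (st (Suc j), H (Suc j), Ko (level_of b (H (Suc j))) (st (Suc j))) \<and>
      dirrel R v (forest_proj b (st j, H j, xx j)) (wt (ii j) (forest_proj b (st j, H j, xx j)))"
    if "k \<le> j" "j < N" for j
  proof -
    have Hs: "H (Suc j) = (st j, xx j, ii j) # H j" using H_Suc that(2) by blast
    have "(s, h, x) \<notin> subtree (st (Suc j)) (H (Suc j))"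
      using subtree_length[of s h x "st (Suc j)" "H (Suc j)"] lenH[of "Suc j"] that by (auto simp: k_def)
    moreover have "(s', h', y) \<in> subtree (st (Suc j)) (H (Suc j))" using Ysub[of "Suc j"] that(2) by simp
    ultimately have "((st j, H j, xx j), (st (Suc j), (st j, xx j, ii j) # H j,
        Ko (level_of b ((st j, xx j, ii j) # H j)) (st (Suc j)))) \<in> forest_rel b v"
      unfolding Hs using gate[OF path] by blast
    from forest_rel_cons[OF this] show ?thesis unfolding Hs by blast
  qed
  show False
  proof (rule kill[OF v, where ss = "\<lambda>j. st (k + j)" and z = "b + k"
        and cs = "\<lambda>j. Kp ((b + (k + j)) mod m) (st (k + j)) (xx (k + j))"
        and bs = "\<lambda>j. wt (ii (k + j)) (Kp ((b + (k + j)) mod m) (st (k + j)) (xx (k + j)))"])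
    fix j assume "j < M"
    then have j: "k \<le> k + j" "k + j < N" using len by (auto simp: k_def N_def)
    have lvH: "level_of b (H (k + j)) = (b + (k + j)) mod m" using lenH j by (simp add: level_of_def)
    show "st (k + j) \<in> St \<and>
       Kp ((b + (k + j)) mod m) (st (k + j)) (xx (k + j)) \<in> D ((b + k + j) mod (2 * M)) (st (k + j)) \<and>
       wt (ii (k + j)) (Kp ((b + (k + j)) mod m) (st (k + j)) (xx (k + j)))
         \<in> C - D ((b + k + j) mod (2 * M)) (st (k + j)) \<and>
       st (k + Suc j) = rep ((b + k + j) mod (2 * M))
         (Kp ((b + (k + j)) mod m) (st (k + j)) (xx (k + j)))
         (wt (ii (k + j)) (Kp ((b + (k + j)) mod m) (st (k + j)) (xx (k + j)))) \<and>
       dirrel R v (Kp ((b + (k + j)) mod m) (st (k + j)) (xx (k + j)))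
         (wt (ii (k + j)) (Kp ((b + (k + j)) mod m) (st (k + j)) (xx (k + j))))"
      using link[OF j] linkD[of "(b + (k + j)) mod m" "st (k + j)" "xx (k + j)" "ii (k + j)"]
      by (simp add: lvH next_state_def m_def add.assoc)
  qed
qed

lemma no_deep':
  assumes "fst v \<in> I - S" "(X, Y) \<in> (forest_rel b v)\<^sup>*"
    "length (fst (snd Y)) = length (fst (snd X)) + M"
  shows False
proof -
  obtain s h x s' h' y where "X = (s, h, x)" "Y = (s', h', y)" by (metis prod_cases3)
  then show False using no_deep[OF assms(1), of s h x s' h' y b] assms(2,3) by simp
qed

text \<open>The index range is \<open>{..n}\<close> so that there are letters even if \<open>n = 0\<close>.\<close>

definition letters :: "nat \<Rightarrow> ('a \<times> nat \<times> nat) set" where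
  "letters B = St \<times> {..<B} \<times> {..n}"

definition quot_univ :: "nat \<Rightarrow> (nat \<times> 'a \<times> ('a \<times> nat \<times> nat) list \<times> nat) set" where
  "quot_univ B = {(d, s, h, x). d < m \<and> s \<in> St \<and> set h \<subseteq> letters B \<and> length h = m \<and> x \<in> Kc d s \<and> x < B}"

fun quot_proj :: "nat \<times> 'a \<times> ('a \<times> nat \<times> nat) list \<times> nat \<Rightarrow> 'a" where
  "quot_proj (d, s, h, x) = Kp d s x"

fun quot_child :: "nat \<Rightarrow> nat \<times> 'a \<times> ('a \<times> nat \<times> nat) list \<times> nat \<Rightarrow>
    nat \<times> 'a \<times> ('a \<times> nat \<times> nat) list \<times> nat \<Rightarrow> bool" where
  "quot_child i (d, s, h, x) (d', s', h', x') \<longleftrightarrow> link d s x i \<and> d' = Suc d mod m \<and> s' = next_state d s x i \<and>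
     h' = take m ((s, x, i) # h) \<and> x' = Ko d' s'"

fun quot_in_block :: "(nat \<Rightarrow> 'a \<Rightarrow> nat \<Rightarrow> nat \<Rightarrow> bool) \<Rightarrow> nat \<times> 'a \<times> ('a \<times> nat \<times> nat) list \<times> nat \<Rightarrow>
    nat \<times> 'a \<times> ('a \<times> nat \<times> nat) list \<times> nat \<Rightarrow> bool" where
  "quot_in_block K (d, s, h, x) (d', s', h', x') \<longleftrightarrow> d' = d \<and> s' = s \<and> h' = h \<and> K d s x x'"

definition quot_rel where
  "quot_rel B v = {(X, Y). X \<in> quot_univ B \<and> Y \<in> quot_univ B \<and> (quot_in_block (\<lambda>d s. dirrel (KR d s) v) X Y \<or>
     (\<exists>i. quot_child i X Y \<and> dirrel R v (quot_proj X) (wt i (quot_proj X))) \<or>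
     (\<exists>i. quot_child i Y X \<and> dirrel R v (wt i (quot_proj Y)) (quot_proj Y)))}"

lemma quot_rel_flip: "quot_rel B (flip v) = (quot_rel B v)\<inverse>"
proof -
  have "quot_in_block (\<lambda>d s. dirrel (KR d s) (flip v)) X Y = quot_in_block (\<lambda>d s. dirrel (KR d s) v) Y X" for X Y
    by (cases X; cases Y) (auto simp: dirrel_flip)
  then show ?thesis unfolding quot_rel_def by (auto simp: dirrel_flip)
qed

lemma quot_rel_trancl_flip: "(X, Y) \<in> (quot_rel B (flip v))\<^sup>+ \<longleftrightarrow> (Y, X) \<in> (quot_rel B v)\<^sup>+"
  by (simp add: quot_rel_flip trancl_converse)

section \<open>Unrolling quotient paths into a window of the forest\<close>

fun fold_window :: "nat \<Rightarrow> nat \<Rightarrow> nat \<times> 'a \<times> ('a \<times> nat \<times> nat) list \<times> nat \<Rightarrow>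
    'a \<times> ('a \<times> nat \<times> nat) list \<times> nat" where
  "fold_window b z (d, s, h, x) = (s, take (z - b) h, x)"

text \<open>\<open>z\<close> is an absolute level with residue \<open>fst X\<close>. Seen from the
  bottom \<open>b\<close> of a window, only the last \<open>z - b\<close> letters of the history
  matter. Choosing \<open>z\<close> unrolls the cycle of levels into a line.\<close>

lemma fold_window_props:
  assumes "X \<in> quot_univ B" "fst X = z mod m" "b \<le> z" "z \<le> b + m"
  shows "length (fst (snd (fold_window b z X))) = z - b" "forest_elem b (fold_window b z X)" "forest_proj b (fold_window b z X) = quot_proj X"
  using assms by (auto simp: quot_univ_def level_of_def)

text \<open>Pushing a letter commutes with truncation as long as at most \<open>m\<close> letters
  are kept, that is, below the top of the window.\<close>

lemma fold_window_dn:
  assumes "quot_child i X Y" "X \<in> quot_univ B" "fst X = z mod m" "b \<le> z" "Suc z \<le> b + m"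
  shows "forest_child b i (fold_window b z X) (fold_window b (Suc z) Y)" "fst Y = Suc z mod m"
proof -
  obtain d s h x d' s' h' y where XY: "X = (d, s, h, x)" "Y = (d', s', h', y)" by (metis prod_cases4)
  have l: "level_of b (take (z - b) h) = d" "length h = m"
    using assms XY by (auto simp: level_of_def quot_univ_def)
  have z: "Suc z - b = Suc (z - b)" "Suc (z - b) \<le> m" using assms(4,5) by auto
  have d': "d' = Suc z mod m" using assms XY by (simp add: mod_Suc_eq)
  have t: "take (Suc z - b) h' = (s, x, i) # take (z - b) h"
    using assms(1) z XY by (simp add: min_def)
  have "level_of b ((s, x, i) # take (z - b) h) = d'"
    unfolding level_of_def d' using z l(2) assms(4) by (simp add: min_def)
  then show "forest_child b i (fold_window b z X) (fold_window b (Suc z) Y)"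
    using assms(1) unfolding XY fold_window.simps t forest_child.simps quot_child.simps l(1) by simp
  show "fst Y = Suc z mod m" using d' XY by simp
qed

lemma pred_mod: "Suc d mod m = Suc z mod m \<Longrightarrow> d < m \<Longrightarrow> d = z mod m"
  unfolding mod_Suc[of d] mod_Suc[of z] by (auto split: if_splits)

lemma fold_window_step:
  assumes e: "(X, Y) \<in> quot_rel B v" and X: "fst X = z mod m" "b < z" "z < b + m"
  shows "\<exists>z'. b \<le> z' \<and> z' \<le> b + m \<and> fst Y = z' mod m \<and> (fold_window b z X, fold_window b z' Y) \<in> forest_rel b v"
proof -
  have U: "X \<in> quot_univ B" "Y \<in> quot_univ B" using e by (auto simp: quot_rel_def)
  consider "quot_in_block (\<lambda>d s. dirrel (KR d s) v) X Y"
    | i where "quot_child i X Y" "dirrel R v (quot_proj X) (wt i (quot_proj X))"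
    | i where "quot_child i Y X" "dirrel R v (wt i (quot_proj Y)) (quot_proj Y)"
    using e by (auto simp: quot_rel_def)
  then show ?thesis
  proof cases
    case 1
    then have "fst Y = z mod m" using X by (cases X; cases Y) auto
    moreover have "in_block b v (fold_window b z X) (fold_window b z Y)"
      using 1 U X by (cases X; cases Y) (auto simp: quot_univ_def level_of_def)
    ultimately show ?thesis using X by (intro exI[of _ z]) (auto simp: forest_rel_def)
  next
    case 2
    have "forest_child b i (fold_window b z X) (fold_window b (Suc z) Y)" "fst Y = Suc z mod m"
      using fold_window_dn[OF 2(1) U(1) X(1), of b] X by auto
    moreover have "forest_proj b (fold_window b z X) = quot_proj X" using fold_window_props(3)[OF U(1) X(1), of b] X by simp
    ultimately show ?thesis using X 2(2) by (intro exI[of _ "Suc z"]) (auto simp: forest_rel_def)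
  next
    case 3
    obtain z' where z': "z = Suc z'" using X by (cases z) auto
    have Y: "fst Y = z' mod m"
    proof (rule pred_mod)
      show "Suc (fst Y) mod m = Suc z' mod m" using 3(1) X(1) z' by (cases X; cases Y) simp
      show "fst Y < m" using U(2) by (auto simp: quot_univ_def)
    qed
    have "forest_child b i (fold_window b z' Y) (fold_window b z X)"
      using fold_window_dn(1)[OF 3(1) U(2) Y, of b] X z' by auto
    moreover have "forest_proj b (fold_window b z' Y) = quot_proj Y" using fold_window_props(3)[OF U(2) Y, of b] X z' by simp
    ultimately show ?thesis using X z' Y 3(2) by (intro exI[of _ z']) (auto simp: forest_rel_def)
  qed
qed

text \<open>\<open>X\<close> is placed in the middle of the window, \<open>M\<close> levels from
  both ends. Reaching an end would make the folded path gain \<open>M\<close> levels, or lose them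
  and gain them when read backwards, against \<open>no_deep\<close>. So each prefix ends strictly
  inside and the next step can be folded as well.\<close>

lemma fold_window_path:
  assumes p: "(X, Y) \<in> (quot_rel B v)\<^sup>+" and v: "fst v \<in> I - S" and z0: "fst X = (b + M) mod m"
  shows "\<exists>z. b < z \<and> z < b + m \<and> fst Y = z mod m \<and> (fold_window b (b + M) X, fold_window b z Y) \<in> (forest_rel b v)\<^sup>+"
proof -
  have XU: "X \<in> quot_univ B" using p by (induction rule: trancl_induct) (auto simp: quot_rel_def)
  have lenX: "length (fst (snd (fold_window b (b + M) X))) = M"
    using fold_window_props(1)[OF XU z0, of b] by (simp add: m_def)
  have strict: "b < z \<and> z < b + m"
    if Y: "Y \<in> quot_univ B" "fst Y = z mod m" "b \<le> z" "z \<le> b + m"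
      and pth: "(fold_window b (b + M) X, fold_window b z Y) \<in> (forest_rel b v)\<^sup>+" for z Y
  proof -
    note ly = fold_window_props(1)[OF Y]
    have r: "(fold_window b (b + M) X, fold_window b z Y) \<in> (forest_rel b v)\<^sup>*" using pth by simp
    have "z \<noteq> b + m"
    proof
      assume "z = b + m"
      then have "length (fst (snd (fold_window b z Y))) = length (fst (snd (fold_window b (b + M) X))) + M"
        using ly lenX by (simp add: m_def)
      then show False by (rule no_deep'[OF v r])
    qed
    moreover have "z \<noteq> b"
    proof
      assume "z = b"
      then have "length (fst (snd (fold_window b (b + M) X))) = length (fst (snd (fold_window b z Y))) + M"
        using ly lenX by simp
      then show False using no_deep'[of "flip v" "fold_window b z Y" "fold_window b (b + M) X" b] v r
        by (simp add: forest_rel_rtrancl_flip)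
    qed
    ultimately show ?thesis using Y by simp
  qed
  from p show ?thesis
  proof (induction rule: trancl_induct)
    case (base Y)
    have Y: "Y \<in> quot_univ B" using base by (simp add: quot_rel_def)
    obtain z where "b \<le> z" "z \<le> b + m" "fst Y = z mod m" "(fold_window b (b + M) X, fold_window b z Y) \<in> forest_rel b v"
      using fold_window_step[OF base z0, of b] M_ge by (auto simp: m_def)
    then show ?case using strict[OF Y, of z] by blast
  next
    case (step Y Z)
    have Z: "Z \<in> quot_univ B" using step by (simp add: quot_rel_def)
    obtain z where z: "b < z" "z < b + m" "fst Y = z mod m"
      "(fold_window b (b + M) X, fold_window b z Y) \<in> (forest_rel b v)\<^sup>+" using step by blast
    obtain z' where z': "b \<le> z'" "z' \<le> b + m" "fst Z = z' mod m" "(fold_window b z Y, fold_window b z' Z) \<in> forest_rel b v"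
      using fold_window_step[OF step(2) z(3) z(1,2)] by blast
    have "(fold_window b (b + M) X, fold_window b z' Z) \<in> (forest_rel b v)\<^sup>+" using z(4) z'(4) by (rule trancl.trancl_into_trancl)
    then show ?case using strict[OF Z z'(3,1,2)] z' by blast
  qed
qed


text \<open>The interior of a window has fewer than \<open>m\<close> levels. Hence paths of
  different labels to the same quotient element fold to the same forest element.\<close>

lemma window_unique:
  assumes "z mod m = z' mod m" "b < z" "z < b + m" "b < z'" "z' < b + m"
  shows "z = z'"
proof -
  have *: "x = y" if e: "x mod m = y mod m" "y \<le> x" and l: "x < y + m" for x y :: nat
  proof -
    obtain q where "x = y + m * q" using mod_eq_nat1E[OF e] by blast
    then show ?thesis using l by (cases q) auto
  qed
  show ?thesis using *[of z z'] *[of z' z] assms by (cases "z \<le> z'") auto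
qed

section \<open>The quotient is an approximation\<close>

text \<open>If a closed path visits another element, the arrow for \<open>{v, flip v}\<close>
  provides one element of \<open>A\<close> related to the projection of \<open>X\<close> in both
  directions, and transitivity closes the loop.\<close>

lemma forest_loop:
  assumes "(X, X) \<in> (forest_rel b v)\<^sup>+" and v: "fst v \<in> I - S"
  shows "dirrel R v (forest_proj b X) (forest_proj b X)"
proof -
  obtain Z where Z: "(X, Z) \<in> forest_rel b v" "(Z, X) \<in> (forest_rel b v)\<^sup>*" using tranclD[OF assms(1)] by blast
  show ?thesis
  proof (cases "Z = X")
    case True
    obtain s h x where X: "X = (s, h, x)" by (metis prod_cases3)
    have "in_block b v X X" using Z(1) True X by (auto simp: forest_rel_def)
    then show ?thesis
      using approxD(5)[OF ap, of s "fst v" x "level_of b h"] v X by (auto simp: dirrel_def)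
  next
    case False
    have "(X, Z) \<in> (forest_rel b w)\<^sup>*" if "w \<in> {v, flip v}" for w
      using Z that by (auto simp: forest_rel_rtrancl_flip)
    then have "arrow ({v, flip v} \<union> {}) (etype (forest_proj b X)) (etype (forest_proj b Z))"
      using forest_rel_forest_elem[OF Z(1)] False v
      by (intro arrow_forest) (simp_all add: flip_def mem_Times_iff)
    then obtain c where "c \<in> A" "tp c = tp (forest_proj b Z)"
      and c: "\<And>w. w \<in> {v, flip v} \<union> {} \<Longrightarrow> dirrel R w (forest_proj b X) c" by (rule arrow_etypeE) blast
    from c[of v] c[of "flip v"] have "dirrel R v (forest_proj b X) c" "dirrel R v c (forest_proj b X)"
      by (simp_all add: dirrel_flip)
    then show ?thesis using trans_dirrel v by blast
  qed
qed

text \<open>Detours cannot add relations to a tree edge: each path to the child has to use the edge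
  itself.\<close>

lemma edge_exact:
  assumes dn: "forest_child b i X Y" and p: "(X, Y) \<in> (forest_rel b v)\<^sup>*"
  shows "dirrel R v (forest_proj b X) (wt i (forest_proj b X))"
proof -
  obtain s h x s' h' y where XY: "X = (s, h, x)" "Y = (s', h', y)" by (metis prod_cases3)
  have h': "h' = (s, x, i) # h" using dn XY by auto
  have "Y \<in> subtree s' ((s, x, i) # h)" using XY h' by (simp add: subtree_def)
  moreover have "X \<notin> subtree s' ((s, x, i) # h)" using XY subtree_length[of s h x s' "(s, x, i) # h"] by auto
  ultimately have "((s, h, x), (s', (s, x, i) # h, Ko (level_of b ((s, x, i) # h)) s')) \<in> forest_rel b v"
    using gate[OF p] by blast
  from forest_rel_cons(2)[OF this] show ?thesis using XY by simp
qed

text \<open>Nothing forces paths of labels in \<open>S\<close> to die out; as these labels are total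
  on \<open>C\<close>, they may hold everywhere.\<close>

definition quot_R where
  "quot_R B l X Y \<longleftrightarrow> l \<in> S \<or> (X, Y) \<in> (quot_rel B (l, True))\<^sup>+"

definition quot_Q where
  "quot_Q q X Y \<longleftrightarrow> quot_in_block (\<lambda>d s. KQ d s q) X Y \<or> (\<exists>i. quot_child i X Y \<and> Q q (quot_proj X) (wt i (quot_proj X))) \<or>
     (\<exists>i. quot_child i Y X \<and> Q q (wt i (quot_proj Y)) (quot_proj Y))"

lemma dirrel_quot_R: "dirrel (quot_R B) v X Y \<longleftrightarrow> fst v \<in> S \<or> (X, Y) \<in> (quot_rel B v)\<^sup>+"
proof (cases v)
  case (Pair l d)
  have "flip (l, True) = (l, False)" by (simp add: flip_def)
  then show ?thesis using Pair quot_rel_trancl_flip[of X Y B "(l, True)"]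
    by (cases d) (auto simp: dirrel_def quot_R_def)
qed

lemma dirrel_quot_Q: "dirrel quot_Q w X Y \<longleftrightarrow> quot_in_block (\<lambda>d s. dirrel (KQ d s) w) X Y \<or>
    (\<exists>i. quot_child i X Y \<and> dirrel Q w (quot_proj X) (wt i (quot_proj X))) \<or> (\<exists>i. quot_child i Y X \<and> dirrel Q w (wt i (quot_proj Y)) (quot_proj Y))"
  by (cases X; cases Y; cases "snd w") (auto simp: dirrel_def quot_Q_def)

lemma quot_proj_C:
  assumes "X \<in> quot_univ B"
  shows "quot_proj X \<in> C"
proof -
  obtain d s h x where X: "X = (d, s, h, x)" by (metis prod_cases4)
  then have "s \<in> St" "x \<in> Kc d s" using assms by (auto simp: quot_univ_def)
  then show ?thesis using approxD(2)[OF ap, of s x d] D_C[of s d] X by auto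
qed

lemma start_window:
  assumes "X \<in> quot_univ B" "b = fst X + M"
  shows "fst X = (b + M) mod m"
proof -
  have "fst X < m" using assms(1) by (auto simp: quot_univ_def)
  moreover have "b + M = fst X + m" using assms(2) by (simp add: m_def)
  ultimately show ?thesis by simp
qed

text \<open>The residue of the endpoint fixes its level, so one position \<open>z\<close> serves all
  labels of \<open>VN\<close> at once, as composing a joint arrow requires.\<close>

lemma fold_window_common:
  assumes "X \<in> quot_univ B" "VN \<subseteq> (I - S) \<times> UNIV" "VN \<noteq> {}"
    and p: "\<And>v. v \<in> VN \<Longrightarrow> (X, Y) \<in> (quot_rel B v)\<^sup>+" and b: "b = fst X + M"
  shows "\<exists>z. b < z \<and> z < b + m \<and> fst Y = z mod m \<and>
    (\<forall>v\<in>VN. (fold_window b (b + M) X, fold_window b z Y) \<in> (forest_rel b v)\<^sup>+)"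
proof -
  have st: "fst X = (b + M) mod m" by (rule start_window[OF assms(1) b])
  have ex: "\<exists>z. b < z \<and> z < b + m \<and> fst Y = z mod m \<and> (fold_window b (b + M) X, fold_window b z Y) \<in> (forest_rel b v)\<^sup>+"
    if "v \<in> VN" for v
  proof -
    have "fst v \<in> I - S" using assms(2) that by auto
    then show ?thesis by (rule fold_window_path[OF p[OF that] _ st])
  qed
  obtain v0 where v0: "v0 \<in> VN" using assms(3) by blast
  obtain z where z: "b < z" "z < b + m" "fst Y = z mod m" using ex[OF v0] by blast
  have "(fold_window b (b + M) X, fold_window b z Y) \<in> (forest_rel b v)\<^sup>+" if v: "v \<in> VN" for v
  proof -
    obtain z' where z': "b < z'" "z' < b + m" "fst Y = z' mod m"
      "(fold_window b (b + M) X, fold_window b z' Y) \<in> (forest_rel b v)\<^sup>+" using ex[OF v] by blast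
    have "z' = z" by (rule window_unique[OF trans[OF z'(3)[symmetric] z(3)] z'(1,2) z(1,2)])
    with z'(4) show ?thesis by simp
  qed
  then show ?thesis using z by blast
qed

lemma arrow_Q:
  assumes X: "X \<in> quot_univ B" and Y: "Y \<in> quot_univ B" and V: "V \<subseteq> I \<times> UNIV"
    and VR: "\<And>v. v \<in> V \<Longrightarrow> dirrel (quot_R B) v X Y"
  shows "arrow V (etype (quot_proj X)) (etype (quot_proj Y))"
proof -
  define VN where "VN = V \<inter> (I - S) \<times> UNIV"
  define VS where "VS = V \<inter> S \<times> UNIV"
  have VV: "V = VN \<union> VS" using V by (auto simp: VN_def VS_def)
  have VN: "VN \<subseteq> (I - S) \<times> UNIV" and VS: "VS \<subseteq> S \<times> UNIV" by (auto simp: VN_def VS_def)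
  have sS: "dirrel R v (quot_proj X) (quot_proj Y)" if "v \<in> VS" for v
  proof -
    have "fst v \<in> S" using that VS by auto
    then show ?thesis by (rule dirrel_tot[OF _ quot_proj_C[OF X] quot_proj_C[OF Y]])
  qed
  have YA: "quot_proj Y \<in> A" using quot_proj_C[OF Y] C_A by auto
  show ?thesis
  proof (cases "VN = {}")
    case True
    then have "V = VS" using VV by simp
    then show ?thesis by (intro arrow_etype[OF V YA] sS) simp
  next
    case False
    define b where "b = fst X + M"
    have "(X, Y) \<in> (quot_rel B v)\<^sup>+" if "v \<in> VN" for v
    proof -
      have "fst v \<notin> S" using that VN by auto
      then show ?thesis using VR[of v] that VV unfolding dirrel_quot_R by simp
    qed
    from fold_window_common[OF X VN False this b_def] obtain z where
      z: "b < z" "z < b + m" "fst Y = z mod m"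
      and p': "\<forall>v\<in>VN. (fold_window b (b + M) X, fold_window b z Y) \<in> (forest_rel b v)\<^sup>+" by blast
    have p: "(fold_window b (b + M) X, fold_window b z Y) \<in> (forest_rel b v)\<^sup>+" if "v \<in> VN" for v
      using p' that by blast
    have st: "fst X = (b + M) mod m" by (rule start_window[OF X b_def])
    have fX: "forest_elem b (fold_window b (b + M) X)" "forest_proj b (fold_window b (b + M) X) = quot_proj X"
      using fold_window_props(2,3)[OF X st, of b] by (simp_all add: m_def)
    have fY: "forest_proj b (fold_window b z Y) = quot_proj Y" using fold_window_props(3)[OF Y z(3), of b] z(1,2) by simp
    show ?thesis
    proof (cases "fold_window b (b + M) X = fold_window b z Y")
      \<comment> \<open>\<open>X\<close> and \<open>Y\<close> need not be equal here: their
        histories may differ in letters that the window drops. Every label of \<open>VN\<close> then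
        has a closed path in the forest.\<close>
      case True
      have "dirrel R v (quot_proj X) (quot_proj Y)" if "v \<in> VN" for v
      proof -
        have "fst v \<in> I - S" using that VN by auto
        then have "dirrel R v (forest_proj b (fold_window b z Y)) (forest_proj b (fold_window b z Y))"
          using p[OF that] unfolding True by (intro forest_loop)
        then show ?thesis using True fX(2) fY by simp
      qed
      then have "dirrel R v (quot_proj X) (quot_proj Y)" if "v \<in> V" for v using that sS VV by blast
      then show ?thesis by (rule arrow_etype[OF V YA])
    next
      case ne: False
      have "arrow (VN \<union> VS) (etype (forest_proj b (fold_window b (b + M) X))) (etype (forest_proj b (fold_window b z Y)))"
        by (rule arrow_forest[OF VN False VS ne fX(1) trancl_into_rtrancl[OF p]])
      then show ?thesis using fX fY VV by simp
    qed
  qed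
qed

text \<open>Equal residues force equal levels inside the window, so the folded endpoints lie in one
  block and the retraction onto it applies.\<close>

lemma quot_R_block:
  assumes X: "(d, s, h, x) \<in> quot_univ B" and "x \<noteq> y" "(d, s, h, y) \<in> quot_univ B"
    and v: "v \<in> I \<times> UNIV" and r: "dirrel (quot_R B) v (d, s, h, x) (d, s, h, y)"
  shows "dirrel (KR d s) v x y"
proof (cases "fst v \<in> S")
  case True
  have "s \<in> St" "x \<in> Kc d s" "y \<in> Kc d s" using assms by (auto simp: quot_univ_def)
  then show ?thesis using approxD(4)[OF ap, of s "fst v"] True assms(2) by (auto simp: dirrel_def)
next
  case False
  let ?X = "(d, s, h, x)" and ?Y = "(d, s, h, y)"
  define b where "b = fst ?X + M"
  have "{v} \<subseteq> (I - S) \<times> UNIV" using v False by auto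
  moreover have "(?X, ?Y) \<in> (quot_rel B w)\<^sup>+" if "w \<in> {v}" for w using r False that by (simp add: dirrel_quot_R)
  ultimately have "\<exists>z. b < z \<and> z < b + m \<and> fst ?Y = z mod m \<and>
    (\<forall>v\<in>{v}. (fold_window b (b + M) ?X, fold_window b z ?Y) \<in> (forest_rel b v)\<^sup>+)"
    by (intro fold_window_common[OF X _ _ _ b_def]) simp_all
  then obtain z where z: "b < z" "z < b + m" "fst ?Y = z mod m"
      and p: "(fold_window b (b + M) ?X, fold_window b z ?Y) \<in> (forest_rel b v)\<^sup>+" by blast
  note z = z[unfolded fst_conv]
  have st: "d = (b + M) mod m" using start_window[OF X b_def] unfolding fst_conv .
  have "z = b + M" 
    by (rule window_unique[OF trans[OF z(3)[symmetric] st] z(1,2)]) (use M_ge in \<open>auto simp: m_def\<close>)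
  with p have p': "((s, take M h, x), (s, take M h, y)) \<in> (forest_rel b v)\<^sup>*" by simp
  have "level_of b (take M h) = d" using st X by (auto simp: level_of_def quot_univ_def m_def)
  then show ?thesis using same_block[OF p'] X v assms(2) by (auto simp: quot_univ_def)
qed

lemma quot_R_edge:
  assumes X: "X \<in> quot_univ B" and dn: "quot_child i X Y" and v: "v \<in> I \<times> UNIV" and r: "dirrel (quot_R B) v X Y"
  shows "dirrel R v (quot_proj X) (wt i (quot_proj X))"
proof (cases "fst v \<in> S")
  case True
  have "wt i (quot_proj X) \<in> C" using dn linkD(6) by (cases X; cases Y) auto
  then show ?thesis using dirrel_tot True quot_proj_C[OF X] by auto
next
  case False
  define b where "b = fst X + M"
  have "{v} \<subseteq> (I - S) \<times> UNIV" using v False by auto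
  moreover have "(X, Y) \<in> (quot_rel B w)\<^sup>+" if "w \<in> {v}" for w using r False that by (simp add: dirrel_quot_R)
  ultimately have "\<exists>z. b < z \<and> z < b + m \<and> fst Y = z mod m \<and>
    (\<forall>v\<in>{v}. (fold_window b (b + M) X, fold_window b z Y) \<in> (forest_rel b v)\<^sup>+)"
    by (intro fold_window_common[OF X _ _ _ b_def]) simp_all
  then obtain z where z: "b < z" "z < b + m" "fst Y = z mod m"
      and p: "(fold_window b (b + M) X, fold_window b z Y) \<in> (forest_rel b v)\<^sup>+" by blast
  have st: "fst X = (b + M) mod m" by (rule start_window[OF X b_def])
  have dn': "forest_child b i (fold_window b (b + M) X) (fold_window b (Suc (b + M)) Y)" "fst Y = Suc (b + M) mod m"
    using fold_window_dn[OF dn X st, of b] M_ge by (auto simp: m_def)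
  have "z = Suc (b + M)"
    by (rule window_unique[OF trans[OF z(3)[symmetric] dn'(2)] z(1,2)]) (use M_ge in \<open>auto simp: m_def\<close>)
  then have "(fold_window b (b + M) X, fold_window b (Suc (b + M)) Y) \<in> (forest_rel b v)\<^sup>*"
    using trancl_into_rtrancl[OF p] by simp
  from edge_exact[OF dn'(1) this] show ?thesis
    using fold_window_props(3)[OF X st, of b] by (simp add: m_def)
qed

text \<open>Here \<open>2 \<le> M\<close> enters: with at least four residues, parent and child
  cannot be confused modulo \<open>m\<close>.\<close>

lemma Suc_mod_neq:
  assumes "d < m"
  shows "Suc d mod m \<noteq> d" "Suc (Suc d mod m) mod m \<noteq> d"
proof -
  have m4: "4 \<le> m" using M_ge by (simp add: m_def)
  have c: "Suc (Suc d) < m \<or> Suc (Suc d) = m \<or> Suc d = m" using assms by linarith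
  have "Suc d mod m = (if Suc d = m then 0 else Suc d)" using assms by auto
  moreover have "Suc (Suc d) mod m = (if Suc (Suc d) = m then 0 else Suc (Suc d))" if "Suc d \<noteq> m"
    using assms that by auto
  ultimately show "Suc d mod m \<noteq> d" "Suc (Suc d mod m) mod m \<noteq> d"
    using c m4 by (simp_all split: if_splits)
qed

text \<open>The newest letter of a child contains the demand index, so an edge between two given
  elements belongs to a single demand and carries only the relations of that witness.\<close>

lemma quot_child_neq:
  assumes "quot_child i X Y" "X \<in> quot_univ B"
  shows "fst Y \<noteq> fst X" "\<not> quot_child j Y X" "\<not> quot_in_block K X Y" "quot_child j X Y \<Longrightarrow> j = i"
proof -
  obtain d s h x d' s' h' y where XY: "X = (d, s, h, x)" "Y = (d', s', h', y)" by (metis prod_cases4)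
  have d: "d < m" "d' = Suc d mod m" using assms XY by (auto simp: quot_univ_def)
  obtain k where k: "m = Suc k" using m_pos by (cases m) auto
  show "fst Y \<noteq> fst X" using XY d(2) Suc_mod_neq(1)[OF d(1)] by simp
  then show "\<not> quot_in_block K X Y" using XY by auto
  have "Suc d' mod m \<noteq> d" unfolding d(2) using Suc_mod_neq(2)[OF d(1)] .
  then show "\<not> quot_child j Y X" using XY by auto
  have "take m ((s, x, j) # h) = take m ((s, x, i) # h) \<Longrightarrow> j = i" unfolding k by simp
  then show "quot_child j X Y \<Longrightarrow> j = i" using assms(1) XY by simp
qed

lemma quot_Q_edge:
  assumes "X \<in> quot_univ B" "quot_child i X Y" "dirrel quot_Q w X Y"
  shows "dirrel Q w (quot_proj X) (wt i (quot_proj X))"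
  using assms quot_child_neq[OF assms(2,1)] unfolding dirrel_quot_Q by blast

lemma etype_quot_child: "quot_child i X Y \<Longrightarrow> etype (quot_proj Y) = etype (wt i (quot_proj X))"
  using linkD(8,9) Kp_Ko by (cases X; cases Y) auto

lemma wt_quot_child: "quot_child i X Y \<Longrightarrow> wt i (quot_proj X) \<in> A"
  using linkD(6) C_A by (cases X; cases Y) auto

lemma child_quot_univ:
  assumes X: "(d, s, h, x) \<in> quot_univ B" and l: "link d s x i" and KB: "\<And>z s. s \<in> St \<Longrightarrow> Kc z s \<subseteq> {..<B}"
  shows "(Suc d mod m, next_state d s x i, take m ((s, x, i) # h), Ko (Suc d mod m) (next_state d s x i)) \<in> quot_univ B"
proof -
  note L = linkD[OF l]
  have "set (take m ((s, x, i) # h)) \<subseteq> letters B"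
    using X L(1,3) by (auto simp: quot_univ_def letters_def dest!: in_set_takeD)
  moreover have "Ko (Suc d mod m) (next_state d s x i) \<in> Kc (Suc d mod m) (next_state d s x i)"
    using Ko_in[OF L(8)] .
  ultimately show ?thesis
    using L(8) KB[OF L(8)] m_pos X by (auto simp: quot_univ_def)
qed

lemma finite_quot_univ: "finite (quot_univ B)"
  and card_quot_univ: "card (quot_univ B) \<le> m * (card St * ((card St * (B * Suc n)) ^ m * B))"
proof -
  let ?W = "{..<m} \<times> St \<times> {h. set h \<subseteq> letters B \<and> length h = m} \<times> {..<B}"
  have finL: "finite (letters B)" using fin_St by (simp add: letters_def)
  have sub: "quot_univ B \<subseteq> ?W" by (auto simp: quot_univ_def)
  have fin: "finite ?W" using finite_lists_length_eq[OF finL] fin_St by auto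
  show "finite (quot_univ B)" using sub fin by (rule finite_subset)
  have "card ?W = m * (card St * ((card St * (B * Suc n)) ^ m * B))"
    using card_lists_length_eq[OF finL] by (simp add: card_cartesian_product letters_def)
  then show "card (quot_univ B) \<le> m * (card St * ((card St * (B * Suc n)) ^ m * B))"
    using card_mono[OF fin sub] by simp
qed

lemma quot_univ_point:
  assumes "a \<in> St" and KB: "\<And>z s. s \<in> St \<Longrightarrow> Kc z s \<subseteq> {..<B}"
  shows "a \<in> quot_proj ` quot_univ B"
proof -
  have "(0, a, replicate m (a, Ko 0 a, 0), Ko 0 a) \<in> quot_univ B"
    using assms(1) KB[OF assms(1), of 0] Ko_in[OF assms(1), of 0] m_pos
    by (auto simp: quot_univ_def letters_def)
  then show ?thesis using Kp_Ko[OF assms(1), of 0] by (force simp: image_iff)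
qed

theorem approx_quot_univ:
  assumes KB: "\<And>z s. s \<in> St \<Longrightarrow> Kc z s \<subseteq> {..<B}"
  shows "approx S C (quot_univ B) quot_proj (quot_R B) quot_Q"
  unfolding approx_def
proof (intro conjI ballI allI impI)
  show "finite (quot_univ B)" by (rule finite_quot_univ)
  show "quot_proj ` quot_univ B \<subseteq> C" using quot_proj_C by auto
  show "quot_R B l X Z" if "quot_R B l X Y" "quot_R B l Y Z" for l X Y Z
    using that by (auto simp: quot_R_def intro: trancl_trans)
  show "quot_R B l X Y" if "l \<in> S" for l X Y using that by (simp add: quot_R_def)
next
  fix l X assume l: "l \<in> I" and X: "X \<in> quot_univ B"
  obtain d s h x where Xe: "X = (d, s, h, x)" by (metis prod_cases4)
  have sx: "s \<in> St" "x \<in> Kc d s" using X Xe by (auto simp: quot_univ_def)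
  show "quot_R B l X X \<longleftrightarrow> R l (quot_proj X) (quot_proj X)"
  proof (cases "l \<in> S")
    case True
    then show ?thesis using tot quot_proj_C[OF X] by (simp add: quot_R_def)
  next
    case False
    show ?thesis
    proof
      assume "quot_R B l X X"
      then have r: "(X, X) \<in> (quot_rel B (l, True))\<^sup>+" using False by (simp add: quot_R_def)
      define b where "b = fst X + M"
      have "\<exists>z. b < z \<and> z < b + m \<and> fst X = z mod m \<and>
          (\<forall>v\<in>{(l, True)}. (fold_window b (b + M) X, fold_window b z X) \<in> (forest_rel b v)\<^sup>+)"
        by (rule fold_window_common[OF X _ _ _ b_def]) (use l False r in auto)
      then obtain z where z: "b < z" "z < b + m" "fst X = z mod m"
        and p: "(fold_window b (b + M) X, fold_window b z X) \<in> (forest_rel b (l, True))\<^sup>+" by blast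
      have st: "fst X = (b + M) mod m" by (rule start_window[OF X b_def])
      have "z = b + M" 
    by (rule window_unique[OF trans[OF z(3)[symmetric] st] z(1,2)]) (use M_ge in \<open>auto simp: m_def\<close>)
      then have "dirrel R (l, True) (quot_proj X) (quot_proj X)"
        using forest_loop[of "fold_window b (b + M) X" b "(l, True)"] p l False
          fold_window_props(3)[OF X st, of b] by (simp add: m_def)
      then show "R l (quot_proj X) (quot_proj X)" by (simp add: dirrel_def)
    next
      assume "R l (quot_proj X) (quot_proj X)"
      then have "KR d s l x x" using approxD(5)[OF ap, of s l x d] sx l Xe by simp
      then have "(X, X) \<in> quot_rel B (l, True)" using X Xe by (auto simp: quot_rel_def dirrel_def)
      then show "quot_R B l X X" by (auto simp: quot_R_def)
    qed
  qed
next
  fix q X assume X: "X \<in> quot_univ B"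
  obtain d s h x where Xe: "X = (d, s, h, x)" by (metis prod_cases4)
  have "\<not> quot_child i X X" for i using quot_child_neq(1)[of i X X B] X by blast
  then have "quot_Q q X X \<longleftrightarrow> KQ d s q x x" using Xe by (auto simp: quot_Q_def)
  then show "quot_Q q X X \<longleftrightarrow> Q q (quot_proj X) (quot_proj X)"
    using approxD(6)[OF ap, of s x d q] X Xe by (auto simp: quot_univ_def)
next
  fix X Y V assume "X \<in> quot_univ B" "Y \<in> quot_univ B" "V \<subseteq> I \<times> UNIV" "\<forall>v\<in>V. dirrel (quot_R B) v X Y"
  then show "arrow V (etype (quot_proj X)) (etype (quot_proj Y))" by (intro arrow_Q) blast+
next
  fix X Y assume X: "X \<in> quot_univ B" and Y: "Y \<in> quot_univ B" and ne: "X \<noteq> Y"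
  obtain d s h x d' s' h' y where XY: "X = (d, s, h, x)" "Y = (d', s', h', y)" by (metis prod_cases4)
  consider (block) "d' = d" "s' = s" "h' = h" | (down) i where "quot_child i X Y" | (up) i where "quot_child i Y X"
    | (none) "\<not> (d' = d \<and> s' = s \<and> h' = h)" "\<nexists>i. quot_child i X Y" "\<nexists>i. quot_child i Y X" by blast
  then show "\<exists>a\<in>A. \<exists>b\<in>A. tp a = tp (quot_proj X) \<and> tp b = tp (quot_proj Y) \<and>
       (\<forall>v\<in>I \<times> UNIV. dirrel (quot_R B) v X Y \<longrightarrow> dirrel R v a b) \<and> (\<forall>w. dirrel quot_Q w X Y \<longrightarrow> dirrel Q w a b)"
  proof cases
    case block
    have xy: "x \<noteq> y" using ne XY block by auto
    have sx: "s \<in> St" "x \<in> Kc d s" "y \<in> Kc d s" using X Y XY block by (auto simp: quot_univ_def)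
    obtain a b where ab: "a \<in> A" "b \<in> A" "tp a = tp (Kp d s x)" "tp b = tp (Kp d s y)"
      and ab5: "\<forall>v\<in>I \<times> UNIV. dirrel (KR d s) v x y \<longrightarrow> dirrel R v a b"
      and ab6: "\<forall>w. dirrel (KQ d s) w x y \<longrightarrow> dirrel Q w a b"
      using approxD(8)[OF ap, OF sx xy] by blast
    have "dirrel R v a b" if "v \<in> I \<times> UNIV" "dirrel (quot_R B) v X Y" for v
    proof -
      have "dirrel (KR d s) v x y"
        by (rule quot_R_block[of d s h x B y v]) (use X Y XY block xy that in simp_all)
      then show ?thesis using ab5 that(1) by blast
    qed
    moreover have "dirrel Q w a b" if "dirrel quot_Q w X Y" for w
    proof -
      have "\<not> quot_child i X Y" "\<not> quot_child i Y X" for i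
        using quot_child_neq(1)[OF _ X, of i Y] quot_child_neq(1)[OF _ Y, of i X] XY block(1)
      unfolding XY fst_conv by blast+
      then have "quot_in_block (\<lambda>d s. dirrel (KQ d s) w) X Y" using that unfolding dirrel_quot_Q by blast
      then have "dirrel (KQ d s) w x y" using XY by simp
      then show ?thesis using ab6 by blast
    qed
    moreover have "tp a = tp (quot_proj X)" "tp b = tp (quot_proj Y)" using ab XY block by simp_all
    ultimately show ?thesis using ab(1,2) by (intro bexI[of _ a] bexI[of _ b]) simp_all
  next
    \<comment> \<open>The partner is the true witness rather than the projection of the child: both
      have the same type, and the relations of a tree edge are those to the witness.\<close>
    case down
    have "tp (wt i (quot_proj X)) = tp (quot_proj Y)" by (rule tp_etype[OF etype_quot_child[OF down, symmetric]])
    moreover have "quot_proj X \<in> A" using quot_proj_C[OF X] C_A by auto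
    ultimately show ?thesis
      by (intro bexI[of _ "quot_proj X"] bexI[of _ "wt i (quot_proj X)"])
        (simp_all add: wt_quot_child[OF down] quot_R_edge[OF X down] quot_Q_edge[OF X down])
  next
    case up
    have "tp (wt i (quot_proj Y)) = tp (quot_proj X)" by (rule tp_etype[OF etype_quot_child[OF up, symmetric]])
    moreover have "quot_proj Y \<in> A" using quot_proj_C[OF Y] C_A by auto
    moreover have "dirrel R v (wt i (quot_proj Y)) (quot_proj Y)" if "v \<in> I \<times> UNIV" "dirrel (quot_R B) v X Y" for v
      using quot_R_edge[OF Y up, of "flip v"] that by (simp add: dirrel_flip mem_Times_iff)
    moreover have "dirrel Q w (wt i (quot_proj Y)) (quot_proj Y)" if "dirrel quot_Q w X Y" for w
      using quot_Q_edge[OF Y up, of "flip w"] that by (simp add: dirrel_flip)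
    ultimately show ?thesis
      by (intro bexI[of _ "wt i (quot_proj Y)"] bexI[of _ "quot_proj Y"]) (simp_all add: wt_quot_child[OF up])
  next
    \<comment> \<open>Such a pair satisfies no \<open>quot_Q\<close> atom. All transitive relations
      that hold are collected in \<open>V\<close> and realised jointly through one arrow.\<close>
    case none
    define V where "V = {v \<in> I \<times> UNIV. dirrel (quot_R B) v X Y}"
    have "arrow V (etype (quot_proj X)) (etype (quot_proj Y))" by (rule arrow_Q[OF X Y]) (auto simp: V_def)
    then obtain b where b: "b \<in> A" "tp b = tp (quot_proj Y)" "\<And>v. v \<in> V \<Longrightarrow> dirrel R v (quot_proj X) b"
      by (rule arrow_etypeE) blast
    have "\<not> quot_in_block K X Y" for K using none(1) XY by auto
    then have "\<not> dirrel quot_Q w X Y" for w using none(2,3) unfolding dirrel_quot_Q by blast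
    moreover have "quot_proj X \<in> A" using quot_proj_C[OF X] C_A by auto
    ultimately show ?thesis
      by (intro bexI[of _ "quot_proj X"] bexI[of _ b]) (simp_all add: b V_def)
  qed
next
  fix X i assume X: "X \<in> quot_univ B" and i: "i < n" and w: "wt i (quot_proj X) \<in> C"
  obtain d s h x where Xe: "X = (d, s, h, x)" by (metis prod_cases4)
  have sx: "s \<in> St" "x \<in> Kc d s" using X Xe by (auto simp: quot_univ_def)
  show "\<exists>Y\<in>quot_univ B. tp (quot_proj Y) = tp (wt i (quot_proj X)) \<and> (wt i (quot_proj X) = quot_proj X \<longrightarrow> Y = X) \<and>
       (\<forall>v\<in>I \<times> UNIV. dirrel R v (quot_proj X) (wt i (quot_proj X)) \<longrightarrow> dirrel (quot_R B) v X Y) \<and>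
       (\<forall>w. dirrel Q w (quot_proj X) (wt i (quot_proj X)) \<longrightarrow> dirrel quot_Q w X Y)"
  proof (cases "wt i (quot_proj X) \<in> D d s")
    case True
    obtain y where y: "y \<in> Kc d s" "tp (Kp d s y) = tp (wt i (quot_proj X))" "wt i (quot_proj X) = quot_proj X \<longrightarrow> y = x"
      "\<forall>v\<in>I \<times> UNIV. dirrel R v (quot_proj X) (wt i (quot_proj X)) \<longrightarrow> dirrel (KR d s) v x y"
      "\<forall>w. dirrel Q w (quot_proj X) (wt i (quot_proj X)) \<longrightarrow> dirrel (KQ d s) w x y"
      using approxD(9)[OF ap, OF sx i] True Xe by auto
    let ?Y = "(d, s, h, y)"
    have Y: "?Y \<in> quot_univ B" using X Xe y(1) KB[OF sx(1)] by (auto simp: quot_univ_def)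
    have "dirrel (quot_R B) v X ?Y" if "v \<in> I \<times> UNIV" "dirrel R v (quot_proj X) (wt i (quot_proj X))" for v
    proof -
      have "dirrel (KR d s) v x y" using that y(4) by blast
      then have "(X, ?Y) \<in> quot_rel B v" using X Y Xe by (simp add: quot_rel_def)
      then show ?thesis by (auto simp: dirrel_quot_R)
    qed
    moreover have "dirrel quot_Q u X ?Y" if "dirrel Q u (quot_proj X) (wt i (quot_proj X))" for u
    proof -
      have "dirrel (KQ d s) u x y" using that y(5) by blast
      then show ?thesis using Xe by (simp add: dirrel_quot_Q)
    qed
    ultimately show ?thesis using Y y(2,3) Xe by (intro bexI[of _ ?Y]) simp_all
  next
    case False
    have l: "link d s x i" using False w i sx Xe by (simp add: link_def)
    let ?Y = "(Suc d mod m, next_state d s x i, take m ((s, x, i) # h), Ko (Suc d mod m) (next_state d s x i))"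
    have Y: "?Y \<in> quot_univ B" using child_quot_univ[OF X[unfolded Xe] l KB] .
    have dn: "quot_child i X ?Y" using l Xe by simp
    have "dirrel (quot_R B) v X ?Y" if "dirrel R v (quot_proj X) (wt i (quot_proj X))" for v
    proof -
      have "(X, ?Y) \<in> quot_rel B v" using that X Y dn unfolding quot_rel_def by blast
      then show ?thesis by (auto simp: dirrel_quot_R)
    qed
    moreover have "dirrel quot_Q u X ?Y" if "dirrel Q u (quot_proj X) (wt i (quot_proj X))" for u
      using that dn unfolding dirrel_quot_Q by blast
    moreover have "wt i (quot_proj X) \<noteq> quot_proj X" using linkD(4,7)[OF l] Xe by auto
    moreover have "tp (quot_proj ?Y) = tp (wt i (quot_proj X))" by (rule tp_etype[OF etype_quot_child[OF dn]])
    ultimately show ?thesis using Y by (intro bexI[of _ ?Y]) simp_all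
  qed
qed

end

section \<open>Induction on the labels that are not yet total\<close>

context colored_relations begin

section \<open>Heights, components and highest representatives\<close>

definition total_class :: "nat set \<Rightarrow> 'a set \<Rightarrow> bool" where
  "total_class S C \<longleftrightarrow> (\<forall>a\<in>C. \<forall>b\<in>C. a \<noteq> b \<longrightarrow> (\<forall>l\<in>S. R l a b))"

text \<open>A numerical height for direction \<open>v\<close>: constant on strongly connected
  components and strictly increasing along edges that cannot be reversed.\<close>

definition rank :: "'a set \<Rightarrow> nat \<times> bool \<Rightarrow> 'a \<Rightarrow> nat" where
  "rank C v a = card {c \<in> C. c = a \<or> dirrel R v c a}"

definition top_rep :: "'a set \<Rightarrow> nat \<times> bool \<Rightarrow> 't \<times> ((nat \<times> bool) set \<times> 't) set \<Rightarrow> 'a" where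
  "top_rep C v \<tau> = (SOME a. a \<in> C \<and> etype a = \<tau> \<and> (\<forall>c\<in>C. etype c = \<tau> \<longrightarrow> rank C v c \<le> rank C v a))"

lemma top_rep:
  assumes "finite C" "b \<in> C"
  shows "top_rep C v (etype b) \<in> C" "etype (top_rep C v (etype b)) = etype b" "rank C v b \<le> rank C v (top_rep C v (etype b))"
proof -
  let ?E = "{c \<in> C. etype c = etype b}"
  have fin: "finite (rank C v ` ?E)" "rank C v ` ?E \<noteq> {}" using assms by auto
  obtain a where a: "a \<in> ?E" "rank C v a = Max (rank C v ` ?E)" using Max_in[OF fin] by auto
  have "\<forall>c\<in>C. etype c = etype b \<longrightarrow> rank C v c \<le> rank C v a" using a(2) Max_ge[OF fin(1)] by auto
  then have "\<exists>a. a \<in> C \<and> etype a = etype b \<and> (\<forall>c\<in>C. etype c = etype b \<longrightarrow> rank C v c \<le> rank C v a)"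
    using a(1) by blast
  from someI_ex[OF this] show "top_rep C v (etype b) \<in> C" "etype (top_rep C v (etype b)) = etype b"
    "rank C v b \<le> rank C v (top_rep C v (etype b))"
    using assms unfolding top_rep_def by auto
qed

lemma rank_less:
  assumes "finite C" "fst v \<in> I" "c \<in> C" "b \<in> C" "dirrel R v c b" "\<not> dirrel R v b c" "c \<noteq> b"
  shows "rank C v c < rank C v b"
proof -
  let ?P = "\<lambda>a. {x \<in> C. x = a \<or> dirrel R v x a}"
  have "?P c \<subseteq> ?P b" using assms(5) trans_dirrel[OF assms(2), of _ c b] by auto
  moreover have "b \<in> ?P b" "b \<notin> ?P c" using assms by auto
  ultimately have "?P c \<subset> ?P b" by blast
  then show ?thesis unfolding rank_def using assms(1) by (intro psubset_card_mono) auto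
qed

lemma rank_eq:
  assumes "fst v \<in> I" "c \<in> C" "s \<in> C" "dirrel R v c s" "dirrel R v s c"
  shows "rank C v c = rank C v s"
proof -
  have "{x \<in> C. x = c \<or> dirrel R v x c} = {x \<in> C. x = s \<or> dirrel R v x s}"
    using assms(4,5) trans_dirrel[OF assms(1), of _ c s] trans_dirrel[OF assms(1), of _ s c] by auto
  then show ?thesis by (simp add: rank_def)
qed

text \<open>At levels devoted to something outside \<open>I - S\<close> the blocks are single
  points.\<close>

definition scc :: "nat set \<Rightarrow> 'a set \<Rightarrow> nat \<Rightarrow> 'a \<Rightarrow> 'a set" where
  "scc S C u s = (if u \<in> I - S then {c \<in> C. c = s \<or> (R u s c \<and> R u c s)} else {s})"

text \<open>What counts as high depends on the edge by which the block is left: for a forward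
  \<open>u\<close>-edge the order of \<open>u\<close> is used, otherwise the reversed one.\<close>

definition next_rep :: "'a set \<Rightarrow> nat \<Rightarrow> 'a \<Rightarrow> 'a \<Rightarrow> 'a" where
  "next_rep C u c b = top_rep C (u, R u c b) (etype b)"

text \<open>An edge leaving the component is not reversible, so its direction is the one that
  \<open>next_rep\<close> reads off. Rank is the same at \<open>s\<close> and \<open>c\<close>,
  grows from \<open>c\<close> to \<open>b\<close>, and does not drop on passing to the highest
  representative.\<close>

lemma scc_step:
  assumes fin: "finite C" and u: "u \<in> I - S" and s: "s \<in> C" and c: "c \<in> scc S C u s"
    and b: "b \<in> C - scc S C u s" and d: "dirrel R (u, e) c b"
  shows "next_rep C u c b = top_rep C (u, e) (etype b)" "rank C (u, e) s < rank C (u, e) (top_rep C (u, e) (etype b))"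
proof -
  have cC: "c \<in> C" "c = s \<or> (R u s c \<and> R u c s)" using c u by (auto simp: scc_def)
  have tr: "R u x y \<Longrightarrow> R u y z \<Longrightarrow> R u x z" for x y z using trans_R u by blast
  have nb: "b \<noteq> s" "\<not> (R u s b \<and> R u b s)" using b u by (auto simp: scc_def)
  have ns: "\<not> (R u c b \<and> R u b c)" using cC nb tr by blast
  then have e: "R u c b = e" using d by (cases e) (auto simp: dirrel_def)
  show "next_rep C u c b = top_rep C (u, e) (etype b)" using e by (simp add: next_rep_def)
  have "\<not> dirrel R (u, e) b c" using ns d by (auto simp: dirrel_def split: if_splits)
  moreover have "c \<noteq> b" using cC(2) nb by auto
  ultimately have 1: "rank C (u, e) c < rank C (u, e) b"
    using rank_less[OF fin _ cC(1), of "(u, e)" b] b d u by auto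
  have 2: "rank C (u, e) c = rank C (u, e) s"
  proof (cases "c = s")
    case False
    then show ?thesis using rank_eq[of "(u, e)" c C s] cC u s by (auto simp: dirrel_def)
  qed simp
  show "rank C (u, e) s < rank C (u, e) (top_rep C (u, e) (etype b))"
    using 1 2 top_rep(3)[OF fin, of b "(u, e)"] b by auto
qed

text \<open>A highest representative is recovered from its enriched type and the direction, so a
  repeated type would repeat a state and contradict the growth of rank. The start \<open>s 0\<close>
  may be any element and is left out; the \<open>N + 1\<close> states after it are already too
  many.\<close>

lemma chain_bound:
  assumes fin: "finite C" and u: "u \<in> I - S" and N: "card (etype ` C) \<le> N"
    and ch: "\<And>j. j \<le> N \<Longrightarrow> s j \<in> C \<and> c j \<in> scc S C u (s j) \<and> b j \<in> C - scc S C u (s j) \<and>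
      s (Suc j) = next_rep C u (c j) (b j) \<and> dirrel R (u, e) (c j) (b j)"
  shows False
proof -
  have st: "s (Suc j) = top_rep C (u, e) (etype (b j))" "rank C (u, e) (s j) < rank C (u, e) (s (Suc j))"
    if "j \<le> N" for j
  proof -
    have "s j \<in> C" "c j \<in> scc S C u (s j)" "b j \<in> C - scc S C u (s j)" "dirrel R (u, e) (c j) (b j)"
      and eq: "s (Suc j) = next_rep C u (c j) (b j)" using ch[OF that] by blast+
    note sc = scc_step[OF fin u this(1-4)]
    show "s (Suc j) = top_rep C (u, e) (etype (b j))" using eq sc(1) by (rule trans)
    then show "rank C (u, e) (s j) < rank C (u, e) (s (Suc j))" using sc(2) by (simp only:)
  qed
  have mono: "rank C (u, e) (s i) < rank C (u, e) (s j)" if "i < j" "j \<le> Suc N" for i j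
    using that
  proof (induction j)
    case (Suc j)
    then show ?case using st(2)[of j] by (cases "i = j") auto
  qed simp
  have fp: "top_rep C (u, e) (etype (s (Suc j))) = s (Suc j)" if "j \<le> N" for j
  proof -
    have "b j \<in> C" using ch[OF that] by blast
    then show ?thesis by (simp only: st(1)[OF that] top_rep(2)[OF fin])
  qed
  have "inj_on (\<lambda>j. etype (s (Suc j))) {..N}"
  proof (rule linorder_inj_onI)
    fix i j assume ij: "i < j" "i \<in> {..N}" "j \<in> {..N}"
    show "etype (s (Suc i)) \<noteq> etype (s (Suc j))"
    proof
      assume "etype (s (Suc i)) = etype (s (Suc j))"
      then have "s (Suc i) = s (Suc j)" using fp[of i] fp[of j] ij by (metis atMost_iff)
      then show False using mono[of "Suc i" "Suc j"] ij by simp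
    qed
  qed auto
  moreover have "(\<lambda>j. etype (s (Suc j))) ` {..N} \<subseteq> etype ` C"
  proof (intro image_subsetI imageI)
    fix j assume "j \<in> {..N}"
    then have j: "j \<le> N" by simp
    then have "b j \<in> C" using ch by blast
    then show "s (Suc j) \<in> C" unfolding st(1)[OF j] by (rule top_rep(1)[OF fin])
  qed
  ultimately have "card {..N} \<le> card (etype ` C)"
    using fin by (intro card_inj_on_le) auto
  then show False using N by simp
qed

text \<open>The schedule: level \<open>z\<close> is devoted to the label \<open>schedule us N z\<close>; each label in turn gets
  \<open>N + 1\<close> consecutive levels, so that by \<open>chain_bound\<close> every path of its relation dies out.\<close>

definition schedule :: "nat list \<Rightarrow> nat \<Rightarrow> nat \<Rightarrow> nat" where
  "schedule us N z = us ! ((z mod (length us * Suc N)) div Suc N)"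

lemma schedule_in: "us \<noteq> [] \<Longrightarrow> schedule us N z \<in> set us"
  unfolding schedule_def
  by (intro nth_mem less_mult_imp_div_less mod_less_divisor) simp

text \<open>A window may begin in the midst of a run of \<open>u\<close>, but two periods always
  contain a whole run: that of the first period starting after \<open>z\<close>.\<close>

lemma schedule_block:
  assumes "u \<in> set us"
  obtains J where "z \<le> J" "J + N < z + 2 * (length us * Suc N)"
    "\<And>i. i \<le> N \<Longrightarrow> schedule us N (J + i) = u"
proof -
  obtain t where t: "t < length us" "us ! t = u" using assms by (auto simp: in_set_conv_nth)
  define P where "P = length us * Suc N"
  have tP: "t * Suc N + N < P"
  proof -
    have "Suc t * Suc N \<le> P" unfolding P_def using t by (intro mult_le_mono1) simp
    then show ?thesis by simp
  qed
  define J where "J = Suc (z div P) * P + t * Suc N"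
  have "z mod P < P" using tP by simp
  then have z: "z < Suc (z div P) * P" "Suc (z div P) * P \<le> z + P"
    using div_mult_mod_eq[of z P] by (simp_all only: mult_Suc)
  have 3: "schedule us N (J + i) = u" if "i \<le> N" for i
  proof -
    have "(J + i) mod P = (t * Suc N + i) mod P"
      unfolding J_def add.assoc by (rule mod_mult_self3)
    also have "\<dots> = t * Suc N + i" using tP that by (intro mod_less) linarith
    finally have 1: "(J + i) mod P = t * Suc N + i" .
    have "(t * Suc N + i) div Suc N = t + i div Suc N" by (rule div_mult_self3) simp
    also have "\<dots> = t" using that by simp
    finally show ?thesis unfolding schedule_def P_def[symmetric] 1 using t(2) by (simp only:)
  qed
  have 1: "z \<le> J" using z(1) unfolding J_def by linarith
  have 2: "J + N < z + 2 * P" using z(2) tP unfolding J_def by linarith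
  show thesis by (rule that[OF 1 2[unfolded P_def] 3])
qed

lemma schedule_mod: "P dvd k \<Longrightarrow> P = length us * Suc N \<Longrightarrow> schedule us N (z mod k) = schedule us N z"
  by (simp add: schedule_def mod_mod_cancel)

text \<open>The factors are the modulus, a bound on the number of states (the root and one
  representative for each label, direction and enriched type), and the number of demand indices in
  letters.\<close>

definition bound_base :: "nat list \<Rightarrow> nat \<Rightarrow> nat" where
  "bound_base us N = 4 * (length us * Suc N) * (1 + length us * 2 * N) * Suc n"

definition modulus :: "nat list \<Rightarrow> nat \<Rightarrow> nat" where
  "modulus us N = 4 * (length us * Suc N)"

section \<open>The induction step and the resulting size\<close>

lemma scc_total_class:
  assumes "total_class S C" "u \<in> I - S" "s \<in> C"
  shows "total_class (insert u S) (scc S C u s)"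
proof -
  have "R u a b" if "a \<in> scc S C u s" "b \<in> scc S C u s" "a \<noteq> b" for a b
  proof -
    have "a = s \<or> R u a s" "b = s \<or> R u s b" using that assms(2) by (auto simp: scc_def)
    moreover have "a = s \<Longrightarrow> R u s b" "b = s \<Longrightarrow> R u a s" using that calculation by auto
    ultimately show ?thesis using trans_R[of u a s b] assms(2) by blast
  qed
  moreover have "scc S C u s \<subseteq> C" using assms(3) by (auto simp: scc_def)
  ultimately show ?thesis using assms(1) unfolding total_class_def by blast
qed

text \<open>That \<open>a\<close> itself is met by the projection allows a child block to have its
  origin exactly at the prescribed state.\<close>

definition approximable :: "nat \<Rightarrow> nat set \<Rightarrow> 'a set \<Rightarrow> 'a \<Rightarrow> bool" where
  "approximable B S C a \<longleftrightarrow> (\<exists>c p (R' :: nat \<Rightarrow> nat \<Rightarrow> nat \<Rightarrow> bool) Q'.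
     c \<le> B \<and> approx S C {..<c} p R' Q' \<and> a \<in> p ` {..<c})"

lemma approximable_singleton: "1 \<le> B \<Longrightarrow> approximable B S {a} a"
  unfolding approximable_def
  using approx_singleton[of S a "0::nat"]
  by (intro exI[of _ "1::nat"] exI[of _ "\<lambda>_. a"]) (auto simp: lessThan_Suc)

lemma approximable_step:
  assumes SI: "S \<subseteq> I" and CA: "C \<subseteq> A" and C: "total_class S C" and a: "a \<in> C"
    and us: "I \<subseteq> set us" "us \<noteq> []" and N: "card (etype ` A) \<le> N" and B: "1 \<le> B"
    and IH: "\<And>u D s. u \<in> I - S \<Longrightarrow> D \<subseteq> A \<Longrightarrow> total_class (insert u S) D \<Longrightarrow> s \<in> D \<Longrightarrow>
      approximable B (insert u S) D s"
  shows "approximable ((bound_base us N * B) ^ Suc (modulus us N)) S C a"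
\<comment> \<open>\<open>total_class\<close> speaks of distinct elements only, so a one-point class
  may lack loops. With a second element present, loops follow by transitivity.\<close>
proof (cases "C = {a}")
  case True
  have "1 \<le> bound_base us N * B" using us(2) B by (cases us) (simp_all add: bound_base_def)
  then show ?thesis using approximable_singleton[of _ S a] True by (simp add: Suc_le_eq)
next
  case False
  then obtain a' where a': "a' \<in> C" "a' \<noteq> a" using a by blast
  have finC: "finite C" using CA fin_A finite_subset by blast
  have tot: "R l x y" if "l \<in> S" "x \<in> C" "y \<in> C" for l x y
  proof (cases "x = y")
    case True
    obtain w where w: "w \<in> C" "w \<noteq> x" using a a' by metis
    then have "R l x w" "R l w x" using C that by (auto simp: total_class_def)
    then show ?thesis using True trans_R[of l x w x] that SI by auto
  next
    case False
    then show ?thesis using C that by (auto simp: total_class_def)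
  qed
  define P where "P = length us * Suc N"
  \<comment> \<open>Two periods contain a full run of every label, and \<open>2 * M\<close> is a
    multiple of the period, so the schedule depends only on the level modulo
    \<open>2 * M\<close>.\<close>
  define M where "M = 2 * P"
  have P1: "1 \<le> P" using us(2) by (cases us) (simp_all add: P_def)
  define D where "D z s = scc S C (schedule us N z) s" for z s
  define rep where "rep z c b = next_rep C (schedule us N z) c b" for z c b
  define St where "St = insert a ((\<lambda>(v, \<tau>). top_rep C v \<tau>) ` ((set us \<times> UNIV) \<times> etype ` C))"
  have DC: "D z s \<subseteq> C" if "s \<in> C" for z s using that by (auto simp: D_def scc_def)
  have sD: "s \<in> D z s" if "s \<in> C" for z s using that by (auto simp: D_def scc_def)
  have "\<exists>t. s \<in> C \<longrightarrow> (case t of (c, p, R', Q', k) \<Rightarrow> c \<le> B \<and>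
     approx S (D z s) {..<c::nat} p R' Q' \<and> k < c \<and> p k = s)" for z s
  proof (cases "s \<in> C")
    case True
    have "approximable B S (D z s) s"
    proof (cases "schedule us N z \<in> I - S")
      case u: True
      have "approximable B (insert (schedule us N z) S) (D z s) s"
        using IH[OF u, of "D z s" s] DC[OF True] sD[OF True] CA scc_total_class[OF C u True]
        unfolding D_def by blast
      then show ?thesis unfolding approximable_def using approx_mono by blast
    next
      case False
      then have "D z s = {s}" by (auto simp: D_def scc_def)
      then show ?thesis using approximable_singleton[OF B] by simp
    qed
    then obtain c p R' Q' k where "c \<le> B" "approx S (D z s) {..<c::nat} p R' Q'" "k < c" "p k = s"
      unfolding approximable_def by auto
    then show ?thesis by (intro exI[of _ "(c, p, R', Q', k)"]) simp
  qed simp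
  then have "\<forall>zs. \<exists>t. snd zs \<in> C \<longrightarrow> (case t of (c, p, R', Q', k) \<Rightarrow> c \<le> B \<and>
     approx S (D (fst zs) (snd zs)) {..<c::nat} p R' Q' \<and> k < c \<and> p k = snd zs)" by blast
  from choice[OF this] obtain F where F: "\<And>zs. snd zs \<in> C \<longrightarrow> (case F zs of (c, p, R', Q', k) \<Rightarrow> c \<le> B \<and>
     approx S (D (fst zs) (snd zs)) {..<c::nat} p R' Q' \<and> k < c \<and> p k = snd zs)" by blast
  define Kn where "Kn z s = fst (F (z, s))" for z s
  define Kp where "Kp z s = fst (snd (F (z, s)))" for z s
  define KR where "KR z s = fst (snd (snd (F (z, s))))" for z s
  define KQ where "KQ z s = fst (snd (snd (snd (F (z, s)))))" for z s
  define Ko where "Ko z s = snd (snd (snd (snd (F (z, s)))))" for z s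
  have K: "Kn z s \<le> B \<and> approx S (D z s) {..<Kn z s} (Kp z s) (KR z s) (KQ z s) \<and>
      Ko z s < Kn z s \<and> Kp z s (Ko z s) = s" if "s \<in> C" for z s
    using F[of "(z, s)"] that unfolding Kn_def Kp_def KR_def KQ_def Ko_def
    by (simp add: case_prod_unfold)
  have finS: "finite ((set us \<times> (UNIV :: bool set)) \<times> etype ` C)" using finC by simp
  have rpC: "top_rep C v \<tau> \<in> C" if "\<tau> \<in> etype ` C" for v \<tau>
  proof -
    have "\<exists>b\<in>C. \<tau> = etype b" using that by blast
    then obtain b where "b \<in> C" "\<tau> = etype b" by blast
    then show ?thesis using top_rep(1)[OF finC, of b v] by simp
  qed
  have "(\<lambda>(v, \<tau>). top_rep C v \<tau>) ` ((set us \<times> UNIV) \<times> etype ` C) \<subseteq> C"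
    by (rule image_subsetI) (simp add: case_prod_unfold rpC mem_Times_iff)
  then have StC: "St \<subseteq> C" unfolding St_def using a by simp
  interpret L: layered A I R Q tp wt n S C M D "\<lambda>z s. {..<Kn z s}" Kp KR KQ Ko rep St
  proof
    show "S \<subseteq> I" "C \<subseteq> A" "St \<subseteq> C" by fact+
    show "2 \<le> M" using P1 by (simp add: M_def)
    show "finite St" unfolding St_def using finS by simp
    show "R l x y" if "l \<in> S" "x \<in> C" "y \<in> C" for l x y using tot that .
    fix s z assume "s \<in> St"
    then have s: "s \<in> C" using StC by blast
    show "approx S (D z s) {..<Kn z s} (Kp z s) (KR z s) (KQ z s)" "D z s \<subseteq> C"
      "Ko z s \<in> {..<Kn z s}" "Kp z s (Ko z s) = s"
      using K[OF s] DC[OF s] by auto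
  next
    fix b z c assume b: "b \<in> C"
    have "schedule us N z \<in> set us" using schedule_in us(2) by blast
    then show "rep z c b \<in> St" using b unfolding St_def rep_def next_rep_def by force
    show "etype (rep z c b) = etype b" using top_rep(2)[OF finC b] by (simp add: rep_def next_rep_def)
  next
    fix v ss cs z bs
    assume v: "fst v \<in> I - S"
      and ch: "\<And>j. j < M \<Longrightarrow> ss j \<in> St \<and> cs j \<in> D ((z + j) mod (2 * M)) (ss j) \<and>
         bs j \<in> C - D ((z + j) mod (2 * M)) (ss j) \<and>
         ss (Suc j) = rep ((z + j) mod (2 * M)) (cs j) (bs j) \<and> dirrel R v (cs j) (bs j)"
    have vu: "fst v \<in> set us" using v us(1) by blast
    obtain J where J: "z \<le> J" "J + N < z + 2 * (length us * Suc N)"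
      "\<And>i. i \<le> N \<Longrightarrow> schedule us N (J + i) = fst v" using schedule_block[OF vu, of z N] by blast
    define k where "k = J - z"
    have k: "k + i < M" "schedule us N ((z + (k + i)) mod (2 * M)) = fst v" if "i \<le> N" for i
    proof -
      show "k + i < M" using that J(1,2) by (simp add: k_def M_def P_def)
      have "z + (k + i) = J + i" using J(1) by (simp add: k_def)
      moreover have "P dvd 2 * M" by (simp add: M_def)
      ultimately show "schedule us N ((z + (k + i)) mod (2 * M)) = fst v"
        using J(3)[OF that] schedule_mod[OF _ P_def, of "2 * M" "z + (k + i)"] by (simp only:)
    qed
    show False
    proof (rule chain_bound[OF finC v, where N = N and e = "snd v" and s = "\<lambda>j. ss (k + j)"
          and c = "\<lambda>j. cs (k + j)" and b = "\<lambda>j. bs (k + j)"])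
      have "card (etype ` C) \<le> card (etype ` A)" using CA fin_A by (intro card_mono) auto
      then show "card (etype ` C) \<le> N" using N by simp
      fix j assume "j \<le> N"
      from ch[OF k(1)[OF this]] k(2)[OF this] StC
      show "ss (k + j) \<in> C \<and> cs (k + j) \<in> scc S C (fst v) (ss (k + j)) \<and>
        bs (k + j) \<in> C - scc S C (fst v) (ss (k + j)) \<and>
        ss (k + Suc j) = next_rep C (fst v) (cs (k + j)) (bs (k + j)) \<and>
        dirrel R (fst v, snd v) (cs (k + j)) (bs (k + j))"
        unfolding D_def rep_def by auto
    qed
  qed
  have KB: "{..<Kn z s} \<subseteq> {..<B}" if "s \<in> St" for z s using K[of s z] that StC by auto
  have ap: "approx S C (L.quot_univ B) L.quot_proj (L.quot_R B) L.quot_Q" using L.approx_quot_univ[OF KB] .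
  obtain f where f: "bij_betw f {..<card (L.quot_univ B)} (L.quot_univ B)"
    using ex_bij_betw_nat_finite[OF L.finite_quot_univ] by (auto simp: lessThan_atLeast0)
  have "a \<in> L.quot_proj ` L.quot_univ B" using L.quot_univ_point[OF _ KB] by (simp add: St_def)
  then have "a \<in> (L.quot_proj \<circ> f) ` {..<card (L.quot_univ B)}"
    unfolding image_comp[symmetric] bij_betw_imp_surj_on[OF f] .
  moreover have "card (L.quot_univ B) \<le> (bound_base us N * B) ^ Suc (modulus us N)"
  proof -
    let ?st = "1 + length us * 2 * N" and ?q = "bound_base us N * B"
    have mm: "L.m = modulus us N" unfolding L.m_def by (simp add: M_def P_def modulus_def)
    have "card (etype ` C) \<le> card (etype ` A)" using CA fin_A by (intro card_mono) auto
    then have e: "card (etype ` C) \<le> N" using N by simp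
    have "card St \<le> Suc (card ((\<lambda>(v, \<tau>). top_rep C v \<tau>) ` ((set us \<times> UNIV) \<times> etype ` C)))"
      unfolding St_def by (rule card_insert_le_m1) auto
    also have "\<dots> \<le> Suc (card ((set us \<times> (UNIV :: bool set)) \<times> etype ` C))"
      using card_image_le[OF finS] by simp
    also have "\<dots> = Suc (card (set us) * 2 * card (etype ` C))"
      by (simp add: card_cartesian_product)
    also have "\<dots> \<le> Suc (length us * 2 * N)"
      using e card_length[of us] by (intro Suc_le_mono[THEN iffD2] mult_le_mono) auto
    finally have st: "card St \<le> ?st" by simp
    have m1: "1 \<le> L.m" using L.m_pos by simp
    have q: "bound_base us N = L.m * ?st * Suc n" unfolding mm by (simp add: bound_base_def modulus_def)
    have 1: "L.m * card St * B \<le> ?q"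
    proof -
      have "L.m * card St * B \<le> L.m * ?st * B" using st by (intro mult_le_mono) auto
      also have "\<dots> \<le> L.m * ?st * Suc n * B" by simp
      finally show ?thesis unfolding q .
    qed
    have 2: "card St * (B * Suc n) \<le> ?q"
    proof -
      have "card St * (B * Suc n) \<le> 1 * (?st * (B * Suc n))" using st by (simp only: mult_1) (intro mult_le_mono, auto)
      also have "\<dots> \<le> L.m * (?st * (B * Suc n))" using m1 by (intro mult_le_mono) auto
      also have "\<dots> = L.m * ?st * Suc n * B" by (simp only: mult_ac)
      finally show ?thesis unfolding q .
    qed
    have "card (L.quot_univ B) \<le> L.m * (card St * ((card St * (B * Suc n)) ^ L.m * B))" by (rule L.card_quot_univ)
    also have "\<dots> = (L.m * card St * B) * (card St * (B * Suc n)) ^ L.m" by (simp only: mult_ac)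
    also have "\<dots> \<le> ?q * ?q ^ L.m" by (rule mult_le_mono[OF 1 power_mono[OF 2]]) simp
    finally show ?thesis using mm by simp
  qed
  ultimately show ?thesis unfolding approximable_def using approx_transport[OF ap f] by blast
qed

theorem approximable_bound:
  assumes us: "I \<subseteq> set us" "us \<noteq> []" and N: "card (etype ` A) \<le> N"
  shows "S \<subseteq> I \<Longrightarrow> C \<subseteq> A \<Longrightarrow> total_class S C \<Longrightarrow> a \<in> C \<Longrightarrow> card (I - S) = j \<Longrightarrow>
    approximable (bound_base us N ^ ((2 * Suc (modulus us N)) ^ Suc j)) S C a"
proof (induction j arbitrary: S C a)
  have q1: "1 \<le> bound_base us N" using us(2) by (cases us) (simp_all add: bound_base_def)
  have mono: "approximable B' S C a" if "approximable B S C a" "B \<le> B'" for B B' S C a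
    using that unfolding approximable_def by (meson order_trans)
  {
    case 0
    \<comment> \<open>No label is left outside \<open>S\<close>: all blocks are points, and the
      recursion starts from the bound 1.\<close>
    have "approximable ((bound_base us N * 1) ^ Suc (modulus us N)) S C a"
      using 0 fin_I by (intro approximable_step[OF _ _ _ _ us N]) auto
    moreover have "(bound_base us N * 1) ^ Suc (modulus us N) \<le> bound_base us N ^ ((2 * Suc (modulus us N)) ^ Suc 0)"
      unfolding mult_1_right using q1 by (intro power_increasing) auto
    ultimately show ?case by (rule mono)
  next
    case (Suc j)
    let ?e = "(2 * Suc (modulus us N)) ^ Suc j"
    have "approximable (bound_base us N ^ ?e) (insert u S) D s"
      if u: "u \<in> I - S" and "D \<subseteq> A" "total_class (insert u S) D" "s \<in> D" for u D s
    proof (rule Suc.IH)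
      have "I - insert u S = (I - S) - {u}" by auto
      then show "card (I - insert u S) = j" using Suc.prems(5) u fin_I by simp
    qed (use that Suc.prems in auto)
    moreover have "1 \<le> bound_base us N ^ ?e" using q1 by simp
    ultimately have "approximable ((bound_base us N * bound_base us N ^ ?e) ^ Suc (modulus us N)) S C a"
      using Suc.prems by (intro approximable_step[OF _ _ _ _ us N])
    moreover have "(bound_base us N * bound_base us N ^ ?e) ^ Suc (modulus us N)
      \<le> bound_base us N ^ ((2 * Suc (modulus us N)) ^ Suc (Suc j))"
    proof -
      have "1 \<le> ?e" by (rule one_le_power) simp
      then have "Suc ?e * Suc (modulus us N) \<le> (2 * ?e) * Suc (modulus us N)" by (intro mult_le_mono1) linarith
      also have "\<dots> = (2 * Suc (modulus us N)) ^ Suc (Suc j)" by (simp only: power_Suc mult_ac)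
      finally have "bound_base us N ^ (Suc ?e * Suc (modulus us N)) \<le> bound_base us N ^ ((2 * Suc (modulus us N)) ^ Suc (Suc j))"
        using q1 by (rule power_increasing)
      then show ?thesis by (simp only: power_mult power_Suc)
    qed
    ultimately show ?case by (rule mono)
  }
qed

end

section \<open>From formulas to coloured relations\<close>

text \<open>A list rather than a set: positions in it serve as demand indices.\<close>

primrec subformulas :: "fm \<Rightarrow> fm list" where
  "subformulas (Atom R xs) = [Atom R xs]"
| "subformulas (Eq x y) = [Eq x y]"
| "subformulas (And \<phi> \<psi>) = And \<phi> \<psi> # subformulas \<phi> @ subformulas \<psi>"
| "subformulas (Or \<phi> \<psi>) = Or \<phi> \<psi> # subformulas \<phi> @ subformulas \<psi>"
| "subformulas (Exists x \<phi>) = Exists x \<phi> # subformulas \<phi>"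
| "subformulas (Neg \<phi>) = Neg \<phi> # subformulas \<phi>"

lemma length_subformulas: "length (subformulas \<phi>) \<le> fm_length \<phi>"
  by (induction \<phi>) auto

lemma subformulas_self: "\<phi> \<in> set (subformulas \<phi>)"
  by (cases \<phi>) auto

lemma subformulas_props:
  assumes "\<psi> \<in> set (subformulas \<phi>)"
  shows "unfo \<sigma> \<phi> \<Longrightarrow> unfo \<sigma> \<psi>" "all_vars \<psi> \<subseteq> all_vars \<phi>" "fm_symbols \<psi> \<subseteq> fm_symbols \<phi>"
  using assms by (induction \<phi>) (auto; blast)+

lemma finite_fm_symbols: "finite (fm_symbols \<phi>)"
  by (induction \<phi>) auto

lemma card_fm_symbols: "card (fm_symbols \<phi>) \<le> fm_length \<phi>"
proof (induction \<phi>)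
  case (And \<phi> \<psi>)
  then show ?case using card_Un_le[of "fm_symbols \<phi>" "fm_symbols \<psi>"] by simp
next
  case (Or \<phi> \<psi>)
  then show ?case using card_Un_le[of "fm_symbols \<phi>" "fm_symbols \<psi>"] by simp
qed auto

lemma free_vars_all_vars: "free_vars \<phi> \<subseteq> all_vars \<phi>"
  by (induction \<phi>) auto

lemma sat_cong: "(\<And>x. x \<in> free_vars \<phi> \<Longrightarrow> v x = v' x) \<Longrightarrow> sat A v \<phi> \<longleftrightarrow> sat A v' \<phi>"
proof (induction \<phi> arbitrary: v v')
  case (Atom R xs)
  then have "map v xs = map v' xs" by simp
  then show ?case by (simp only: sat.simps)
next
  case (Exists x \<phi>)
  have "sat A (v(x := a)) \<phi> \<longleftrightarrow> sat A (v'(x := a)) \<phi>" for a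
    by (rule Exists.IH) (use Exists.prems in auto)
  then show ?case by simp
next
  case (And \<phi> \<psi>)
  have "sat A v \<phi> \<longleftrightarrow> sat A v' \<phi>" "sat A v \<psi> \<longleftrightarrow> sat A v' \<psi>"
    by (rule And.IH; use And.prems in simp)+
  then show ?case by simp
next
  case (Or \<phi> \<psi>)
  have "sat A v \<phi> \<longleftrightarrow> sat A v' \<phi>" "sat A v \<psi> \<longleftrightarrow> sat A v' \<psi>"
    by (rule Or.IH; use Or.prems in simp)+
  then show ?case by simp
next
  case (Neg \<phi>)
  have "sat A v \<phi> \<longleftrightarrow> sat A v' \<phi>" by (rule Neg.IH) (use Neg.prems in simp)
  then show ?case by simp
qed auto

locale unfo_model =
  fixes \<sigma> :: signature and \<phi> :: fm and A :: "nat struct"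
  assumes unfo: "unfo \<sigma> \<phi>" and two: "two_variable \<sigma> \<phi>" and adm: "admissible \<sigma> A"
    and fin: "finite (universe A)"
begin

text \<open>One label stands for a relation together with its inverse; \<open>T (2 * u)\<close> is
  the label \<open>u\<close> with direction \<open>False\<close>.\<close>

definition labels :: "nat set" where
  "labels = {u \<in> {1..pairs \<sigma>}. T (2 * u - 1) \<in> fm_symbols \<phi> \<or> T (2 * u) \<in> fm_symbols \<phi>}"

definition rel_T :: "nat \<Rightarrow> nat \<Rightarrow> nat \<Rightarrow> bool" where
  "rel_T u a b \<longleftrightarrow> [a, b] \<in> interp A (T (2 * u - 1))"

definition rel_base :: "nat \<Rightarrow> nat \<Rightarrow> nat \<Rightarrow> bool" where
  "rel_base q a b \<longleftrightarrow> [a, b] \<in> interp A (Base q)"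

text \<open>The additional atoms make a type decide all unary and loop atoms, including those that
  are not subformulas.\<close>

definition type_formulas :: "fm set" where
  "type_formulas = set (subformulas \<phi>) \<union> (\<lambda>P. Atom P [0]) ` fm_symbols \<phi> \<union> (\<lambda>P. Atom P [0, 0]) ` fm_symbols \<phi>"

definition one_type :: "nat \<Rightarrow> fm set" where
  "one_type a = {\<psi> \<in> type_formulas. sat A (\<lambda>_. a) \<psi>}"

text \<open>With two variables, a quantified subformula has at most one free variable, so its truth
  at constant assignments covers every case.\<close>

definition witness :: "nat \<Rightarrow> nat \<Rightarrow> nat" where
  "witness i a = (case subformulas \<phi> ! i of
     Exists z \<psi> \<Rightarrow> if \<exists>b\<in>universe A. sat A ((\<lambda>_. a)(z := b)) \<psi>
        then SOME b. b \<in> universe A \<and> sat A ((\<lambda>_. a)(z := b)) \<psi> else a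
   | _ \<Rightarrow> a)"

lemma witness_sat:
  assumes "subformulas \<phi> ! i = Exists z \<psi>" "sat A (\<lambda>_. a) (Exists z \<psi>)"
  shows "witness i a \<in> universe A" "sat A ((\<lambda>_. a)(z := witness i a)) \<psi>"
proof -
  have ex: "\<exists>b. b \<in> universe A \<and> sat A ((\<lambda>_. a)(z := b)) \<psi>" using assms by auto
  then have "witness i a = (SOME b. b \<in> universe A \<and> sat A ((\<lambda>_. a)(z := b)) \<psi>)"
    using assms unfolding witness_def by auto
  then show "witness i a \<in> universe A" "sat A ((\<lambda>_. a)(z := witness i a)) \<psi>"
    using someI_ex[OF ex] by auto
qed

lemma T_conv: "u \<in> {1..pairs \<sigma>} \<Longrightarrow> [a, b] \<in> interp A (T (2 * u)) \<longleftrightarrow> rel_T u b a"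
proof -
  assume "u \<in> {1..pairs \<sigma>}"
  then have "T_rel A (2 * u) = (T_rel A (2 * u - 1))\<inverse>" using adm by (simp add: admissible_def)
  then have "(a, b) \<in> T_rel A (2 * u) \<longleftrightarrow> (b, a) \<in> T_rel A (2 * u - 1)" by simp
  then show ?thesis by (simp add: T_rel_def rel_T_def)
qed

sublocale colored_relations "universe A" labels rel_T rel_base one_type witness "length (subformulas \<phi>)"
proof
  show "finite (universe A)" by (rule fin)
  show "finite labels" by (simp add: labels_def)
  show "rel_T l a c" if l: "l \<in> labels" and "rel_T l a b" "rel_T l b c" for l a b c
  proof -
    have "2 * l - 1 \<in> {1..2 * pairs \<sigma>}" using l by (auto simp: labels_def)
    then have "trans (T_rel A (2 * l - 1))" using adm by (simp add: admissible_def)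
    moreover have "(a, b) \<in> T_rel A (2 * l - 1)" "(b, c) \<in> T_rel A (2 * l - 1)"
      using that by (simp_all add: T_rel_def rel_T_def)
    ultimately have "(a, c) \<in> T_rel A (2 * l - 1)" by (rule transD)
    then show ?thesis by (simp add: T_rel_def rel_T_def)
  qed
qed

section \<open>The small structure and local homomorphisms\<close>

definition local_hom :: "'b struct \<Rightarrow> (nat \<Rightarrow> 'b) \<Rightarrow> 'c struct \<Rightarrow> (nat \<Rightarrow> 'c) \<Rightarrow> bool" where
  "local_hom B v B' v' \<longleftrightarrow> (\<forall>P\<in>fm_symbols \<phi>. \<forall>xs. set xs \<subseteq> {0, 1} \<longrightarrow> length xs = arity \<sigma> P \<longrightarrow>
     map v xs \<in> interp B P \<longrightarrow> map v' xs \<in> interp B' P) \<and> (v 0 = v 1 \<longrightarrow> v' 0 = v' 1)"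

text \<open>Nullary and unary atoms are copied from \<open>A\<close>. Pairs of transitive relations
  outside \<open>labels\<close> become empty, which keeps the structure admissible.\<close>

definition small_struct :: "nat \<Rightarrow> (nat \<Rightarrow> nat) \<Rightarrow> (nat \<Rightarrow> nat \<Rightarrow> nat \<Rightarrow> bool) \<Rightarrow> (nat \<Rightarrow> nat \<Rightarrow> nat \<Rightarrow> bool) \<Rightarrow> nat struct"
  where "small_struct c p R' Q' = \<lparr>universe = {..<c}, interp = (\<lambda>P. case P of
     Base q \<Rightarrow> {xs. Base q \<in> fm_symbols \<phi> \<and> set xs \<subseteq> {..<c} \<and> length xs = arity \<sigma> (Base q) \<and>
        (xs = [] \<and> [] \<in> interp A P \<or> (\<exists>x. xs = [x] \<and> [p x] \<in> interp A P) \<or>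
         (\<exists>x y. xs = [x, y] \<and> Q' q x y))}
   | T k \<Rightarrow> {xs. set xs \<subseteq> {..<c} \<and> (\<exists>u\<in>labels. \<exists>x y. xs = [x, y] \<and>
        (k = 2 * u - 1 \<and> R' u x y \<or> k = 2 * u \<and> R' u y x))})\<rparr>"

lemma labels_pos: "u \<in> labels \<Longrightarrow> 1 \<le> u" "u \<in> labels \<Longrightarrow> u \<le> pairs \<sigma>"
  by (auto simp: labels_def)

lemma T_rel_small_struct:
  assumes "u \<ge> 1"
  shows "T_rel (small_struct c p R' Q') (2 * u - 1) = {(x, y). x < c \<and> y < c \<and> u \<in> labels \<and> R' u x y}"
    "T_rel (small_struct c p R' Q') (2 * u) = {(x, y). x < c \<and> y < c \<and> u \<in> labels \<and> R' u y x}"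
proof -
  have 1: "2 * u - 1 = 2 * w - 1 \<longleftrightarrow> u = w" "2 * u - 1 \<noteq> 2 * w" "2 * u \<noteq> 2 * w - 1" if "w \<in> labels" for w
    using assms labels_pos(1)[OF that] by presburger+
  show "T_rel (small_struct c p R' Q') (2 * u - 1) = {(x, y). x < c \<and> y < c \<and> u \<in> labels \<and> R' u x y}"
    using 1 by (auto simp: T_rel_def small_struct_def)
  show "T_rel (small_struct c p R' Q') (2 * u) = {(x, y). x < c \<and> y < c \<and> u \<in> labels \<and> R' u y x}"
    using 1 by (auto simp: T_rel_def small_struct_def)
qed

lemma admissible_small_struct:
  assumes ap: "approx {} (universe A) {..<c} p R' Q'" and c: "0 < c"
  shows "admissible \<sigma> (small_struct c p R' Q')"
  unfolding admissible_def
proof (intro conjI ballI)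
  show "is_struct \<sigma> (small_struct c p R' Q')"
    unfolding is_struct_def
  proof (intro conjI ballI subsetI)
    show "universe (small_struct c p R' Q') \<noteq> {}" using c by (auto simp: small_struct_def)
    fix P xs assume "P \<in> symbols \<sigma>" "xs \<in> interp (small_struct c p R' Q') P"
    then show "xs \<in> {as. set as \<subseteq> universe (small_struct c p R' Q') \<and> length as = arity \<sigma> P}"
      by (auto simp: small_struct_def split: symbol.splits)
  qed
  have tr: "R' u x z" if "u \<in> labels" "x < c" "y < c" "z < c" "R' u x y" "R' u y z" for u x y z
    using approxD(3)[OF ap, of u x y z] that by simp
  have tr1: "trans {(x, y). x < c \<and> y < c \<and> u \<in> labels \<and> R' u x y}" for u
    by (rule transI) (use tr in blast)
  have tr2: "trans {(x, y). x < c \<and> y < c \<and> u \<in> labels \<and> R' u y x}" for u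
    by (rule transI) (use tr in blast)
  show "trans (T_rel (small_struct c p R' Q') k)" if k: "k \<in> {1..2 * pairs \<sigma>}" for k
  proof -
    define u where "u = (k + 1) div 2"
    have u: "u \<ge> 1" "k = 2 * u - 1 \<or> k = 2 * u" using k unfolding u_def by auto
    from u(2) show ?thesis
    proof
      assume "k = 2 * u - 1"
      then show ?thesis using T_rel_small_struct(1)[OF u(1)] tr1 by (simp only:)
    next
      assume "k = 2 * u"
      then show ?thesis using T_rel_small_struct(2)[OF u(1)] tr2 by (simp only:)
    qed
  qed
  show "T_rel (small_struct c p R' Q') (2 * u) = (T_rel (small_struct c p R' Q') (2 * u - 1))\<inverse>"
    if "u \<in> {1..pairs \<sigma>}" for u
  proof -
    have "u \<ge> 1" using that by simp
    then show ?thesis unfolding T_rel_small_struct[OF \<open>u \<ge> 1\<close>] by auto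
  qed
qed

lemma symbols_\<phi>: "P \<in> fm_symbols \<phi> \<Longrightarrow> P \<in> symbols \<sigma>"
proof -
  have "unfo \<sigma> \<psi> \<Longrightarrow> fm_symbols \<psi> \<subseteq> symbols \<sigma>" for \<psi> by (induction \<psi>) auto
  then show "P \<in> fm_symbols \<phi> \<Longrightarrow> P \<in> symbols \<sigma>" using unfo by blast
qed

text \<open>Each binary symbol becomes a directed relation, in the same way on both sides; inverses
  and both argument orders are then treated uniformly by \<open>flip\<close>.\<close>

lemma binary_atoms:
  assumes P: "P \<in> fm_symbols \<phi>" and ar: "arity \<sigma> P = 2"
  shows "(\<exists>w. \<forall>x y. (x < c \<longrightarrow> y < c \<longrightarrow> ([x, y] \<in> interp (small_struct c p R' Q') P \<longleftrightarrow> dirrel Q' w x y)) \<and>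
             ([x, y] \<in> interp A P \<longleftrightarrow> dirrel rel_base w x y)) \<or>
         (\<exists>w\<in>labels \<times> UNIV. \<forall>x y. (x < c \<longrightarrow> y < c \<longrightarrow> ([x, y] \<in> interp (small_struct c p R' Q') P \<longleftrightarrow> dirrel R' w x y)) \<and>
             ([x, y] \<in> interp A P \<longleftrightarrow> dirrel rel_T w x y))"
proof (cases P)
  case (Base q)
  then show ?thesis using P ar
    by (intro disjI1 exI[of _ "(q, True)"]) (auto simp: small_struct_def dirrel_def rel_base_def)
next
  case (T k)
  have k: "k \<in> {1..2 * pairs \<sigma>}" using symbols_\<phi>[OF P] T by (auto simp: symbols_def)
  define u where "u = (k + 1) div 2"
  have u: "1 \<le> u" "u \<le> pairs \<sigma>" "k = 2 * u - 1 \<or> k = 2 * u" using k unfolding u_def by auto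
  have ul: "u \<in> labels" using u P T by (auto simp: labels_def)
  have n1: "[x, y] \<in> interp (small_struct c p R' Q') (T k) \<longleftrightarrow> (x, y) \<in> T_rel (small_struct c p R' Q') k" for x y
    by (simp add: T_rel_def)
  from u(3) show ?thesis
  proof
    assume k: "k = 2 * u - 1"
    have "T_rel (small_struct c p R' Q') k = {(x, y). x < c \<and> y < c \<and> u \<in> labels \<and> R' u x y}"
      unfolding k by (rule T_rel_small_struct(1)[OF u(1)])
    moreover have "[x, y] \<in> interp A (T k) \<longleftrightarrow> rel_T u x y" for x y by (simp only: k rel_T_def)
    ultimately show ?thesis
      using ul T by (intro disjI2 bexI[of _ "(u, True)"]) (simp_all add: n1 dirrel_def)
  next
    assume k: "k = 2 * u"
    have "T_rel (small_struct c p R' Q') k = {(x, y). x < c \<and> y < c \<and> u \<in> labels \<and> R' u y x}"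
      unfolding k by (rule T_rel_small_struct(2)[OF u(1)])
    moreover have "[x, y] \<in> interp A (T k) \<longleftrightarrow> rel_T u y x" for x y
      unfolding k using T_conv u by simp
    ultimately show ?thesis
      using ul T by (intro disjI2 bexI[of _ "(u, False)"]) (simp_all add: n1 dirrel_def)
  qed
qed

lemma tp_atom:
  assumes "one_type a = one_type b" "P \<in> fm_symbols \<phi>"
  shows "[a] \<in> interp A P \<longleftrightarrow> [b] \<in> interp A P" "[a, a] \<in> interp A P \<longleftrightarrow> [b, b] \<in> interp A P"
proof -
  have "Atom P [0] \<in> type_formulas" "Atom P [0, 0] \<in> type_formulas" using assms(2) by (auto simp: type_formulas_def)
  moreover have "Atom P [0] \<in> one_type a \<longleftrightarrow> Atom P [0] \<in> one_type b" "Atom P [0, 0] \<in> one_type a \<longleftrightarrow> Atom P [0, 0] \<in> one_type b"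
    using assms(1) by simp_all
  ultimately show "[a] \<in> interp A P \<longleftrightarrow> [b] \<in> interp A P" "[a, a] \<in> interp A P \<longleftrightarrow> [b, b] \<in> interp A P"
    by (simp_all add: one_type_def)
qed

lemma short_lists:
  assumes "set xs \<subseteq> {0, 1 :: nat}" "length xs \<le> 2"
  shows "xs = [] \<or> (\<exists>z\<in>{0, 1}. xs = [z]) \<or> (\<exists>z\<in>{0, 1}. xs = [z, z]) \<or> xs = [0, 1] \<or> xs = [1, 0]"
proof -
  consider "xs = []" | a where "xs = [a]" | a b where "xs = [a, b]"
    using assms(2) by (cases xs; cases "tl xs"; cases "tl (tl xs)") auto
  then show ?thesis using assms(1) by cases auto
qed

lemma no_nullary_unary_T: "P \<in> fm_symbols \<phi> \<Longrightarrow> arity \<sigma> P \<noteq> 2 \<Longrightarrow> \<exists>q. P = Base q"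
  by (cases P) auto

text \<open>Nullary atoms are copied, and unary and loop atoms agree by equality of types, so only
  atoms on both variables need hypotheses; one argument order suffices because of
  \<open>flip\<close>.\<close>

lemma local_hom_small_struct:
  assumes ap: "approx {} (universe A) {..<c} p R' Q'"
    and v: "\<And>z. z \<in> {0, 1} \<Longrightarrow> v z < c" and tv: "\<And>z. z \<in> {0, 1} \<Longrightarrow> one_type (v' z) = one_type (p (v z))"
  shows "(v 0 = v 1 \<Longrightarrow> v' 0 = v' 1) \<Longrightarrow>
      (\<forall>w\<in>labels \<times> UNIV. dirrel R' w (v 0) (v 1) \<longrightarrow> dirrel rel_T w (v' 0) (v' 1)) \<Longrightarrow>
      (\<forall>w. dirrel Q' w (v 0) (v 1) \<longrightarrow> dirrel rel_base w (v' 0) (v' 1)) \<Longrightarrow> local_hom (small_struct c p R' Q') v A v'"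
    and "(v' 0 = v' 1 \<Longrightarrow> v 0 = v 1) \<Longrightarrow>
      (\<forall>w\<in>labels \<times> UNIV. dirrel rel_T w (v' 0) (v' 1) \<longrightarrow> dirrel R' w (v 0) (v 1)) \<Longrightarrow>
      (\<forall>w. dirrel rel_base w (v' 0) (v' 1) \<longrightarrow> dirrel Q' w (v 0) (v 1)) \<Longrightarrow> local_hom A v' (small_struct c p R' Q') v"
proof -
  let ?B = "small_struct c p R' Q'"
  have nul: "[] \<in> interp ?B P \<longleftrightarrow> [] \<in> interp A P" if "P \<in> fm_symbols \<phi>" "arity \<sigma> P = 0" for P
    using that no_nullary_unary_T[of P] by (auto simp: small_struct_def)
  have un: "[v z] \<in> interp ?B P \<longleftrightarrow> [v' z] \<in> interp A P"
    if "P \<in> fm_symbols \<phi>" "arity \<sigma> P = 1" "z \<in> {0, 1}" for P z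
  proof -
    have "[v z] \<in> interp ?B P \<longleftrightarrow> [p (v z)] \<in> interp A P"
      using that no_nullary_unary_T[of P] v by (auto simp: small_struct_def)
    then show ?thesis using tp_atom(1)[OF tv[OF that(3)] that(1)] by simp
  qed
  have lp: "[v z, v z] \<in> interp ?B P \<longleftrightarrow> [v' z, v' z] \<in> interp A P"
    if "P \<in> fm_symbols \<phi>" "arity \<sigma> P = 2" "z \<in> {0, 1}" for P z
  proof -
    have vz: "v z \<in> {..<c}" using v that by simp
    have a: "dirrel Q' w (v z) (v z) \<longleftrightarrow> dirrel rel_base w (p (v z)) (p (v z))" for w
      using approxD(6)[OF ap vz] by (simp add: dirrel_def)
    have b: "dirrel R' w (v z) (v z) \<longleftrightarrow> dirrel rel_T w (p (v z)) (p (v z))" if "w \<in> labels \<times> UNIV" for w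
      using approxD(5)[OF ap _ vz] that by (auto simp: dirrel_def)
    have "[v z, v z] \<in> interp ?B P \<longleftrightarrow> [p (v z), p (v z)] \<in> interp A P"
      using binary_atoms[OF that(1,2), of c p R' Q']
    proof (elim disjE exE bexE)
      fix w assume "\<forall>x y. (x < c \<longrightarrow> y < c \<longrightarrow> ([x, y] \<in> interp ?B P \<longleftrightarrow> dirrel Q' w x y)) \<and>
             ([x, y] \<in> interp A P \<longleftrightarrow> dirrel rel_base w x y)"
      then show ?thesis using v[OF that(3)] a[of w] by simp
    next
      fix w assume "w \<in> labels \<times> UNIV"
        "\<forall>x y. (x < c \<longrightarrow> y < c \<longrightarrow> ([x, y] \<in> interp ?B P \<longleftrightarrow> dirrel R' w x y)) \<and>
             ([x, y] \<in> interp A P \<longleftrightarrow> dirrel rel_T w x y)"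
      then show ?thesis using v[OF that(3)] b[of w] by simp
    qed
    then show ?thesis using tp_atom(2)[OF tv[OF that(3)] that(1)] by simp
  qed
  have v01: "v 0 < c" "v 1 < c" using v by auto
  have ar: "arity \<sigma> P \<le> 2" if "P \<in> fm_symbols \<phi>" for P using two that by (simp add: two_variable_def)
  {
    assume eq: "v 0 = v 1 \<Longrightarrow> v' 0 = v' 1"
      and r: "\<forall>w\<in>labels \<times> UNIV. dirrel R' w (v 0) (v 1) \<longrightarrow> dirrel rel_T w (v' 0) (v' 1)"
      and q: "\<forall>w. dirrel Q' w (v 0) (v 1) \<longrightarrow> dirrel rel_base w (v' 0) (v' 1)"
    have r': "dirrel rel_T w (v' 1) (v' 0)" if "w \<in> labels \<times> UNIV" "dirrel R' w (v 1) (v 0)" for w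
      using r[rule_format, of "flip w"] that by (simp add: dirrel_flip mem_Times_iff)
    have q': "dirrel rel_base w (v' 1) (v' 0)" if "dirrel Q' w (v 1) (v 0)" for w
      using q[rule_format, of "flip w"] that by (simp add: dirrel_flip)
    have bin: "([v 0, v 1] \<in> interp ?B P \<longrightarrow> [v' 0, v' 1] \<in> interp A P) \<and>
        ([v 1, v 0] \<in> interp ?B P \<longrightarrow> [v' 1, v' 0] \<in> interp A P)"
      if "P \<in> fm_symbols \<phi>" "arity \<sigma> P = 2" for P
      using binary_atoms[OF that, of c p R' Q']
    proof (elim disjE exE bexE)
      fix w assume "\<forall>x y. (x < c \<longrightarrow> y < c \<longrightarrow> ([x, y] \<in> interp ?B P \<longleftrightarrow> dirrel Q' w x y)) \<and>
             ([x, y] \<in> interp A P \<longleftrightarrow> dirrel rel_base w x y)"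
      then show ?thesis using v01 q[rule_format, of w] q'[of w] by simp
    next
      fix w assume "w \<in> labels \<times> UNIV"
        "\<forall>x y. (x < c \<longrightarrow> y < c \<longrightarrow> ([x, y] \<in> interp ?B P \<longleftrightarrow> dirrel R' w x y)) \<and>
             ([x, y] \<in> interp A P \<longleftrightarrow> dirrel rel_T w x y)"
      then show ?thesis using v01 r[rule_format, of w] r'[of w] by simp
    qed
    show "local_hom ?B v A v'"
      unfolding local_hom_def
    proof (intro conjI ballI allI impI)
      fix P xs assume P: "P \<in> fm_symbols \<phi>" and xs: "set xs \<subseteq> {0, 1}" "length xs = arity \<sigma> P"
        and m: "map v xs \<in> interp ?B P"
      have "length xs \<le> 2" using xs(2) ar[OF P] by simp
      from short_lists[OF xs(1) this] show "map v' xs \<in> interp A P"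
      proof (elim disjE bexE)
        assume "xs = []"
        then show ?thesis using nul[OF P] xs(2) m by simp
      next
        fix z :: nat assume "z \<in> {0, 1}" "xs = [z]"
        then show ?thesis using un[OF P, of z] xs(2) m by simp
      next
        fix z :: nat assume "z \<in> {0, 1}" "xs = [z, z]"
        then show ?thesis using lp[OF P, of z] xs(2) m by simp
      qed (use bin[OF P] xs(2) m in simp_all)
    qed (use eq in auto)
  }
  {
    assume eq: "v' 0 = v' 1 \<Longrightarrow> v 0 = v 1"
      and r: "\<forall>w\<in>labels \<times> UNIV. dirrel rel_T w (v' 0) (v' 1) \<longrightarrow> dirrel R' w (v 0) (v 1)"
      and q: "\<forall>w. dirrel rel_base w (v' 0) (v' 1) \<longrightarrow> dirrel Q' w (v 0) (v 1)"
    have r': "dirrel R' w (v 1) (v 0)" if "w \<in> labels \<times> UNIV" "dirrel rel_T w (v' 1) (v' 0)" for w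
      using r[rule_format, of "flip w"] that by (simp add: dirrel_flip mem_Times_iff)
    have q': "dirrel Q' w (v 1) (v 0)" if "dirrel rel_base w (v' 1) (v' 0)" for w
      using q[rule_format, of "flip w"] that by (simp add: dirrel_flip)
    have bin: "([v' 0, v' 1] \<in> interp A P \<longrightarrow> [v 0, v 1] \<in> interp ?B P) \<and>
        ([v' 1, v' 0] \<in> interp A P \<longrightarrow> [v 1, v 0] \<in> interp ?B P)"
      if "P \<in> fm_symbols \<phi>" "arity \<sigma> P = 2" for P
      using binary_atoms[OF that, of c p R' Q']
    proof (elim disjE exE bexE)
      fix w assume "\<forall>x y. (x < c \<longrightarrow> y < c \<longrightarrow> ([x, y] \<in> interp ?B P \<longleftrightarrow> dirrel Q' w x y)) \<and>
             ([x, y] \<in> interp A P \<longleftrightarrow> dirrel rel_base w x y)"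
      then show ?thesis using v01 q[rule_format, of w] q'[of w] by simp
    next
      fix w assume "w \<in> labels \<times> UNIV"
        "\<forall>x y. (x < c \<longrightarrow> y < c \<longrightarrow> ([x, y] \<in> interp ?B P \<longleftrightarrow> dirrel R' w x y)) \<and>
             ([x, y] \<in> interp A P \<longleftrightarrow> dirrel rel_T w x y)"
      then show ?thesis using v01 r[rule_format, of w] r'[of w] by simp
    qed
    show "local_hom A v' ?B v"
      unfolding local_hom_def
    proof (intro conjI ballI allI impI)
      fix P xs assume P: "P \<in> fm_symbols \<phi>" and xs: "set xs \<subseteq> {0, 1}" "length xs = arity \<sigma> P"
        and m: "map v' xs \<in> interp A P"
      have "length xs \<le> 2" using xs(2) ar[OF P] by simp
      from short_lists[OF xs(1) this] show "map v xs \<in> interp ?B P"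
      proof (elim disjE bexE)
        assume "xs = []"
        then show ?thesis using nul[OF P] xs(2) m by simp
      next
        fix z :: nat assume "z \<in> {0, 1}" "xs = [z]"
        then show ?thesis using un[OF P, of z] xs(2) m by simp
      next
        fix z :: nat assume "z \<in> {0, 1}" "xs = [z, z]"
        then show ?thesis using lp[OF P, of z] xs(2) m by simp
      qed (use bin[OF P] xs(2) m in simp_all)
    qed (use eq in auto)
  }
qed

end

section \<open>Preservation of formulas and the bound\<close>

lemma subformulas_closed:
  "And \<psi> \<chi> \<in> set (subformulas \<phi>) \<Longrightarrow> \<psi> \<in> set (subformulas \<phi>) \<and> \<chi> \<in> set (subformulas \<phi>)"
  "Or \<psi> \<chi> \<in> set (subformulas \<phi>) \<Longrightarrow> \<psi> \<in> set (subformulas \<phi>) \<and> \<chi> \<in> set (subformulas \<phi>)"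
  "Exists z \<psi> \<in> set (subformulas \<phi>) \<Longrightarrow> \<psi> \<in> set (subformulas \<phi>)"
  "Neg \<psi> \<in> set (subformulas \<phi>) \<Longrightarrow> \<psi> \<in> set (subformulas \<phi>)"
  by (induction \<phi>) (auto simp: subformulas_self)

context unfo_model begin

lemma one_free_var:
  assumes "\<psi> \<in> set (subformulas \<phi>)" "free_vars \<psi> \<subseteq> {z}"
  obtains w where "w \<in> {0, 1}" "free_vars \<psi> \<subseteq> {w}"
proof -
  have "free_vars \<psi> \<subseteq> {0, 1}"
    using free_vars_all_vars[of \<psi>] subformulas_props(2)[OF assms(1)] two by (auto simp: two_variable_def)
  then have "(free_vars \<psi> \<subseteq> {0}) \<or> (free_vars \<psi> \<subseteq> {1})" using assms(2) by auto
  then show thesis using that by blast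
qed

lemma sat_one_type:
  assumes "\<psi> \<in> set (subformulas \<phi>)" "free_vars \<psi> \<subseteq> {w}"
  shows "sat A v \<psi> \<longleftrightarrow> \<psi> \<in> one_type (v w)"
proof -
  have "sat A v \<psi> \<longleftrightarrow> sat A (\<lambda>_. v w) \<psi>" by (rule sat_cong) (use assms(2) in auto)
  then show ?thesis using assms(1) by (simp add: one_type_def type_formulas_def)
qed

context
  fixes c :: nat and p :: "nat \<Rightarrow> nat" and R' Q' :: "nat \<Rightarrow> nat \<Rightarrow> nat \<Rightarrow> bool"
  assumes ap: "approx {} (universe A) {..<c} p R' Q'"
begin

abbreviation "A' \<equiv> small_struct c p R' Q'"

lemma universe_small_struct: "universe A' = {..<c}" by (simp add: small_struct_def)

text \<open>Loops are exact in an approximation, so single elements are compared in both directions.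
  This is what lets unary negation through.\<close>

lemma local_hom_const:
  assumes "x < c"
  shows "local_hom A' (\<lambda>_. x) A (\<lambda>_. p x)" "local_hom A (\<lambda>_. p x) A' (\<lambda>_. x)"
proof -
  have r: "dirrel R' w x x \<longleftrightarrow> dirrel rel_T w (p x) (p x)" if "w \<in> labels \<times> UNIV" for w
    using approxD(5)[OF ap, of "fst w" x] assms that by (auto simp: dirrel_def)
  have q: "dirrel Q' w x x \<longleftrightarrow> dirrel rel_base w (p x) (p x)" for w
    using approxD(6)[OF ap, of x] assms by (simp add: dirrel_def)
  show "local_hom A' (\<lambda>_. x) A (\<lambda>_. p x)"
    by (rule local_hom_small_struct(1)[OF ap]) (simp_all add: assms r q)
  show "local_hom A (\<lambda>_. p x) A' (\<lambda>_. x)"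
    by (rule local_hom_small_struct(2)[OF ap]) (simp_all add: assms r q)
qed

lemma p_universe: "x < c \<Longrightarrow> p x \<in> universe A"
  using approxD(2)[OF ap] by simp

lemma local_hom_exists:
  assumes "v 0 < c" "v 1 < c"
  obtains v' where "\<forall>z\<in>{0, 1}. one_type (v' z) = one_type (p (v z))" "\<forall>z. v' z \<in> universe A"
    "local_hom A' v A v'"
proof (cases "v 0 = v 1")
  \<comment> \<open>The clause on pairs in \<open>approx\<close> concerns distinct elements; a
    repeated element is sent along \<open>p\<close>.\<close>
  case True
  have eq: "z \<in> {0, 1} \<Longrightarrow> v z = v 0" for z using True by auto
  have m: "map v xs = map (\<lambda>_. v 0) xs" if "set xs \<subseteq> {0, 1}" for xs
    by (intro map_cong refl eq) (use that in blast)
  have "local_hom A' v A (\<lambda>_. p (v 0))"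
    unfolding local_hom_def
  proof (intro conjI ballI allI impI)
    fix P xs assume "P \<in> fm_symbols \<phi>" "set xs \<subseteq> {0, 1}" "length xs = arity \<sigma> P"
      "map v xs \<in> interp A' P"
    then show "map (\<lambda>_. p (v 0)) xs \<in> interp A P"
      using local_hom_const(1)[OF assms(1)] unfolding local_hom_def by (simp only: m)
  qed simp
  moreover have "\<forall>z\<in>{0, 1}. one_type (p (v 0)) = one_type (p (v z))" using True by simp
  ultimately show thesis using p_universe[OF assms(1)] by (intro that[of "\<lambda>_. p (v 0)"]) simp_all
next
  case False
  have l: "v 0 \<in> {..<c}" "v 1 \<in> {..<c}" using assms by simp_all
  obtain a b where ab: "a \<in> universe A" "b \<in> universe A" "one_type a = one_type (p (v 0))" "one_type b = one_type (p (v 1))"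
    and r: "\<forall>w\<in>labels \<times> UNIV. dirrel R' w (v 0) (v 1) \<longrightarrow> dirrel rel_T w a b"
    and q: "\<forall>w. dirrel Q' w (v 0) (v 1) \<longrightarrow> dirrel rel_base w a b"
    using approxD(8)[OF ap l False] by blast
  define v' :: "nat \<Rightarrow> nat" where "v' = (\<lambda>_. b)(0 := a)"
  have v': "v' 0 = a" "v' 1 = b" "\<And>z. v' z \<in> universe A" using ab by (simp_all add: v'_def)
  have t: "one_type (v' z) = one_type (p (v z))" if "z \<in> {0, 1}" for z using that v' ab by auto
  have vc: "v z < c" if "z \<in> {0, 1}" for z using that assms by auto
  have lh: "local_hom A' v A v'"
  proof (rule local_hom_small_struct(1)[OF ap vc t])
    show "v 0 = v 1 \<Longrightarrow> v' 0 = v' 1" using False by blast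
    show "\<forall>w\<in>labels \<times> UNIV. dirrel R' w (v 0) (v 1) \<longrightarrow> dirrel rel_T w (v' 0) (v' 1)" unfolding v'(1,2) by (rule r)
    show "\<forall>w. dirrel Q' w (v 0) (v 1) \<longrightarrow> dirrel rel_base w (v' 0) (v' 1)" unfolding v'(1,2) by (rule q)
  qed
  show thesis using t v'(3) lh by (intro that[of v']) blast+
qed

lemma local_hom_witness:
  assumes "x < c" "z \<in> {0, 1}" "\<psi>' = Exists z \<psi>" "\<psi>' \<in> set (subformulas \<phi>)" "sat A (\<lambda>_. p x) \<psi>'"
  obtains b y where "b \<in> universe A" "y < c" "sat A ((\<lambda>_. p x)(z := b)) \<psi>" "one_type (p y) = one_type b"
    "local_hom A ((\<lambda>_. p x)(z := b)) A' ((\<lambda>_. x)(z := y))"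
proof -
  obtain i where i: "i < length (subformulas \<phi>)" "subformulas \<phi> ! i = Exists z \<psi>"
    using assms(3,4) by (auto simp: in_set_conv_nth)
  define b where "b = witness i (p x)"
  have b: "b \<in> universe A" "sat A ((\<lambda>_. p x)(z := b)) \<psi>"
    using witness_sat[OF i(2)] assms(3,5) unfolding b_def by auto
  have l: "x \<in> {..<c}" using assms(1) by simp
  obtain y where y: "y < c" "one_type (p y) = one_type b" "b = p x \<longrightarrow> y = x"
    and r: "\<forall>w\<in>labels \<times> UNIV. dirrel rel_T w (p x) b \<longrightarrow> dirrel R' w x y"
    and q: "\<forall>w. dirrel rel_base w (p x) b \<longrightarrow> dirrel Q' w x y"
    using approxD(9)[OF ap l i(1) b(1)[unfolded b_def]] unfolding b_def by blast
  have r': "\<forall>w\<in>labels \<times> UNIV. dirrel rel_T w b (p x) \<longrightarrow> dirrel R' w y x"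
  proof (intro ballI impI)
    fix w :: "nat \<times> bool" assume "w \<in> labels \<times> UNIV" "dirrel rel_T w b (p x)"
    then show "dirrel R' w y x" using r[rule_format, of "flip w"] by (simp add: dirrel_flip mem_Times_iff)
  qed
  have q': "\<forall>w. dirrel rel_base w b (p x) \<longrightarrow> dirrel Q' w y x"
  proof (intro allI impI)
    fix w :: "nat \<times> bool" assume "dirrel rel_base w b (p x)"
    then show "dirrel Q' w y x" using q[rule_format, of "flip w"] by (simp add: dirrel_flip)
  qed
  let ?v = "(\<lambda>_. x)(z := y)" and ?v' = "(\<lambda>_. p x)(z := b)"
  have "local_hom A ?v' A' ?v"
  proof (rule local_hom_small_struct(2)[OF ap])
    \<comment> \<open>An element that is its own witness must be matched by itself, or an equality
      atom would be lost.\<close>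
    show "?v' 0 = ?v' 1 \<Longrightarrow> ?v 0 = ?v 1" using assms(2) y(3) by auto
    show "\<forall>w\<in>labels \<times> UNIV. dirrel rel_T w (?v' 0) (?v' 1) \<longrightarrow> dirrel R' w (?v 0) (?v 1)"
      using assms(2)
    proof
      assume "z = 0" then show ?thesis using r' by simp
    next
      assume "z \<in> {1}" then show ?thesis using r by simp
    qed
    show "\<forall>w. dirrel rel_base w (?v' 0) (?v' 1) \<longrightarrow> dirrel Q' w (?v 0) (?v 1)"
      using assms(2)
    proof
      assume "z = 0" then show ?thesis using q' by simp
    next
      assume "z \<in> {1}" then show ?thesis using q by simp
    qed
  qed (simp_all add: assms(1) y(1,2))
  then show thesis by (rule that[OF b(1) y(1) b(2) y(2)])
qed

text \<open>Both directions are proved together because negation exchanges them. The truth in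
  \<open>A\<close> of a formula with at most one free variable is read off the type, so at a
  quantifier or a negation the given assignment may be replaced by another of the same type: by the
  pair realising two elements when going to \<open>A\<close>, by the chosen witness when coming from
  \<open>A\<close>.\<close>

lemma preservation:
  assumes "\<psi> \<in> set (subformulas \<phi>)"
    and "\<forall>z\<in>{0, 1}. v z < c" "\<forall>z\<in>{0, 1}. one_type (v' z) = one_type (p (v z))"
  shows "(local_hom A' v A v' \<longrightarrow> sat A' v \<psi> \<longrightarrow> sat A v' \<psi>) \<and>
         (local_hom A v' A' v \<longrightarrow> sat A v' \<psi> \<longrightarrow> sat A' v \<psi>)"
  using assms
proof (induction \<psi> arbitrary: v v')
  case (Atom P xs)
  have "P \<in> fm_symbols \<phi>" "set xs \<subseteq> {0, 1}" "length xs = arity \<sigma> P"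
    using subformulas_props(1)[OF Atom.prems(1) unfo] subformulas_props(2,3)[OF Atom.prems(1)] two
    by (auto simp: two_variable_def)
  then show ?case unfolding local_hom_def sat.simps by blast
next
  case (Eq x y)
  have xy: "x = 0 \<or> x = 1" "y = 0 \<or> y = 1"
    using subformulas_props(2)[OF Eq.prems(1)] two by (auto simp: two_variable_def)
  have "local_hom A' v A v' \<longrightarrow> v 0 = v 1 \<longrightarrow> v' 0 = v' 1" "local_hom A v' A' v \<longrightarrow> v' 0 = v' 1 \<longrightarrow> v 0 = v 1"
    unfolding local_hom_def by blast+
  then show ?case using xy unfolding sat.simps by metis
next
  case (And \<psi>1 \<psi>2)
  have s: "\<psi>1 \<in> set (subformulas \<phi>)" "\<psi>2 \<in> set (subformulas \<phi>)"
    using subformulas_closed(1)[OF And.prems(1)] by blast+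
  show ?case
    using And.IH(1)[OF s(1) And.prems(2,3)] And.IH(2)[OF s(2) And.prems(2,3)]
    unfolding sat.simps by blast
next
  case (Or \<psi>1 \<psi>2)
  have s: "\<psi>1 \<in> set (subformulas \<phi>)" "\<psi>2 \<in> set (subformulas \<phi>)"
    using subformulas_closed(2)[OF Or.prems(1)] by blast+
  show ?case
    using Or.IH(1)[OF s(1) Or.prems(2,3)] Or.IH(2)[OF s(2) Or.prems(2,3)]
    unfolding sat.simps by blast
next
  case (Exists z \<psi>)
  have sub: "\<psi> \<in> set (subformulas \<phi>)" by (rule subformulas_closed(3)[OF Exists.prems(1)])
  have av: "z \<in> {0, 1}" "all_vars \<psi> \<subseteq> {0, 1}"
    using subformulas_props(2)[OF Exists.prems(1)] two by (auto simp: two_variable_def)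
  define w where "w = 1 - z"
  have w: "w \<in> {0, 1}" "w \<noteq> z" using av by (auto simp: w_def)
  have fv: "free_vars (Exists z \<psi>) \<subseteq> {w}"
    using free_vars_all_vars[of \<psi>] av by (auto simp: w_def)
  note st = sat_one_type[OF Exists.prems(1) fv]
  show ?case
  proof (intro conjI impI)
    assume "sat A' v (Exists z \<psi>)"
    then obtain y where y: "y < c" "sat A' (v(z := y)) \<psi>" by (auto simp: universe_small_struct)
    let ?v = "v(z := y)"
    have vc: "\<forall>u\<in>{0, 1}. ?v u < c" using y(1) Exists.prems(2) by simp
    have vc': "?v 0 < c" "?v 1 < c" using vc by simp_all
    obtain v'' where t: "\<forall>u\<in>{0, 1}. one_type (v'' u) = one_type (p (?v u))"
      and un: "\<forall>u. v'' u \<in> universe A" and lh: "local_hom A' ?v A v''"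
      by (rule local_hom_exists[OF vc'])
    have "sat A v'' \<psi>" using Exists.IH[OF sub vc t] lh y(2) by blast
    then have "sat A (v''(z := v'' z)) \<psi>" by simp
    then have "sat A v'' (Exists z \<psi>)" unfolding sat.simps using un by blast
    \<comment> \<open>\<open>v''\<close> need not agree with \<open>v'\<close>; but the quantified
      formula depends on \<open>w\<close> only, where both have the same type.\<close>
    moreover have "one_type (v'' w) = one_type (v' w)" using bspec[OF t w(1)] bspec[OF Exists.prems(3) w(1)] w(2) by simp
    ultimately show "sat A v' (Exists z \<psi>)" using st by simp
  next
    assume "sat A v' (Exists z \<psi>)"
    then have s: "sat A (\<lambda>_. p (v w)) (Exists z \<psi>)" using st bspec[OF Exists.prems(3) w(1)] by simp
    have vw: "v w < c" by (rule bspec[OF Exists.prems(2) w(1)])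
    obtain b y where bb: "b \<in> universe A" "y < c" "sat A ((\<lambda>_. p (v w))(z := b)) \<psi>" "one_type (p y) = one_type b"
      "local_hom A ((\<lambda>_. p (v w))(z := b)) A' ((\<lambda>_. v w)(z := y))"
      by (rule local_hom_witness[OF vw av(1) refl Exists.prems(1) s])
    have c2: "\<forall>u\<in>{0, 1}. ((\<lambda>_. v w)(z := y)) u < c" using bb(2) vw by simp
    have t2: "\<forall>u\<in>{0, 1}. one_type (((\<lambda>_. p (v w))(z := b)) u) = one_type (p (((\<lambda>_. v w)(z := y)) u))"
      using bb(4) by simp
    have "sat A' ((\<lambda>_. v w)(z := y)) \<psi>"
      using Exists.IH[OF sub c2 t2] bb(3,5) by blast
    then have "sat A' (\<lambda>_. v w) (Exists z \<psi>)"
      unfolding sat.simps universe_small_struct using bb(2) by blast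
    moreover have "sat A' (\<lambda>_. v w) (Exists z \<psi>) \<longleftrightarrow> sat A' v (Exists z \<psi>)"
      by (rule sat_cong) (use fv in auto)
    ultimately show "sat A' v (Exists z \<psi>)" by blast
  qed
next
  case (Neg \<psi>)
  have sub: "\<psi> \<in> set (subformulas \<phi>)" by (rule subformulas_closed(4)[OF Neg.prems(1)])
  have "\<exists>x. free_vars \<psi> \<subseteq> {x}" using subformulas_props(1)[OF Neg.prems(1) unfo] by simp
  then obtain w where w: "w \<in> {0, 1}" "free_vars \<psi> \<subseteq> {w}" using one_free_var[OF sub] by blast
  have vw: "v w < c" by (rule bspec[OF Neg.prems(2) w(1)])
  have "sat A' v \<psi> \<longleftrightarrow> sat A' (\<lambda>_. v w) \<psi>" by (rule sat_cong) (use w in auto)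
  also have "\<dots> \<longleftrightarrow> sat A (\<lambda>_. p (v w)) \<psi>"
    using Neg.IH[OF sub, of "\<lambda>_. v w" "\<lambda>_. p (v w)"] vw local_hom_const[OF vw] by blast
  also have "\<dots> \<longleftrightarrow> sat A v' \<psi>"
    using sat_one_type[OF sub w(2)] bspec[OF Neg.prems(3) w(1)] by simp
  finally show ?case by simp
qed

lemma sentence_preserved:
  assumes "x < c" "free_vars \<phi> = {}" "sat A v \<phi>"
  shows "sat A' (\<lambda>_. x) \<phi>"
proof -
  have "sat A v \<phi> \<longleftrightarrow> sat A (\<lambda>_. p x) \<phi>" by (rule sat_cong) (use assms(2) in auto)
  then show ?thesis
    using preservation[OF subformulas_self, of "\<lambda>_. x" "\<lambda>_. p x"] assms(1) local_hom_const[OF assms(1)] assms(3) by blast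
qed

end

section \<open>Counting types and the triply exponential bound\<close>

lemma card_labels: "card labels \<le> fm_length \<phi>"
proof -
  define f where "f u = (if T (2 * u - 1) \<in> fm_symbols \<phi> then T (2 * u - 1) else T (2 * u))" for u
  have "inj_on f labels"
  proof (rule inj_onI)
    fix u w assume uw: "u \<in> labels" "w \<in> labels" "f u = f w"
    have "2 * u - 1 = 2 * w - 1 \<or> 2 * u - 1 = 2 * w \<or> 2 * u = 2 * w - 1 \<or> 2 * u = 2 * w"
      using uw(3) unfolding f_def by (simp only: symbol.inject simp_thms split: if_splits)
    then show "u = w" using labels_pos(1)[OF uw(1)] labels_pos(1)[OF uw(2)] by presburger
  qed
  moreover have "f ` labels \<subseteq> fm_symbols \<phi>" by (auto simp: f_def labels_def)
  ultimately have "card labels \<le> card (fm_symbols \<phi>)"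
    using finite_fm_symbols by (intro card_inj_on_le) auto
  then show ?thesis using card_fm_symbols order_trans by blast
qed

lemma card_type_formulas: "finite type_formulas" "card type_formulas \<le> 3 * fm_length \<phi>"
proof -
  let ?s = "fm_symbols \<phi>"
  show "finite type_formulas" using finite_fm_symbols by (simp add: type_formulas_def)
  have "card type_formulas \<le> card (set (subformulas \<phi>)) + card ((\<lambda>P. Atom P [0]) ` ?s) + card ((\<lambda>P. Atom P [0, 0]) ` ?s)"
    unfolding type_formulas_def by (rule order_trans[OF card_Un_le add_right_mono[OF card_Un_le]])
  also have "\<dots> \<le> fm_length \<phi> + fm_length \<phi> + fm_length \<phi>"
    using card_length[of "subformulas \<phi>"] length_subformulas[of \<phi>] card_fm_symbols[of \<phi>]
      card_image_le[OF finite_fm_symbols, of "\<lambda>P. Atom P [0]" \<phi>]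
      card_image_le[OF finite_fm_symbols, of "\<lambda>P. Atom P [0, 0]" \<phi>] by linarith
  finally show "card type_formulas \<le> 3 * fm_length \<phi>" by simp
qed

text \<open>With \<open>k\<close> the length, there are at most \<open>2 ^ (3 * k)\<close> types and
  \<open>2 ^ (2 * k)\<close> sets \<open>V\<close>, hence \<open>2 ^ (5 * k)\<close> pairs, and an
  enriched type is a type with a set of pairs.\<close>

lemma card_etype: "card (etype ` universe A) \<le> 2 ^ (2 ^ (6 * fm_length \<phi>))"
proof -
  let ?n = "fm_length \<phi>" and ?L = "Pow (labels \<times> (UNIV :: bool set))"
  have finL: "finite labels" by (rule fin_I)
  have sub: "etype ` universe A \<subseteq> Pow type_formulas \<times> Pow (?L \<times> Pow type_formulas)"
  proof -
    have "one_type a \<subseteq> type_formulas" for a by (auto simp: one_type_def)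
    then show ?thesis unfolding etype_def by auto
  qed
  have fin: "finite (Pow type_formulas \<times> Pow (?L \<times> Pow type_formulas))" using finL card_type_formulas(1) by simp
  have n1: "1 \<le> ?n" by (cases \<phi>) auto
  have cL: "card ?L \<le> 2 ^ (2 * ?n)"
    using card_labels finL by (simp add: card_Pow card_cartesian_product mult.commute)
  have cT: "card (Pow type_formulas) \<le> 2 ^ (3 * ?n)" using card_type_formulas by (simp add: card_Pow)
  have "card (?L \<times> Pow type_formulas) \<le> 2 ^ (2 * ?n) * 2 ^ (3 * ?n)"
    using cL cT by (simp only: card_cartesian_product) (rule mult_le_mono)
  also have "\<dots> = 2 ^ (5 * ?n)" by (simp add: power_add[symmetric])
  finally have "card (Pow (?L \<times> Pow type_formulas)) \<le> 2 ^ (2 ^ (5 * ?n))"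
    using finL card_type_formulas(1) by (simp add: card_Pow)
  with cT have "card (Pow type_formulas) * card (Pow (?L \<times> Pow type_formulas)) \<le> 2 ^ (3 * ?n) * 2 ^ (2 ^ (5 * ?n))"
    by (rule mult_le_mono)
  then have "card (Pow type_formulas \<times> Pow (?L \<times> Pow type_formulas)) \<le> 2 ^ (3 * ?n + 2 ^ (5 * ?n))"
    by (simp only: card_cartesian_product power_add)
  also have "\<dots> \<le> 2 ^ (2 ^ (6 * ?n))"
  proof (intro power_increasing)
    have "3 * ?n \<le> 5 * ?n" by simp
    also have "\<dots> \<le> 2 ^ (5 * ?n)" using less_exp[of "5 * ?n"] by simp
    finally have "3 * ?n + 2 ^ (5 * ?n) \<le> 2 ^ Suc (5 * ?n)" by simp
    also have "\<dots> \<le> (2 :: nat) ^ (6 * ?n)" using n1 by (intro power_increasing) auto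
    finally show "3 * ?n + 2 ^ (5 * ?n) \<le> (2 :: nat) ^ (6 * ?n)" .
  qed simp
  finally show ?thesis using card_mono[OF fin sub] by simp
qed

text \<open>With \<open>E = 2 ^ (6 * k)\<close> the size is at most \<open>2\<close> to the power
  \<open>2 ^ (2 * E + (k + E + 5) * Suc k)\<close>, and the inner exponent is at most
  \<open>E * (2 * k + 4)\<close>. For \<open>4 \<le> k\<close> the second factor is at most
  \<open>2 ^ k\<close>, whence \<open>7 * k\<close>.\<close>

lemma final_bound:
  assumes "4 \<le> k" "length us \<le> Suc k" "j \<le> k" "length (subformulas \<phi>) \<le> k"
  shows "bound_base us (2 ^ (2 ^ (6 * k))) ^ ((2 * Suc (modulus us (2 ^ (2 ^ (6 * k))))) ^ Suc j)
    \<le> 2 ^ (2 ^ (2 ^ (7 * k)))"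
proof -
  define E :: nat where "E = 2 ^ (6 * k)"
  let ?N = "2 ^ E :: nat" and ?l = "length us"
  have k2: "2 * k + 4 \<le> 2 ^ k" using assms(1)
  proof (induction k rule: dec_induct)
    case (step m) then show ?case by simp
  qed simp
  have l: "?l \<le> 2 ^ k" "Suc (length (subformulas \<phi>)) \<le> 2 ^ k" using k2 assms by linarith+
  have E: "2 * k + 4 \<le> E" "2 ^ 6 \<le> E"
  proof -
    have "(2 :: nat) ^ k \<le> E" unfolding E_def by (intro power_increasing) auto
    then show "2 * k + 4 \<le> E" using k2 by linarith
    show "2 ^ 6 \<le> E" unfolding E_def using assms(1) by (intro power_increasing) auto
  qed
  have SN: "Suc ?N \<le> 2 ^ Suc E" by simp
  have lSN: "?l * Suc ?N \<le> 2 ^ (k + Suc E)"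
    unfolding power_add by (rule mult_le_mono[OF l(1) SN])
  have m: "modulus us ?N \<le> 2 ^ (k + E + 3)"
  proof -
    have "modulus us ?N \<le> 4 * 2 ^ (k + Suc E)" unfolding modulus_def using lSN by simp
    also have "\<dots> = 2 ^ (k + E + 3)" by (simp add: power_add)
    finally show ?thesis .
  qed
  have q: "bound_base us ?N \<le> 2 ^ (3 * k + 2 * E + 5)"
  proof -
    have "?l * 2 * ?N \<le> 2 ^ k * 2 * ?N" using l(1) by simp
    moreover have "1 \<le> 2 ^ k * 2 * ?N" by simp
    ultimately have "1 + ?l * 2 * ?N \<le> 2 ^ k * 2 * ?N + 2 ^ k * 2 * ?N" by linarith
    also have "\<dots> = 2 ^ (k + E + 2)" by (simp add: power_add)
    finally have 1: "1 + ?l * 2 * ?N \<le> 2 ^ (k + E + 2)" .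
    have "bound_base us ?N = modulus us ?N * (1 + ?l * 2 * ?N) * Suc (length (subformulas \<phi>))"
      by (simp add: bound_base_def modulus_def)
    also have "\<dots> \<le> 2 ^ (k + E + 3) * 2 ^ (k + E + 2) * 2 ^ k"
      by (intro mult_le_mono m 1 l)
    also have "\<dots> = 2 ^ (3 * k + 2 * E + 5)" by (simp only: power_add[symmetric]) (simp add: algebra_simps)
    finally show ?thesis .
  qed
  have e: "(2 * Suc (modulus us ?N)) ^ Suc j \<le> 2 ^ ((k + E + 5) * Suc k)"
  proof -
    have "2 * Suc x \<le> 4 * y" if "x \<le> y" "1 \<le> y" for x y :: nat using that by simp
    from this[OF m] have "2 * Suc (modulus us ?N) \<le> 4 * 2 ^ (k + E + 3)" by simp
    also have "\<dots> = 2 ^ (k + E + 5)" by (simp add: power_add)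
    finally have "(2 * Suc (modulus us ?N)) ^ Suc j \<le> (2 ^ (k + E + 5)) ^ Suc j" by (rule power_mono) simp
    also have "\<dots> = 2 ^ ((k + E + 5) * Suc j)" by (simp only: power_mult)
    also have "\<dots> \<le> 2 ^ ((k + E + 5) * Suc k)"
      using assms(3) by (intro power_increasing mult_le_mono) auto
    finally show ?thesis .
  qed
  have "bound_base us ?N ^ ((2 * Suc (modulus us ?N)) ^ Suc j)
    \<le> (2 ^ (3 * k + 2 * E + 5)) ^ ((2 * Suc (modulus us ?N)) ^ Suc j)" using q by (rule power_mono) simp
  also have "\<dots> \<le> (2 ^ (3 * k + 2 * E + 5)) ^ (2 ^ ((k + E + 5) * Suc k))"
    using e by (rule power_increasing) simp
  also have "\<dots> = 2 ^ ((3 * k + 2 * E + 5) * 2 ^ ((k + E + 5) * Suc k))" by (simp only: power_mult)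
  also have "\<dots> \<le> 2 ^ (2 ^ (2 ^ (7 * k)))"
  proof (rule power_increasing)
    have "3 * k + 2 * E + 5 \<le> 2 ^ (2 * E)"
    proof -
      have "3 * k + 2 * E + 5 \<le> 4 * E" using E(1) by linarith
      also have "\<dots> \<le> 2 * 2 ^ E * 2" using less_exp[of E] by linarith
      also have "\<dots> = 2 ^ (E + 2)" by (simp add: power_add)
      also have "\<dots> \<le> 2 ^ (2 * E)" using E(2) by (intro power_increasing) auto
      finally show ?thesis .
    qed
    then have "(3 * k + 2 * E + 5) * 2 ^ ((k + E + 5) * Suc k) \<le> 2 ^ (2 * E) * 2 ^ ((k + E + 5) * Suc k)"
      by (rule mult_le_mono1)
    also have "\<dots> = 2 ^ (2 * E + (k + E + 5) * Suc k)" by (simp only: power_add)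
    also have "\<dots> \<le> 2 ^ (2 ^ (7 * k))"
    proof (rule power_increasing)
      have "k + E + 5 \<le> 2 * E" using E(1) assms(1) by linarith
      then have "2 * E + (k + E + 5) * Suc k \<le> 2 * E + 2 * E * Suc k" by (intro add_left_mono mult_le_mono1)
      also have "\<dots> = E * (2 * k + 4)" by (simp add: algebra_simps)
      also have "\<dots> \<le> E * 2 ^ k" using k2 by (rule mult_le_mono2)
      also have "\<dots> = 2 ^ (7 * k)" unfolding E_def by (simp add: power_add[symmetric])
      finally show "2 * E + (k + E + 5) * Suc k \<le> 2 ^ (7 * k)" .
    qed simp
    finally show "(3 * k + 2 * E + 5) * 2 ^ ((k + E + 5) * Suc k) \<le> 2 ^ (2 ^ (7 * k))" .
  qed simp
  finally show ?thesis unfolding E_def .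
qed

lemma small_model:
  assumes "4 \<le> fm_length \<phi>" "free_vars \<phi> = {}" "sat A v \<phi>"
  shows "\<exists>(B :: nat struct) x. admissible \<sigma> B \<and> finite (universe B) \<and> x \<in> universe B \<and> sat B (\<lambda>_. x) \<phi> \<and>
    card (universe B) \<le> 2 ^ (2 ^ (2 ^ (7 * fm_length \<phi>)))"
proof -
  let ?k = "fm_length \<phi>"
  obtain a where a: "a \<in> universe A" using adm by (auto simp: admissible_def is_struct_def)
  \<comment> \<open>The leading \<open>0\<close> keeps the list nonempty if there are no labels.
    Labels are positive, so at the levels of \<open>0\<close> the blocks are single points.\<close>
  define us where "us = 0 # sorted_list_of_set labels"
  have us: "labels \<subseteq> set us" "us \<noteq> []" "length us \<le> Suc ?k"
    using fin_I card_labels by (auto simp: us_def)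
  have "approximable (bound_base us (2 ^ (2 ^ (6 * ?k))) ^ ((2 * Suc (modulus us (2 ^ (2 ^ (6 * ?k))))) ^ Suc (card labels)))
      {} (universe A) a"
    using a by (intro approximable_bound[OF us(1,2) card_etype]) (auto simp: total_class_def)
  then obtain c p R' Q' where
    c: "c \<le> bound_base us (2 ^ (2 ^ (6 * ?k))) ^ ((2 * Suc (modulus us (2 ^ (2 ^ (6 * ?k))))) ^ Suc (card labels))"
    and ap: "approx {} (universe A) {..<c::nat} p R' Q'" and ca: "a \<in> p ` {..<c}"
    unfolding approximable_def by blast
  have c0: "0 < c" using ca by auto
  have "c \<le> 2 ^ (2 ^ (2 ^ (7 * ?k)))"
    using c final_bound[OF assms(1) us(3) card_labels length_subformulas] by (rule order_trans)
  moreover have "sat (small_struct c p R' Q') (\<lambda>_. 0) \<phi>" using sentence_preserved[OF ap c0 assms(2,3)] .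
  moreover have "universe (small_struct c p R' Q') = {..<c}" by (simp add: small_struct_def)
  ultimately show ?thesis
    using admissible_small_struct[OF ap c0] c0 by (intro exI[of _ "small_struct c p R' Q'"] exI[of _ 0]) simp
qed

end

theorem theorem6:
  "\<exists>p :: nat poly. \<forall>(\<sigma> :: signature) (\<phi> :: fm).
     unfo \<sigma> \<phi> \<and> two_variable \<sigma> \<phi> \<and> finitely_satisfiable \<sigma> \<phi> \<longrightarrow>
     (\<exists>A :: nat struct. admissible_model \<sigma> A \<phi> \<and> finite (universe A) \<and>
        card (universe A) \<le> 2 ^ (2 ^ (2 ^ poly p (fm_length \<phi>))))"
proof (intro exI[of _ "[:28, 7:]"] allI impI, elim conjE)
  fix \<sigma> \<phi>
  assume u: "unfo \<sigma> \<phi>" and t: "two_variable \<sigma> \<phi>" and f: "finitely_satisfiable \<sigma> \<phi>"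
  obtain A :: "nat struct" and v where A: "admissible \<sigma> A" "finite (universe A)" "range v \<subseteq> universe A" "sat A v \<phi>"
    using f by (auto simp: finitely_satisfiable_def admissible_model_def)
  \<comment> \<open>Free variables are read existentially, so the closure is equivalent. Two
    quantifiers add 4 to the length: this gives \<open>7 * (k + 4) = 28 + 7 * k\<close> and the
    lower bound 4 on the length.\<close>
  define \<phi>' where "\<phi>' = Exists 0 (Exists 1 \<phi>)"
  have "unfo \<sigma> \<phi>'" "two_variable \<sigma> \<phi>'" using u t by (auto simp: \<phi>'_def two_variable_def)
  then interpret unfo_model \<sigma> \<phi>' A using A by unfold_locales
  have fv: "free_vars \<phi>' = {}"
    using t free_vars_all_vars[of \<phi>] by (auto simp: \<phi>'_def two_variable_def)
  have "v(0 := v 0, 1 := v 1) = v" by simp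
  then have "sat A (v(0 := v 0, 1 := v 1)) \<phi>" using A(4) by metis
  then have "sat A v \<phi>'" unfolding \<phi>'_def sat.simps using A(3) by blast
  moreover have "4 \<le> fm_length \<phi>'" by (simp add: \<phi>'_def)
  ultimately obtain B :: "nat struct" and x where B: "admissible \<sigma> B" "finite (universe B)"
    "x \<in> universe B" "sat B (\<lambda>_. x) \<phi>'" "card (universe B) \<le> 2 ^ (2 ^ (2 ^ (7 * fm_length \<phi>')))"
    using small_model[OF _ fv] by blast
  obtain a b where ab: "a \<in> universe B" "b \<in> universe B" "sat B ((\<lambda>_. x)(0 := a, 1 := b)) \<phi>"
    using B(4) unfolding \<phi>'_def sat.simps by blast
  have "range ((\<lambda>_. x)(0 := a, 1 := b)) \<subseteq> universe B" using ab B(3) by auto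
  then have "admissible_model \<sigma> B \<phi>" unfolding admissible_model_def using B(1) ab(3) by blast
  moreover have "7 * fm_length \<phi>' = poly [:28, 7:] (fm_length \<phi>)" by (simp add: \<phi>'_def)
  ultimately show "\<exists>A :: nat struct. admissible_model \<sigma> A \<phi> \<and> finite (universe A) \<and>
        card (universe A) \<le> 2 ^ (2 ^ (2 ^ poly [:28, 7:] (fm_length \<phi>)))"
    using B(2,5) by metis
qed

end
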